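(* Let $Z(t) = \chi^{-1/2}(\tfrac12+it)\,\zeta(\tfrac12+it)$ denote Hardy's function for real $t$, where $\zeta$ is the Riemann zeta-function and $\chi(s) = 2^s\pi^{s-1}\sin(\tfrac12\pi s)\,\Gamma(1-s)$. Then for every $\varepsilon > 0$, $$\int_0^T Z(t)\,dt = O_\varepsilon\bigl(T^{\frac14+\varepsilon}\bigr)\qquad (T\to\infty),$$ that is, for every $\varepsilon>0$ there exist constants $C_\varepsilon>0$ and $T_0(\varepsilon)>0$ such that $\left|\int_0^T Z(t)\,dt\right| \le C_\varepsilon\, T^{\frac14+\varepsilon}$ for all $T\ge T_0(\varepsilon)$.
   Context: $\zeta(s)$ is the Riemann zeta-function (given by $\sum_{n\ge1} n^{-s}$ for $\Re s>1$ and continued analytically). With $\chi(s) = 2^s\pi^{s-1}\sin(\tfrac12\pi s)\,\Gamma(1-s)$, the functional equation reads $\zeta(s)=\chi(s)\zeta(1-s)$, and $\chi(s)\chi(1-s)=1$. Hence $|\chi(\tfrac12+it)|=1$ for real $t$, $|Z(t)|=|\zeta(\tfrac12+it)|$, and $Z(t)$ is real-valued. The function $\chi^{-1/2}(\tfrac12+it)$ of real $t$ is the continuous branch of $(\chi(\tfrac12+it))^{-1/2}$ which equals $1$ at $t=0$ (note $\chi(\tfrac12)=1$). Equivalently, $Z(t)=e^{i\theta(t)}\zeta(\tfrac12+it)$, where $\theta$ is the continuous real function with $\theta(0)=0$ and $\chi(\tfrac12+it)=e^{-2i\theta(t)}$ (the Riemann–Siegel theta function). *)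

theory Defs
  imports "HOL-Complex_Analysis.Complex_Analysis"
begin

(* The value at the pole s = 1 is pinned to 0 only to make the description unique;
   see zeta_unique. *)
definition zeta :: "complex \<Rightarrow> complex" where
  "zeta = (THE f. f holomorphic_on (- {1}) \<and>
                  (\<forall>s. Re s > 1 \<longrightarrow> (\<lambda>n. of_nat (Suc n) powr (- s)) sums f s) \<and>
                  f 1 = 0)"

definition chi :: "complex \<Rightarrow> complex" where
  "chi s = 2 powr s * of_real pi powr (s - 1) * sin (of_real pi * s / 2) * Gamma (1 - s)"

(* The continuous branch of chi(1/2 + it)^(-1/2) with value 1 at t = 0;
   see chi_inv_sqrt_ex1. *)
definition chi_inv_sqrt :: "real \<Rightarrow> complex" where
  "chi_inv_sqrt = (THE g. continuous_on UNIV g \<and>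
                          (\<forall>t. (g t)\<^sup>2 = inverse (chi (Complex (1/2) t))) \<and>
                          g 0 = 1)"

(* Complex-valued by type; its values are real by the functional equation. *)
definition hardy_Z :: "real \<Rightarrow> complex" where
  "hardy_Z t = chi_inv_sqrt t * zeta (Complex (1/2) t)"

lemma zeta_unique:
  assumes "f holomorphic_on (- {1})" "g holomorphic_on (- {1})"
    and "\<And>s. Re s > 1 \<Longrightarrow> (\<lambda>n. of_nat (Suc n) powr (- s)) sums f s"
    and "\<And>s. Re s > 1 \<Longrightarrow> (\<lambda>n. of_nat (Suc n) powr (- s)) sums g s"
    and "f 1 = 0" "g 1 = 0"
  shows "f = g"
proof
  fix s :: complex
  have eq: "f z = g z" if "Re z > 1" for z
    using sums_unique2[OF assms(3)[OF that] assms(4)[OF that]] .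
  show "f s = g s"
  proof (cases "s = 1")
    case False
    have "f s = g s"
    proof (rule analytic_continuation_open[where f = f and g = g and s = "{s. Re s > 1}" and s' = "- {1}"])
      show "open {s. Re s > 1}" by (rule open_halfspace_Re_gt)
      show "{s. Re s > 1} \<noteq> {}" by (auto intro!: exI[of _ 2])
      show "connected (- {1 :: complex})"
        by (rule connected_punctured_universe) simp
    qed (use assms(1,2) False eq in \<open>auto intro!: open_Compl\<close>)
    then show ?thesis .
  qed (use assms in simp)
qed

lemma chi_half: "chi (1/2) = 1"
proof -
  have "sin (of_real pi * (1/2 :: complex) / 2) = of_real (sin (pi / 4))"
    by (simp flip: sin_of_real)
  moreover have "(2 :: complex) powr (1/2) = of_real (sqrt 2)"
    by (metis csqrt_conv_powr of_real_numeral of_real_sqrt zero_le_numeral)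
  moreover have "of_real pi powr (1/2 - 1 :: complex) = of_real (1 / sqrt pi)"
  proof -
    have "of_real pi powr (1/2 - 1 :: complex) = of_real (pi powr (- 1/2))"
      by (subst powr_of_real[symmetric]) auto
    also have "pi powr (- 1/2) = 1 / sqrt pi"
      by (simp add: powr_minus_divide powr_half_sqrt)
    finally show ?thesis .
  qed
  moreover have "Gamma (1 - 1/2 :: complex) = of_real (sqrt pi)"
    by (simp add: Gamma_one_half_complex)
  ultimately have "chi (1/2) =
      of_real (sqrt 2 * (1 / sqrt pi) * sin (pi / 4) * sqrt pi)"
    unfolding chi_def by simp
  also have "sqrt 2 * (1 / sqrt pi) * sin (pi / 4) * sqrt pi = 1"
    by (simp add: sin_45)
  finally show ?thesis by simp
qed

lemma chi_critical_line_nonzero: "chi (Complex (1/2) t) \<noteq> 0"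
proof -
  let ?s = "Complex (1/2) t"
  have "1 - ?s \<notin> \<int>\<^sub>\<le>\<^sub>0"
    by (auto elim!: nonpos_Ints_cases simp: complex_eq_iff)
  then have "Gamma (1 - ?s) \<noteq> 0" by (simp add: Gamma_eq_zero_iff)
  moreover have "sin (of_real pi * ?s / 2) \<noteq> 0"
  proof
    assume "sin (of_real pi * ?s / 2) = 0"
    then obtain n :: int where "of_real pi * ?s / 2 = of_real (of_int n * pi)"
      unfolding sin_eq_0 by blast
    then have "Re (of_real pi * ?s / 2) = Re (of_real (of_int n * pi))" by (rule arg_cong)
    then have "1 = 4 * (of_int n :: real)" by simp
    then have "1 = 4 * n" by linarith
    then show False by presburger
  qed
  ultimately show ?thesis by (simp add: chi_def)
qed

lemma continuous_chi_critical_line: "continuous_on UNIV (\<lambda>t. chi (Complex (1/2) t))"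
proof -
  have "1 - Complex (1/2) t \<notin> \<int>\<^sub>\<le>\<^sub>0" for t
    by (auto elim!: nonpos_Ints_cases simp: complex_eq_iff)
  then have "continuous_on UNIV (\<lambda>t. Gamma (1 - Complex (1/2) t))"
    by (intro continuous_at_imp_continuous_on ballI isCont_Gamma)
       (auto simp: Complex_eq intro!: continuous_intros)
  then show ?thesis
    unfolding chi_def by (intro continuous_on_mult) (auto simp: Complex_eq intro!: continuous_intros)
qed

lemma chi_inv_sqrt_ex1:
  "\<exists>!g. continuous_on UNIV g \<and> (\<forall>t. (g t)\<^sup>2 = inverse (chi (Complex (1/2) t))) \<and> g 0 = 1"
proof -
  have chi0: "chi (Complex (1/2) 0) = 1" 
    using chi_half by (simp add: Complex_eq)
  obtain g :: "real \<Rightarrow> complex" where g: "continuous_on UNIV g"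
      "\<And>t. inverse (chi (Complex (1/2) t)) = (g t)\<^sup>2"
  proof (rule continuous_sqrt_on_contractible)
    show "continuous_on UNIV (\<lambda>t. inverse (chi (Complex (1/2) t)))"
      using continuous_chi_critical_line chi_critical_line_nonzero
      by (intro continuous_on_inverse) auto
  qed (use chi_critical_line_nonzero in \<open>auto simp: convex_imp_contractible\<close>)
  have g0: "(g 0)\<^sup>2 = 1" using g(2)[of 0] chi0 by simp
  show ?thesis
  proof (rule ex1I[of _ "\<lambda>t. g t / g 0"])
    show "continuous_on UNIV (\<lambda>t. g t / g 0) \<and>
        (\<forall>t. (g t / g 0)\<^sup>2 = inverse (chi (Complex (1/2) t))) \<and> g 0 / g 0 = 1"
      using g g0 by (auto simp: power_divide intro!: continuous_intros)
  next
    fix h assume h: "continuous_on UNIV h \<and>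
        (\<forall>t. (h t)\<^sup>2 = inverse (chi (Complex (1/2) t))) \<and> h 0 = 1"
    define q where "q t = h t * g 0 / g t" for t
    have gnz: "g t \<noteq> 0" for t using g(2)[of t] chi_critical_line_nonzero[of t] by auto
    have q2: "(q t)\<^sup>2 = 1" for t
      using g(2)[of t] h g0 gnz[of t] by (simp add: q_def power_mult_distrib power_divide)
    have "q constant_on UNIV"
    proof (rule continuous_finite_range_constant)
      show "continuous_on UNIV q"
        unfolding q_def using g h gnz by (intro continuous_intros) auto
      show "finite (q ` UNIV)"
        by (rule finite_subset[of _ "{1, -1}"]) (use q2 in \<open>auto simp: power2_eq_1_iff\<close>)
    qed simp
    then have "q t = q 0" for t by (auto simp: constant_on_def)
    moreover have "q 0 = 1" using h gnz[of 0] by (simp add: q_def)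
    ultimately have "q t = 1" for t by simp
    then show "h = (\<lambda>t. g t / g 0)"
      using gnz by (auto simp: q_def fun_eq_iff field_simps)
  qed
qed

end

theory Submission
  imports Defs "HOL-Real_Asymp.Real_Asymp"
begin

text \<open>
  Put \<open>z = x + \<i>y\<close> with \<open>y = t/2\<close>. Stirling's formula shows that on \<open>Re z = 1/2\<close> the branch
  \<open>\<chi>\<^sup>-\<^sup>1\<^sup>/\<^sup>2\<close> is, up to a constant factor and an error \<open>O(1/t)\<close>, equal to the holomorphic function
  \<open>H(z) = \<Gamma>(z) (\<i>\<pi>)\<^sup>-\<^sup>z\<close>, so that \<open>H(z) \<zeta>(2z - 1/2)\<close> has to be integrated along \<open>Re z = 1/2\<close>, \<open>1 \<le> y \<le> Y\<close>.
  Let \<open>P = sqrt (Y/\<pi>)\<close> and split \<open>\<zeta>\<close> at \<open>N\<close>, the integer part of \<open>P\<close> minus one.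

  The terms \<open>n \<le> N\<close> are moved to the left: \<open>n\<^sup>-\<^sup>2\<^sup>z H(z)\<close> decays there, and the residues of \<open>\<Gamma>\<close> add up to
  \<open>exp (-\<i>\<pi>n\<^sup>2) = (-1)\<^sup>n\<close>. This leaves \<open>\<Sum> (-1)\<^sup>n sqrt n = O(sqrt N)\<close> and horizontal integrals whose sum is
  \<open>O(sqrt P log P)\<close>. The remainder \<open>\<zeta> - \<Sum>\<^sub>n\<^sub>\<le>\<^sub>N\<close> is moved to the right, to \<open>Re z = P\<close>. Near the critical line
  it is bounded by van der Corput's second derivative test, further to the right by absolute convergence.
  Only absolute values of \<open>H\<close> enter, and no functional equation is needed.
\<close>

section \<open>Exponential sums\<close>

text \<open>With the bound \<open>O (Y powr (1/4))\<close> for zeta, absolute values on the critical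
  line give only \<open>Y powr (5/4)\<close>. The shifts gain because at height \<open>Y\<close> the
  modulus of \<open>H z * n powr (- 2 * z)\<close> on \<open>Re z = x\<close> is about
  \<open>(Y / (pi * n^2)) powr x / sqrt Y\<close>: it falls to the left for \<open>n < P\<close>, to
  the right for \<open>n > P\<close>, and neither way for \<open>n\<close> near \<open>P\<close>.
  This fixes the cut from both sides. \<open>N \<le> P - 1\<close> keeps the factors
  \<open>P / (P - n)\<close> of the horizontal integrals summable to a logarithm;
  \<open>N \<ge> P - 2\<close> keeps \<open>(P / N) powr (2 * x)\<close> bounded up to
  \<open>x = P\<close>. The abscissa \<open>P\<close> is forced in the same way. On
  \<open>Re z = x\<close> the integrand decays away from \<open>y = Y\<close> over a length
  \<open>Y / x\<close> and has size \<open>sqrt P / x\<close>, so the vertical side contributes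
  about \<open>P^2 * sqrt P / x^2\<close>, which reaches \<open>sqrt P\<close> only for
  \<open>x\<close> of order \<open>P\<close>; much further right,
  \<open>(P / N) powr (2 * x)\<close> is no longer bounded.\<close>

lemma inverse_one_minus_cis:
  assumes "sin x \<noteq> 0"
  shows "1 / (1 - cis (2 * x)) = Complex (1/2) (cos x / sin x / 2)"
proof -
  have cs: "cis (2 * x) = Complex (1 - 2 * sin x * sin x) (2 * sin x * cos x)"
    by (simp add: complex_eq_iff cos_double_sin sin_double power2_eq_square)
  have sc: "cos x * cos x = 1 - sin x * sin x"
    using sin_cos_squared_add[of x] by (simp add: power2_eq_square)
  have "Complex (1/2) (cos x / sin x / 2) * (1 - cis (2 * x)) = 1"
    unfolding cs using assms by (simp add: complex_eq_iff field_simps) (use sc in algebra)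
  then show ?thesis
    by (metis eq_divide_eq mult_zero_right zero_neq_one)
qed

lemma cot_diff_nonneg:
  fixes a b :: real
  assumes "0 < a" "a \<le> b" "b < pi"
  shows "cos b / sin b \<le> cos a / sin a"
proof -
  have s: "sin a > 0" "sin b > 0" using assms by (auto intro: sin_gt_zero)
  have "cos a / sin a - cos b / sin b = sin (b - a) / (sin a * sin b)"
    using s by (simp add: sin_diff field_simps)
  also have "\<dots> \<ge> 0" using s assms by (auto intro!: divide_nonneg_pos sin_ge_zero)
  finally show ?thesis by simp
qed

lemma sin_pi_ge:
  fixes d x :: real
  assumes "0 < d" "d \<le> x" "x \<le> 1 - d"
  shows "sin (pi * x) \<ge> d"
proof -
  have *: "sin (pi * u) \<ge> u" if "0 < u" "u \<le> 1/2" for u :: real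
  proof -
    define v where "v = pi * u"
    have "pi * u \<le> pi * (1/2)" using that by (intro mult_left_mono) auto
    moreover have "pi * (1/2) \<le> 1.6" using pi_approx by simp
    ultimately have "v \<le> 1.6" unfolding v_def by (rule order_trans)
    then have v: "0 < v" "v \<le> 1.6" using that by (auto simp: v_def)
    \<comment> \<open>On \<open>v \<le> 1.6\<close>, a bound just above \<open>pi / 2\<close>, the
      cubic term takes away at most the share \<open>2.56 / 6\<close> of \<open>v\<close>; half of
      \<open>v \<ge> 3 * u\<close> still exceeds \<open>u\<close>.\<close>
    have "\<bar>sin v - (\<Sum>m<3. sin_coeff m * v ^ m)\<bar> \<le> inverse (fact 3) * \<bar>v\<bar> ^ 3"
      by (rule Maclaurin_sin_bound)
    then have "\<bar>sin v - v\<bar> \<le> v ^ 3 / 6"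
      using v by (simp add: sin_coeff_def eval_nat_numeral fact_numeral field_simps)
    then have "v - v ^ 3 / 6 \<le> sin v" by linarith
    moreover have "v ^ 3 \<le> v * 2.56"
    proof -
      have "v ^ 2 \<le> 1.6 ^ 2" using v by (intro power_mono) auto
      then have "v * v ^ 2 \<le> v * 1.6 ^ 2" using v by (intro mult_left_mono) auto
      then show ?thesis by (simp add: power3_eq_cube power2_eq_square)
    qed
    ultimately have "sin v \<ge> v * (1/2)" using v by (simp add: field_simps)
    moreover have "v \<ge> 3 * u" unfolding v_def using pi_gt3 that by (intro mult_right_mono) auto
    ultimately have "sin v \<ge> u" using that by linarith
    then show ?thesis by (simp add: v_def)
  qed
  show ?thesis
  proof (cases "x \<le> 1/2")
    case True then show ?thesis using *[of x] assms by auto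
  next
    case False
    have "sin (pi * x) = sin (pi * (1 - x))" by (simp add: right_diff_distrib)
    then show ?thesis using *[of "1 - x"] assms False by auto
  qed
qed

text \<open>Kuzmin-Landau inequality. With \<open>x n\<close> half the phase step, reduced by the
  integer \<open>k\<close>, \<open>c n\<close> is \<open>1 / (1 - cis (2 * x n))\<close>, so that
  \<open>e n = (e n - e (Suc n)) * c n\<close>, and summation by parts moves the differences onto
  \<open>c\<close>. All \<open>c n\<close> lie on the vertical line of real part 1/2 with half a
  cotangent as imaginary part; for monotone steps their total variation telescopes. Four values of
  size at most \<open>1 / (2 * d)\<close> remain.\<close>

lemma kuzmin_landau:
  fixes f :: "nat \<Rightarrow> real" and k :: int
  assumes "p \<le> q" and d: "0 < d"
    and g: "\<And>n. p \<le> n \<Longrightarrow> n \<le> q \<Longrightarrow> of_int k + d \<le> f (Suc n) - f n \<and> f (Suc n) - f n \<le> of_int k + 1 - d"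
    and mono: "\<And>n. p \<le> n \<Longrightarrow> n < q \<Longrightarrow> f (Suc (Suc n)) - f (Suc n) \<le> f (Suc n) - f n"
  shows "norm (\<Sum>n=p..q. cis (2 * pi * f n)) \<le> 2 / d"
proof -
  define x where "x n = pi * (f (Suc n) - f n - of_int k)" for n
  define c where "c n = Complex (1/2) (cos (x n) / sin (x n) / 2)" for n
  define e where "e n = cis (2 * pi * f n)" for n
  have sinx: "sin (x n) \<ge> d" if "p \<le> n" "n \<le> q" for n
    unfolding x_def using g[OF that] d by (intro sin_pi_ge) auto
  have xr: "0 < x n" "x n < pi" if "p \<le> n" "n \<le> q" for n
  proof -
    have "0 < f (Suc n) - f n - of_int k" "f (Suc n) - f n - of_int k < 1"
      using g[OF that] d by auto
    then show "0 < x n" "x n < pi" by (auto simp: x_def)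
  qed
  have step_eq: "e n = (e n - e (Suc n)) * c n" if "p \<le> n" "n \<le> q" for n
  proof -
    have nz: "sin (x n) \<noteq> 0" using sinx[OF that] d by auto
    have "e (Suc n) = e n * cis (2 * x n) * cis (2 * pi * of_int k)"
      by (simp add: e_def x_def cis_mult algebra_simps)
    also have "cis (2 * pi * of_int k) = 1"
      by (metis cis_multiple_2pi Ints_of_int)
    finally have "(e n - e (Suc n)) * c n = e n * ((1 - cis (2 * x n)) * c n)"
      by (simp add: algebra_simps)
    also have "(1 - cis (2 * x n)) * c n = 1"
    proof -
      have "c n = 1 / (1 - cis (2 * x n))" "c n \<noteq> 0"
        using inverse_one_minus_cis[OF nz] by (auto simp: c_def complex_eq_iff)
      then show ?thesis by auto
    qed
    finally show ?thesis by simp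
  qed
  have nc: "norm (c n) \<le> 1 / (2 * d)" if "p \<le> n" "n \<le> q" for n
  proof -
    have nz: "sin (x n) > 0" using sinx[OF that] d by auto
    have "norm (c n) = 1 / (2 * sin (x n))"
    proof -
      have "(1/2)\<^sup>2 + (cos (x n) / sin (x n) / 2)\<^sup>2 = (1 / (2 * sin (x n)))\<^sup>2"
        using nz sin_cos_squared_add[of "x n"]
        by (simp add: field_simps power2_eq_square)
      then show ?thesis using nz unfolding c_def by (simp add: cmod_def del: power_divide)
    qed
    also have "\<dots> \<le> 1 / (2 * d)" using sinx[OF that] d by (intro divide_left_mono) auto
    finally show ?thesis .
  qed
  have main: "(\<Sum>n=p..r. e n) = e p * c p - e (Suc r) * c r + (\<Sum>n\<in>{p..<r}. e (Suc n) * (c (Suc n) - c n))"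
    if "p \<le> r" "r \<le> q" for r
    using that
  proof (induction r rule: dec_induct)
    case base
    then show ?case using step_eq[of p] assms by (simp add: algebra_simps)
  next
    case (step r)
    have "(\<Sum>n=p..Suc r. e n) = (\<Sum>n=p..r. e n) + e (Suc r)"
      using step by simp
    also have "e (Suc r) = (e (Suc r) - e (Suc (Suc r))) * c (Suc r)"
      using step by (intro step_eq) auto
    also have "(\<Sum>n=p..r. e n) = e p * c p - e (Suc r) * c r + (\<Sum>n\<in>{p..<r}. e (Suc n) * (c (Suc n) - c n))"
      using step by auto
    finally have X: "(\<Sum>n=p..Suc r. e n) = e p * c p - e (Suc r) * c r + (\<Sum>n\<in>{p..<r}. e (Suc n) * (c (Suc n) - c n)) + (e (Suc r) - e (Suc (Suc r))) * c (Suc r)" .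
    show ?case unfolding X using step.hyps by (simp add: algebra_simps)
  qed
  have "norm (e (Suc n) * (c (Suc n) - c n)) = Im (c (Suc n)) - Im (c n)" if "n \<in> {p..<q}" for n
  proof -
    have "x (Suc n) \<le> x n" using mono[of n] that by (simp add: x_def)
    then have "cos (x n) / sin (x n) \<le> cos (x (Suc n)) / sin (x (Suc n))"
      using xr[of n] xr[of "Suc n"] that by (intro cot_diff_nonneg) auto
    then have "norm (c (Suc n) - c n) = Im (c (Suc n)) - Im (c n)"
      by (simp add: c_def cmod_def)
    then show ?thesis by (simp add: norm_mult e_def)
  qed
  then have "norm (\<Sum>n\<in>{p..<q}. e (Suc n) * (c (Suc n) - c n)) \<le> (\<Sum>n\<in>{p..<q}. Im (c (Suc n)) - Im (c n))"
    by (intro sum_norm_le) auto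
  also have "\<dots> = Im (c q) - Im (c p)" using \<open>p \<le> q\<close> by (rule sum_Suc_diff')
  also have "\<dots> \<le> norm (c q) + norm (c p)"
    using abs_Im_le_cmod[of "c q"] abs_Im_le_cmod[of "c p"] by auto
  finally have A: "norm (\<Sum>n\<in>{p..<q}. e (Suc n) * (c (Suc n) - c n)) \<le> norm (c q) + norm (c p)" .
  have "norm (\<Sum>n=p..q. e n) \<le> norm (c p) + norm (c q) + (norm (c q) + norm (c p))"
    unfolding main[OF \<open>p \<le> q\<close> order_refl]
    by (rule norm_triangle_mono[OF norm_triangle_le_diff A]) (simp add: norm_mult e_def)
  also have "\<dots> \<le> 2 / d"
    using nc[of p] nc[of q] \<open>p \<le> q\<close> d by (simp add: field_simps)
  finally show ?thesis by (simp add: e_def)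
qed

text \<open>Only the extreme indices matter: \<open>A\<close> lies between \<open>Min A\<close> and
  \<open>Max A\<close>, and the decrease of \<open>g\<close> between these two is at least
  \<open>l\<close> per step and at most \<open>D\<close> in total. This counts the indices at which
  the difference of a phase falls into a short window next to an integer.\<close>

lemma card_le_of_separated:
  fixes g :: "nat \<Rightarrow> real"
  assumes "finite A" and l: "0 < l" and D: "0 \<le> D"
    and sep: "\<And>m n. m \<in> A \<Longrightarrow> n \<in> A \<Longrightarrow> m \<le> n \<Longrightarrow> real (n - m) * l \<le> g m - g n"
    and rng: "\<And>m n. m \<in> A \<Longrightarrow> n \<in> A \<Longrightarrow> g m - g n \<le> D"
  shows "real (card A) \<le> D / l + 1"
proof (cases "A = {}")
  case False
  have mm: "Min A \<in> A" "Max A \<in> A" using assms False by auto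
  have "Min A \<le> Max A" using mm assms by auto
  have "A \<subseteq> {Min A..Max A}" using assms by auto
  then have "card A \<le> card {Min A..Max A}" by (intro card_mono) auto
  then have "real (card A) \<le> real (Max A - Min A) + 1" using \<open>Min A \<le> Max A\<close> by simp
  moreover have "real (Max A - Min A) * l \<le> D"
    using sep[OF mm(1,2) \<open>Min A \<le> Max A\<close>] rng[OF mm(1,2)] by simp
  ultimately have "real (card A) \<le> D / l + 1" using l by (smt (verit) pos_le_divide_eq)
  then show ?thesis .
qed (use assms in auto)

text \<open>Van der Corput's test in terms of differences. The indices are sorted by the integer
  part \<open>k\<close> of \<open>g n\<close>, at most \<open>G + 1\<close> classes. In a class, the
  windows of length \<open>d\<close> next to \<open>k\<close> and \<open>k + 1\<close> contain few
  differences because \<open>g\<close> drops by at least \<open>l\<close> per step, and their terms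
  are merely counted. The other indices of the class form an interval, on which Kuzmin-Landau gives
  \<open>2 / d\<close>. The parameter \<open>d\<close> stays free for balancing.\<close>

lemma second_derivative_test:
  fixes f :: "nat \<Rightarrow> real"
  defines "g \<equiv> (\<lambda>n. f (Suc n) - f n)"
  assumes l: "0 < l" and d: "0 < d"
    and dec: "\<And>n. a \<le> n \<Longrightarrow> Suc n < b \<Longrightarrow> l \<le> g n - g (Suc n)"
    and g0: "\<And>n. a \<le> n \<Longrightarrow> n < b \<Longrightarrow> 0 \<le> g n \<and> g n \<le> G"
    and G: "0 \<le> G"
  shows "norm (\<Sum>n\<in>{a..<b}. cis (2 * pi * f n)) \<le> (G + 1) * (2 * (d / l + 1) + 2 / d)"
proof -
  define e where "e n = cis (2 * pi * f n)" for n
  define S where "S = {a..<b}"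
  define K where "K = {0..\<lfloor>G\<rfloor>}"
  have sep: "real (n - m) * l \<le> g m - g n" if "a \<le> m" "m \<le> n" "n < b" for m n
    using that(2,3)
  proof (induction n rule: dec_induct)
    case (step n)
    then show ?case using dec[of n] \<open>a \<le> m\<close> by (simp add: Suc_diff_le algebra_simps)
  qed simp
  have mono: "g n \<le> g m" if "a \<le> m" "m \<le> n" "n < b" for m n
    using sep[OF that] l by (smt (verit) mult_nonneg_nonneg of_nat_0_le_iff)
  have each: "norm (\<Sum>n\<in>{n\<in>S. \<lfloor>g n\<rfloor> = k}. e n) \<le> 2 * (d / l + 1) + 2 / d" for k
  proof -
    \<comment> \<open>The \<open>min\<close> keeps \<open>A1\<close> inside the class when
      \<open>d > 1\<close>; \<open>A3\<close> collects what is left, so the three sets are disjoint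
      for every \<open>d > 0\<close>.\<close>
    define A1 where "A1 = {n\<in>S. of_int k \<le> g n \<and> g n < of_int k + min d 1}"
    define A2 where "A2 = {n\<in>S. of_int k + d \<le> g n \<and> g n \<le> of_int k + 1 - d}"
    define A3 where "A3 = {n\<in>S. \<lfloor>g n\<rfloor> = k} - A1 - A2"
    have fin: "finite A1" "finite A2" "finite A3" by (auto simp: A1_def A2_def A3_def S_def)
    have A3: "g n > of_int k + 1 - d \<and> g n < of_int k + 1 \<and> n \<in> S" if "n \<in> A3" for n
      using that by (auto simp: A3_def A1_def A2_def)
    have eq: "{n\<in>S. \<lfloor>g n\<rfloor> = k} = A1 \<union> (A2 \<union> A3)"
      using d by (auto simp: A3_def A1_def A2_def floor_eq_iff)
    have disj: "A1 \<inter> (A2 \<union> A3) = {}" "A2 \<inter> A3 = {}"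
      by (auto simp: A3_def A1_def A2_def)
    have c1: "real (card A1) \<le> d / l + 1"
    proof (rule card_le_of_separated[where g = g, OF fin(1) l])
      show "real (n - m) * l \<le> g m - g n" if "m \<in> A1" "n \<in> A1" "m \<le> n" for m n
        using that by (intro sep) (auto simp: A1_def S_def)
    qed (use d in \<open>auto simp: A1_def\<close>)
    have c3: "real (card A3) \<le> d / l + 1"
    proof (rule card_le_of_separated[where g = g, OF fin(3) l])
      show "real (n - m) * l \<le> g m - g n" if "m \<in> A3" "n \<in> A3" "m \<le> n" for m n
        using that A3[of m] A3[of n] by (intro sep) (auto simp: S_def)
      show "g m - g n \<le> d" if "m \<in> A3" "n \<in> A3" for m n
        using A3[OF that(1)] A3[OF that(2)] by linarith
    qed (use d in auto)
    have n1: "norm (\<Sum>n\<in>A. e n) \<le> real (card A)" for A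
      by (rule order_trans[OF norm_sum]) (simp add: e_def)
    have n2: "norm (\<Sum>n\<in>A2. e n) \<le> 2 / d"
    proof (cases "A2 = {}")
      case False
      have mm: "Min A2 \<in> A2" "Max A2 \<in> A2" using fin False by auto
      have le: "Min A2 \<le> Max A2" using mm fin by auto
      define p q where "p = Min A2" and "q = Max A2"
      \<comment> \<open>Since \<open>g\<close> is decreasing, a range condition on
        \<open>g n\<close> cuts out consecutive indices.\<close>
      have A2eq: "A2 = {p..q}" unfolding p_def q_def
      proof
        show "{Min A2..Max A2} \<subseteq> A2"
        proof
          fix n assume n: "n \<in> {Min A2..Max A2}"
          have "g (Max A2) \<le> g n" "g n \<le> g (Min A2)"
            using n mm by (auto intro!: mono simp: A2_def S_def)
          then show "n \<in> A2" using n mm by (auto simp: A2_def S_def)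
        qed
      qed (use fin in auto)
      have "norm (\<Sum>n=p..q. cis (2 * pi * f n)) \<le> 2 / d"
      proof (rule kuzmin_landau[OF le[folded p_def q_def] d, of k])
        fix n assume n: "p \<le> n" "n \<le> q"
        then have "n \<in> A2" using A2eq by auto
        then show "real_of_int k + d \<le> f (Suc n) - f n \<and> f (Suc n) - f n \<le> real_of_int k + 1 - d"
          by (auto simp: A2_def g_def)
      next
        fix n assume n: "p \<le> n" "n < q"
        have "g (Suc n) \<le> g n" using n mm[folded p_def q_def] by (intro mono) (auto simp: A2_def S_def)
        then show "f (Suc (Suc n)) - f (Suc n) \<le> f (Suc n) - f n" by (simp add: g_def)
      qed
      then show ?thesis using A2eq by (simp add: e_def)
    qed (use d in simp)
    have "(\<Sum>n\<in>{n\<in>S. \<lfloor>g n\<rfloor> = k}. e n) = (\<Sum>n\<in>A1. e n) + ((\<Sum>n\<in>A2. e n) + (\<Sum>n\<in>A3. e n))"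
      unfolding eq using fin disj by (simp add: sum.union_disjoint)
    also have "norm \<dots> \<le> (d / l + 1) + (2 / d + (d / l + 1))"
      using n1[of A1] n1[of A3] n2 c1 c3
      by (intro norm_triangle_mono) auto
    finally show ?thesis by simp
  qed
  have "(\<lambda>n. \<lfloor>g n\<rfloor>) ` S \<subseteq> K"
    using g0 by (auto simp: S_def K_def floor_mono)
  then have "(\<Sum>n\<in>S. e n) = (\<Sum>k\<in>K. \<Sum>n\<in>{n\<in>S. \<lfloor>g n\<rfloor> = k}. e n)"
    by (intro sum.group[symmetric]) (auto simp: S_def K_def)
  also have "norm \<dots> \<le> (\<Sum>k\<in>K. 2 * (d / l + 1) + 2 / d)"
    by (intro sum_norm_le each)
  also have "\<dots> = real (card K) * (2 * (d / l + 1) + 2 / d)" by simp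
  also have "\<dots> \<le> (G + 1) * (2 * (d / l + 1) + 2 / d)"
  proof (rule mult_right_mono)
    show "real (card K) \<le> G + 1" using G by (simp add: K_def)
  qed (use l d in auto)
  finally show ?thesis by (simp add: e_def S_def)
qed

section \<open>Continuation of the zeta function\<close>

lemma powr_minus_telescope:
  fixes a :: real
  assumes "a > 0" "n \<ge> 1"
  shows "a * real (Suc n) powr (- a - 1) \<le> real n powr (- a) - real (Suc n) powr (- a)"
proof -
  have "\<exists>z. real n < z \<and> z < real (Suc n) \<and>
      real (Suc n) powr (- a) - real n powr (- a) = (real (Suc n) - real n) * (- a * z powr (- a - 1))"
    using assms by (intro MVT2) (auto intro!: derivative_eq_intros)
  then obtain z where z: "real n < z" "z < real (Suc n)"
      "real (Suc n) powr (- a) - real n powr (- a) = - a * z powr (- a - 1)" by auto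
  have "real (Suc n) powr (- a - 1) \<le> z powr (- a - 1)"
    using z assms by (intro powr_mono2') auto
  then have "a * real (Suc n) powr (- a - 1) \<le> a * z powr (- a - 1)"
    using assms by (intro mult_left_mono) auto
  then show ?thesis using z(3) by linarith
qed

text \<open>The mean value theorem bounds each term by a difference of \<open>n powr (- a)\<close>,
  and these differences telescope.\<close>

lemma summable_powr_tail:
  fixes a :: real
  assumes "a > 0" "M \<ge> 1"
  shows "summable (\<lambda>n. real (Suc (n + M)) powr (- a - 1))"
    and "(\<Sum>n. real (Suc (n + M)) powr (- a - 1)) \<le> real M powr (- a) / a"
proof -
  have p: "(\<Sum>n<k. real (Suc (n + M)) powr (- a - 1)) \<le> real M powr (- a) / a" for k
  proof -
    have "(\<Sum>n<k. a * real (Suc (n + M)) powr (- a - 1))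
        \<le> (\<Sum>n<k. real (n + M) powr (- a) - real (Suc n + M) powr (- a))"
    proof (intro sum_mono)
      fix n show "a * real (Suc (n + M)) powr (- a - 1) \<le> real (n + M) powr (- a) - real (Suc n + M) powr (- a)"
        using powr_minus_telescope[of a "n + M"] assms by simp
    qed
    also have "\<dots> = real M powr (- a) - real (k + M) powr (- a)"
      using sum_lessThan_telescope'[of "\<lambda>n. real (n + M) powr (- a)" k] by simp
    also have "\<dots> \<le> real M powr (- a)" by simp
    finally show ?thesis using assms by (simp add: sum_distrib_left[symmetric] field_simps)
  qed
  show s: "summable (\<lambda>n. real (Suc (n + M)) powr (- a - 1))"
    by (rule summableI_nonneg_bounded[OF _ p]) simp
  show "(\<Sum>n. real (Suc (n + M)) powr (- a - 1)) \<le> real M powr (- a) / a"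
    by (rule suminf_le_const[OF s p])
qed

text \<open>Weierstrass M-test with majorants that may depend on the point: the series below are
  controlled uniformly near each point of an open region rather than on all of it.\<close>

lemma holomorphic_series:
  fixes f :: "nat \<Rightarrow> complex \<Rightarrow> complex"
  assumes "open S" and "\<And>n. f n holomorphic_on S"
    and bd: "\<And>x. x \<in> S \<Longrightarrow> \<exists>d>0. \<exists>h. summable h \<and> (\<forall>n. \<forall>y\<in>ball x d \<inter> S. norm (f n y) \<le> h n)"
  shows "(\<lambda>x. \<Sum>n. f n x) holomorphic_on S"
proof -
  obtain g where g: "\<forall>x\<in>S. (\<lambda>n. f n x) sums g x \<and> g field_differentiable (at x)"
  proof (rule series_differentiable_comparison_complex[OF assms(1), of f])
    show "f n field_differentiable at x" if "x \<in> S" for n x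
      using assms that holomorphic_on_imp_differentiable_at by blast
    show "\<exists>d h. 0 < d \<and> summable h \<and> range h \<subseteq> \<real>\<^sub>\<ge>\<^sub>0 \<and>
        (\<forall>\<^sub>F n in sequentially. \<forall>y\<in>ball x d \<inter> S. cmod (f n y) \<le> cmod (h n))" if x: "x \<in> S" for x
    proof -
      obtain d h where dh: "d > 0" "summable h" "\<And>n y. y \<in> ball x d \<inter> S \<Longrightarrow> norm (f n y) \<le> h n"
        using bd[OF x] by blast
      have h0: "h n \<ge> 0" for n
        using dh(3)[of x n] x dh(1) by (auto intro: order_trans[OF norm_ge_zero])
      show ?thesis
        using dh h0 by (intro exI[of _ d] exI[of _ "\<lambda>n. complex_of_real (h n)"])
          (auto simp: summable_complex_of_real)
    qed
  qed blast
  have "g holomorphic_on S"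
    using g assms(1) by (auto simp: holomorphic_on_open field_differentiable_def)
  then show ?thesis
    by (rule holomorphic_transform) (use g in \<open>auto simp: sums_iff\<close>)
qed

text \<open>The falling factorial, that is, the coefficient in the \<open>k\<close>-th derivative of
  \<open>x powr a\<close>.\<close>

definition ffact :: "nat \<Rightarrow> complex \<Rightarrow> complex" where
  "ffact k a = (\<Prod>j<k. a - of_nat j)"

text \<open>Taylor's formula with remainder on the real segment between \<open>u\<close> and
  \<open>v\<close>. The lower bound \<open>m\<close> is kept apart from \<open>u\<close> because the
  expansion is used in both directions; the condition on \<open>Re a\<close> makes the modulus of
  the last derivative nonincreasing, so it is largest at \<open>m\<close>.\<close>

lemma powr_taylor:
  fixes a :: complex and u v m :: real
  assumes m: "0 < m" "m \<le> u" "m \<le> v" and a: "Re a \<le> real N + 1"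
  shows "norm (of_real v powr a - (\<Sum>i\<le>N. ffact i a * of_real u powr (a - of_nat i) * of_real (v - u) ^ i / fact i))
     \<le> norm (ffact (Suc N) a) * m powr (Re a - real N - 1) * \<bar>v - u\<bar> ^ Suc N / fact N"
proof -
  define f where "f i x = ffact i a * x powr (a - of_nat i)" for i and x :: complex
  define S where "S = closed_segment (complex_of_real u) (of_real v)"
  have S: "\<exists>r. x = of_real r \<and> m \<le> r" if "x \<in> S" for x
  proof -
    have "x \<in> of_real ` closed_segment u v"
      using that by (simp add: S_def closed_segment_of_real)
    then show ?thesis using m by (auto simp: closed_segment_eq_real_ivl split: if_splits)
  qed
  have "norm (f 0 (of_real v) - (\<Sum>i\<le>N. f i (of_real u) * (of_real v - of_real u) ^ i / fact i))
     \<le> (norm (ffact (Suc N) a) * m powr (Re a - real N - 1)) * norm (complex_of_real v - of_real u) ^ Suc N / fact N"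
  proof (rule complex_Taylor[of S])
    show "convex S" "complex_of_real u \<in> S" "complex_of_real v \<in> S" by (auto simp: S_def)
    show "(f i has_field_derivative f (Suc i) x) (at x within S)" if xS: "x \<in> S" for i x
    proof -
      obtain r where r: "x = of_real r" "r > 0" using S[OF xS] m by force
      then have "x \<notin> \<real>\<^sub>\<le>\<^sub>0" by auto
      then show ?thesis unfolding f_def
        by (auto intro!: derivative_eq_intros simp: ffact_def algebra_simps)
    qed
    show "norm (f (Suc N) x) \<le> norm (ffact (Suc N) a) * m powr (Re a - real N - 1)" if xS: "x \<in> S" for x
    proof -
      obtain r where r: "x = of_real r" "m \<le> r" using S[OF xS] by auto
      have "norm (x powr (a - of_nat (Suc N))) = r powr (Re a - real N - 1)"
        using r m by (subst norm_powr_real_powr) (auto simp: algebra_simps)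
      also have "\<dots> \<le> m powr (Re a - real N - 1)"
        using r m a by (intro powr_mono2') auto
      finally show ?thesis by (simp add: f_def norm_mult mult_left_mono)
    qed
  qed
  also have "norm (complex_of_real v - of_real u) = \<bar>v - u\<bar>"
    by (metis norm_of_real of_real_diff)
  finally show ?thesis by (simp add: f_def ffact_def)
qed

definition dirichlet_zeta :: "complex \<Rightarrow> complex" where
  "dirichlet_zeta s = (\<Sum>n. of_nat (Suc n) powr (- s))"

lemma norm_nat_powr: "norm (of_nat (Suc n) powr s :: complex) = real (Suc n) powr Re s"
  by (subst norm_powr_real_powr) auto

lemma tendsto_nat_powr_zero:
  assumes "Re a < 0"
  shows "(\<lambda>n. of_nat (Suc n) powr a :: complex) \<longlonglongrightarrow> 0"
proof (rule tendsto_norm_zero_cancel)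
  have "(\<lambda>n. real (Suc n) powr Re a) \<longlonglongrightarrow> 0"
    using assms by real_asymp
  then show "(\<lambda>n. norm (of_nat (Suc n) powr a :: complex)) \<longlonglongrightarrow> 0"
    by (simp add: norm_nat_powr del: of_nat_Suc)
qed

lemma summable_Suc_powr:
  assumes "a > 1"
  shows "summable (\<lambda>n. real (Suc n) powr (- a))"
proof -
  have "summable (\<lambda>n. real (Suc (n + 1)) powr (- (a - 1) - 1))"
    using assms by (intro summable_powr_tail) auto
  then have "summable (\<lambda>n. real (Suc (Suc n)) powr (- a))" by simp
  then show ?thesis by (subst summable_Suc_iff[symmetric])
qed

lemma dirichlet_zeta_sums:
  assumes "Re s > 1"
  shows "(\<lambda>n. of_nat (Suc n) powr (- s)) sums dirichlet_zeta s"
  unfolding dirichlet_zeta_def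
proof (rule summable_sums, rule summable_norm_cancel)
  show "summable (\<lambda>n. norm (of_nat (Suc n) powr (- s)))"
    using summable_Suc_powr[OF assms] by (simp add: norm_nat_powr del: of_nat_Suc)
qed

lemma holomorphic_nat_powr [holomorphic_intros]:
  assumes "f holomorphic_on A"
  shows "(\<lambda>s. of_nat (Suc n) powr f s) holomorphic_on A"
proof -
  have "(of_nat (Suc n) :: complex) \<noteq> 0" by (metis of_nat_neq_0)
  then show ?thesis
    using assms unfolding powr_def by (auto intro!: holomorphic_intros simp del: of_nat_Suc)
qed

lemma holomorphic_dirichlet_zeta: "dirichlet_zeta holomorphic_on {s. Re s > 1}"
  unfolding dirichlet_zeta_def
proof (rule holomorphic_series)
  show "open {s. Re s > 1}" by (rule open_halfspace_Re_gt)
  fix x assume "x \<in> {s. Re s > 1}"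
  then have x: "Re x > 1" by simp
  define d where "d = (Re x - 1) / 2"
  show "\<exists>d>0. \<exists>h. summable h \<and>
      (\<forall>n. \<forall>y\<in>ball x d \<inter> {s. Re s > 1}. norm (of_nat (Suc n) powr (- y) :: complex) \<le> h n)"
  proof (intro exI[of _ d] exI[of _ "\<lambda>n. real (Suc n) powr (- (1 + d))"] conjI allI ballI)
    show d: "d > 0" using x by (simp add: d_def)
    show "summable (\<lambda>n. real (Suc n) powr (- (1 + d)))"
      using d by (intro summable_Suc_powr) auto
    fix n y assume "y \<in> ball x d \<inter> {s. Re s > 1}"
    then have "norm (x - y) < d" by (auto simp: dist_norm)
    then have "Re y \<ge> 1 + d" using abs_Re_le_cmod[of "x - y"] unfolding d_def minus_complex.sel abs_le_iff by (simp add: field_simps)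
    then show "norm (of_nat (Suc n) powr (- y) :: complex) \<le> real (Suc n) powr (- (1 + d))"
      by (simp add: norm_nat_powr powr_mono del: of_nat_Suc)
  qed
qed (auto intro!: holomorphic_intros)

lemma ffact_Suc: "ffact (Suc k) a = ffact k a * (a - of_nat k)"
  by (simp add: ffact_def)

text \<open>The recursion comes from expanding \<open>(n + 1) powr (1 - s)\<close> in powers of \<open>n\<close> and
  summing over \<open>n\<close>; the factor \<open>s + j - 1\<close> of the coefficients cancels the poles of
  \<open>zeta (s + j)\<close>.\<close>
lemma zeta_continuation_step:
  assumes h: "h holomorphic_on {s. Re s > 1 - real K}" "\<And>s. Re s > 1 \<Longrightarrow> h s = (s - 1) * dirichlet_zeta s"
  shows "\<exists>h'. h' holomorphic_on {s. Re s > 1 - real (Suc K)} \<and>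
    (\<forall>s. Re s > 1 \<longrightarrow> h' s = (s - 1) * dirichlet_zeta s)"
proof -
  \<comment> \<open>The Taylor remainder of order \<open>Suc K\<close> when
    \<open>(n + 2) powr (1 - s)\<close> is expanded at \<open>n + 1\<close>. Its decay makes the sum
    \<open>E\<close> holomorphic on \<open>Re s > - K\<close>, one unit further left than
    \<open>h\<close>.\<close>
  define T where "T n s = of_nat (Suc (Suc n)) powr (1 - s) -
      (\<Sum>i\<le>Suc K. ffact i (1 - s) * of_nat (Suc n) powr (1 - s - of_nat i) / fact i)" for n s
  define A where "A = {s. Re s > - real K}"
  define E where "E s = (\<Sum>n. T n s)" for s
  have Tb: "norm (T n s) \<le> norm (ffact (Suc (Suc K)) (1 - s)) * real (Suc n) powr (- Re s - real K - 1)"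
    if "s \<in> A" for n s
  proof -
    have "norm (T n s) \<le> norm (ffact (Suc (Suc K)) (1 - s)) * real (Suc n) powr (- Re s - real K - 1) / fact (Suc K)"
      using powr_taylor[of "real (Suc n)" "real (Suc n)" "real (Suc (Suc n))" "1 - s" "Suc K"] that
      by (auto simp: T_def A_def algebra_simps)
    also have "\<dots> \<le> norm (ffact (Suc (Suc K)) (1 - s)) * real (Suc n) powr (- Re s - real K - 1)"
      by (rule divide_left_mono[of 1, simplified]) (auto simp: fact_ge_1 simp del: fact_Suc)
    finally show ?thesis .
  qed
  have oA: "open A" unfolding A_def by (rule open_halfspace_Re_gt)
  have ffh: "(\<lambda>s. ffact i (1 - s)) holomorphic_on B" for i B
    unfolding ffact_def by (auto intro!: holomorphic_intros)
  have hE: "E holomorphic_on A" unfolding E_def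
  proof (rule holomorphic_series[OF oA])
    show "T n holomorphic_on A" for n
      unfolding T_def by (intro holomorphic_intros ffh) auto
    fix x assume x: "x \<in> A"
    define d where "d = (Re x + real K) / 2"
    have d: "d > 0" using x by (auto simp: d_def A_def)
    have "continuous_on (cball x d) (\<lambda>s. ffact (Suc (Suc K)) (1 - s))"
      using ffh by (rule holomorphic_on_imp_continuous_on)
    then have "bounded ((\<lambda>s. ffact (Suc (Suc K)) (1 - s)) ` cball x d)"
      by (intro compact_imp_bounded compact_continuous_image) auto
    then obtain B where B: "\<And>s. s \<in> cball x d \<Longrightarrow> norm (ffact (Suc (Suc K)) (1 - s)) \<le> B"
      by (auto simp only: bounded_iff ball_simps)
    show "\<exists>d>0. \<exists>h. summable h \<and> (\<forall>n. \<forall>y\<in>ball x d \<inter> A. norm (T n y) \<le> h n)"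
    proof (intro exI[of _ d] exI[of _ "\<lambda>n. B * real (Suc n) powr (- (1 + d))"] conjI allI ballI)
      show "summable (\<lambda>n. B * real (Suc n) powr (- (1 + d)))"
        using d by (intro summable_mult summable_Suc_powr) auto
      fix n y assume y: "y \<in> ball x d \<inter> A"
      then have "norm (x - y) < d" by (auto simp: dist_norm)
      then have "Re y \<ge> d - real K" using abs_Re_le_cmod[of "x - y"] unfolding d_def minus_complex.sel abs_le_iff by (simp add: field_simps)
      then have "real (Suc n) powr (- Re y - real K - 1) \<le> real (Suc n) powr (- (1 + d))"
        by (intro powr_mono) auto
      then show "norm (T n y) \<le> B * real (Suc n) powr (- (1 + d))"
        using y Tb[of y n] B[of y]
        by (intro order_trans[OF Tb] mult_mono) (auto intro: order_trans[OF norm_ge_zero])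
    qed (rule d)
  qed
  \<comment> \<open>The telescoped identity, solved for its \<open>j = 0\<close> term. For
    \<open>j \<ge> 1\<close>, \<open>dirichlet_zeta (s + j)\<close> carries the factor
    \<open>1 - s - j\<close> of the falling factorial and so becomes \<open>- h (s + j)\<close>,
    which is holomorphic on all of \<open>A\<close> since the argument has moved right by at least
    one.\<close>
  define h' where "h' s = E s + 1 - (\<Sum>j=1..K. ffact j (1 - s) / fact (Suc j) * h (s + of_nat j))" for s
  have "h' holomorphic_on A"
    unfolding h'_def
  proof (intro holomorphic_intros hE ffh)
    fix j assume j: "j \<in> {1..K}"
    have "h \<circ> (\<lambda>s. s + of_nat j) holomorphic_on A"
      by (rule holomorphic_on_compose_gen[OF _ h(1)]) (use j in \<open>auto intro!: holomorphic_intros simp: A_def\<close>)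
    then show "(\<lambda>s. h (s + of_nat j)) holomorphic_on A" by (simp add: o_def)
  qed (auto simp del: fact_Suc)
  moreover have "h' s = (s - 1) * dirichlet_zeta s" if s: "Re s > 1" for s
  proof -
    have "(\<lambda>n. of_nat (Suc n) powr (1 - s)) \<longlonglongrightarrow> 0"
      using s by (intro tendsto_nat_powr_zero) auto
    from telescope_sums[OF this]
    \<comment> \<open>The telescoping starts from \<open>1 powr (1 - s) = 1\<close>, which gives the
      sum \<open>-1\<close>.\<close>
    have t: "(\<lambda>n. of_nat (Suc (Suc n)) powr (1 - s) - of_nat (Suc n) powr (1 - s)) sums (- 1)" by simp
    have d: "(\<lambda>n. ffact (Suc j) (1 - s) * of_nat (Suc n) powr (1 - s - of_nat (Suc j)) / fact (Suc j)) sums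
         (ffact (Suc j) (1 - s) / fact (Suc j) * dirichlet_zeta (s + of_nat j))" for j
    proof -
      have "(\<lambda>n. ffact (Suc j) (1 - s) / fact (Suc j) * of_nat (Suc n) powr (- (s + of_nat j))) sums
         (ffact (Suc j) (1 - s) / fact (Suc j) * dirichlet_zeta (s + of_nat j))"
        using s by (intro sums_mult dirichlet_zeta_sums) auto
      then show ?thesis by (simp add: algebra_simps)
    qed
    have "(\<lambda>n. (of_nat (Suc (Suc n)) powr (1 - s) - of_nat (Suc n) powr (1 - s)) -
        (\<Sum>j\<le>K. ffact (Suc j) (1 - s) * of_nat (Suc n) powr (1 - s - of_nat (Suc j)) / fact (Suc j)))
       sums (- 1 - (\<Sum>j\<le>K. ffact (Suc j) (1 - s) / fact (Suc j) * dirichlet_zeta (s + of_nat j)))"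
      by (intro sums_diff t sums_sum d)
    also have "(\<lambda>n. (of_nat (Suc (Suc n)) powr (1 - s) - of_nat (Suc n) powr (1 - s)) -
        (\<Sum>j\<le>K. ffact (Suc j) (1 - s) * of_nat (Suc n) powr (1 - s - of_nat (Suc j)) / fact (Suc j)))
       = (\<lambda>n. T n s)"
      unfolding T_def by (subst sum.atMost_Suc_shift) (simp add: ffact_def algebra_simps)
    finally have "E s = - 1 - (\<Sum>j\<le>K. ffact (Suc j) (1 - s) / fact (Suc j) * dirichlet_zeta (s + of_nat j))"
      by (simp add: E_def sums_iff)
    also have "(\<Sum>j\<le>K. ffact (Suc j) (1 - s) / fact (Suc j) * dirichlet_zeta (s + of_nat j)) =
        (1 - s) * dirichlet_zeta s + (\<Sum>j=1..K. ffact (Suc j) (1 - s) / fact (Suc j) * dirichlet_zeta (s + of_nat j))"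
    proof -
      have "{..K} = insert 0 {1..K}" by auto
      then show ?thesis by (simp add: ffact_def)
    qed
    also have "(\<Sum>j=1..K. ffact (Suc j) (1 - s) / fact (Suc j) * dirichlet_zeta (s + of_nat j)) =
        (\<Sum>j=1..K. - (ffact j (1 - s) / fact (Suc j) * h (s + of_nat j)))"
    proof (intro sum.cong refl)
      fix j
      have hj: "h (s + of_nat j) = (s + of_nat j - 1) * dirichlet_zeta (s + of_nat j)"
        using s by (intro h) auto
      show "ffact (Suc j) (1 - s) / fact (Suc j) * dirichlet_zeta (s + of_nat j) =
         - (ffact j (1 - s) / fact (Suc j) * h (s + of_nat j))"
        unfolding hj ffact_Suc by (simp add: field_simps del: fact_Suc)
    qed
    finally show ?thesis by (simp add: h'_def sum_negf algebra_simps)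
  qed
  ultimately show ?thesis by (intro exI[of _ h']) (auto simp: A_def)
qed

text \<open>The multiples of zeta by \<open>s - 1\<close> on the growing half-planes
  \<open>A K\<close> agree by uniqueness of continuation and glue to an entire function
  \<open>H\<close>. Dividing by \<open>s - 1\<close> gives the continuation; the value at 1 is set
  to match the normalisation in the definition of \<open>zeta\<close>.\<close>

lemma zeta_continuation:
  "\<exists>f. f holomorphic_on (- {1}) \<and> (\<forall>s. Re s > 1 \<longrightarrow> f s = dirichlet_zeta s) \<and> f 1 = 0"
proof -
  define A where "A K = {s. Re s > 1 - real K}" for K
  have "\<exists>h. h holomorphic_on A K \<and> (\<forall>s. Re s > 1 \<longrightarrow> h s = (s - 1) * dirichlet_zeta s)" for K
  proof (induction K)
    case 0
    show ?case
      by (rule exI[of _ "\<lambda>s. (s - 1) * dirichlet_zeta s"])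
         (auto simp: A_def intro!: holomorphic_intros holomorphic_dirichlet_zeta)
  next
    case (Suc K)
    then show ?case unfolding A_def using zeta_continuation_step by blast
  qed
  then obtain h where h: "\<And>K. h K holomorphic_on A K"
      "\<And>K s. Re s > 1 \<Longrightarrow> h K s = (s - 1) * dirichlet_zeta s" by metis
  have oA: "open (A K)" for K unfolding A_def by (rule open_halfspace_Re_gt)
  have mono: "A K \<subseteq> A L" if "K \<le> L" for K L using that by (auto simp: A_def)
  have agree: "h K s = h L s" if "s \<in> A K" "K \<le> L" for K L s
  proof (rule analytic_continuation_open[where f = "h K" and g = "h L" and s = "{s. Re s > 1}" and s' = "A K"])
    show "open {s. Re s > 1}" by (rule open_halfspace_Re_gt)
    show "{s. Re s > 1} \<noteq> {}" by (auto intro!: exI[of _ 2])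
    show "connected (A K)" unfolding A_def by (intro convex_connected convex_halfspace_Re_gt)
    show "h L holomorphic_on A K" using h(1) mono[OF that(2)] by (rule holomorphic_on_subset)
  qed (use that oA h in \<open>auto simp: A_def\<close>)
  \<comment> \<open>The index \<open>K\<close> satisfies \<open>K \<ge> 2 - Re s > 1 - Re s\<close>,
    so \<open>s\<close> lies in \<open>A K\<close>; by \<open>agree\<close> every other admissible
    index gives the same value.\<close>
  define H where "H s = h (nat \<lceil>2 - Re s\<rceil>) s" for s
  have HA: "s \<in> A (nat \<lceil>2 - Re s\<rceil>)" for s
    unfolding A_def by (simp add: of_nat_nat) linarith
  have Hh: "H s = h K s" if "s \<in> A K" for s K
    unfolding H_def using agree[OF HA, of s K] agree[OF that, of "nat \<lceil>2 - Re s\<rceil>"]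
    by (metis nat_le_linear)
  have "H holomorphic_on (\<Union>K. A K)"
  proof (rule holomorphic_on_UN_open)
    show "H holomorphic_on A K" for K
      using h(1)[of K] by (rule holomorphic_transform) (simp add: Hh)
  qed (rule oA)
  moreover have "(\<Union>K. A K) = UNIV" using HA by auto
  ultimately have H: "H holomorphic_on UNIV" by simp
  show ?thesis
  proof (rule exI[of _ "\<lambda>s. if s = 1 then 0 else H s / (s - 1)"], intro conjI allI impI)
    have "(\<lambda>s. H s / (s - 1)) holomorphic_on (- {1})"
      using H by (auto intro!: holomorphic_intros intro: holomorphic_on_subset)
    then show "(\<lambda>s. if s = 1 then 0 else H s / (s - 1)) holomorphic_on (- {1})"
      by (rule holomorphic_transform) auto
    fix s :: complex assume "Re s > 1"
    then show "(if s = 1 then 0 else H s / (s - 1)) = dirichlet_zeta s"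
      using h(2)[of s 0] Hh[of s 0] by (auto simp: A_def)
  qed simp
qed

text \<open>The continuation found above meets the description, and \<open>zeta_unique\<close>
  leaves no other candidate.\<close>

lemma holomorphic_zeta: "zeta holomorphic_on (- {1})"
  and zeta_eq_dirichlet_zeta: "Re s > 1 \<Longrightarrow> zeta s = dirichlet_zeta s"
proof -
  obtain f where f: "f holomorphic_on (- {1})" "\<And>s. Re s > 1 \<Longrightarrow> f s = dirichlet_zeta s" "f 1 = 0"
    using zeta_continuation by blast
  have fs: "(\<lambda>n. of_nat (Suc n) powr (- s)) sums f s" if "Re s > 1" for s
    using dirichlet_zeta_sums[OF that] f(2)[OF that] by simp
  have "zeta = f"
    unfolding zeta_def
  proof (rule the_equality)
    show "f holomorphic_on (- {1}) \<and> (\<forall>s. Re s > 1 \<longrightarrow> (\<lambda>n. of_nat (Suc n) powr (- s)) sums f s) \<and> f 1 = 0"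
      using f fs by blast
    show "g = f" if "g holomorphic_on (- {1}) \<and>
        (\<forall>s. Re s > 1 \<longrightarrow> (\<lambda>n. of_nat (Suc n) powr (- s)) sums g s) \<and> g 1 = 0" for g
      using zeta_unique[of g f] that f fs by blast
  qed
  then show "zeta holomorphic_on (- {1})" "Re s > 1 \<Longrightarrow> zeta s = dirichlet_zeta s"
    using f by auto
qed

section \<open>Bounds for the zeta function\<close>

text \<open>Euler-Maclaurin summation to first order. \<open>U n s\<close> is the term at
  \<open>n + 1\<close> minus the integral of \<open>x powr (- s)\<close> over
  \<open>[n, n + 1]\<close>, hence of size \<open>norm s * n powr (- Re s - 1)\<close>, and the
  series of these from \<open>M\<close> on is holomorphic on the punctured half-plane
  \<open>Re s > 0\<close>. For \<open>Re s > 1\<close> the integrals telescope and the series equals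
  the difference inside the norm; continuation extends the equality.\<close>

lemma zeta_approx:
  assumes s: "Re s > 0" "s \<noteq> 1" and M: "M \<ge> 1"
  shows "norm (zeta s - (\<Sum>n=1..M. of_nat n powr (- s)) - of_nat M powr (1 - s) / (s - 1))
     \<le> norm s * (1 + 1 / Re s) * real M powr (- Re s)"
proof -
  define U where "U n s = of_nat (Suc n) powr (- s) - (of_nat (Suc n) powr (1 - s) - of_nat n powr (1 - s)) / (1 - s)"
    for n and s :: complex
  define A where "A = {s. Re s > 0} - {1::complex}"
  have oA: "open A" unfolding A_def by (intro open_delete open_halfspace_Re_gt)
  have Ub: "norm (U n s) \<le> norm s * real n powr (- Re s - 1)" if "s \<in> A" "n \<ge> 1" for n s
  proof -
    have s: "s \<noteq> 1" "Re s > 0" using that by (auto simp: A_def)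
    have "norm (of_nat n powr (1 - s) - of_nat (Suc n) powr (1 - s) + (1 - s) * of_nat (Suc n) powr (- s))
        \<le> norm (1 - s) * norm s * real n powr (- Re s - 1)"
    proof -
      have "norm (s * s - s) = norm (1 - s) * norm s"
        by (metis mult.commute mult_1 norm_minus_commute norm_mult right_diff_distrib)
      \<comment> \<open>Expanded at \<open>n + 1\<close> and evaluated at \<open>n\<close>, so that
        the linear term is the Dirichlet term at \<open>n + 1\<close>.\<close>
      then show ?thesis
        using powr_taylor[of "real n" "real (Suc n)" "real n" "1 - s" 1] that s
        by (simp add: ffact_def numeral_2_eq_2 algebra_simps)
    qed
    also have "of_nat n powr (1 - s) - of_nat (Suc n) powr (1 - s) + (1 - s) * of_nat (Suc n) powr (- s) = (1 - s) * U n s"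
      using s by (simp add: U_def field_simps)
    finally show ?thesis using s by (simp add: norm_mult mult.assoc)
  qed
  define E where "E s = (\<Sum>n. U (n + M) s)" for s
  have sE: "summable (\<lambda>n. norm (U (n + M) s))" "norm (E s) \<le> norm s * (1 + 1 / Re s) * real M powr (- Re s)" if "s \<in> A" for s
  proof -
    have s: "s \<noteq> 1" "Re s > 0" using that by (auto simp: A_def)
    define h where "h n = real (n + M) powr (- Re s - 1)" for n
    note t = summable_powr_tail[OF s(2) M]
    have sh: "summable h"
    proof -
      have "summable (\<lambda>n. h (Suc n))" using t(1) by (simp add: h_def)
      then show ?thesis by (simp only: summable_Suc_iff)
    qed
    have "suminf h = h 0 + (\<Sum>n. h (Suc n))" using suminf_split_head[OF sh] by simp
    also have "(\<Sum>n. h (Suc n)) \<le> real M powr (- Re s) / Re s" using t(2) by (simp add: h_def)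
    \<comment> \<open>The first majorant, split off from the tail, accounts for the \<open>1\<close>
      in \<open>1 + 1 / Re s\<close>.\<close>
    also have "h 0 \<le> real M powr (- Re s)" using M by (simp add: h_def powr_mono)
    finally have sumh: "suminf h \<le> (1 + 1 / Re s) * real M powr (- Re s)" by (simp add: algebra_simps)
    have b: "norm (U (n + M) s) \<le> norm s * h n" for n
      using Ub[OF that, of "n + M"] M by (simp add: h_def)
    show sn: "summable (\<lambda>n. norm (U (n + M) s))"
      by (rule summable_comparison_test'[OF summable_mult[OF sh, of "norm s"], of 0]) (use b in auto)
    have "norm (E s) \<le> (\<Sum>n. norm (U (n + M) s))"
      unfolding E_def by (rule summable_norm[OF sn])
    also have "\<dots> \<le> (\<Sum>n. norm s * h n)"
      by (intro suminf_le b sn summable_mult sh)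
    also have "\<dots> = norm s * suminf h" by (rule suminf_mult[OF sh])
    also have "\<dots> \<le> norm s * ((1 + 1 / Re s) * real M powr (- Re s))"
      by (intro mult_left_mono sumh) auto
    finally show "norm (E s) \<le> norm s * (1 + 1 / Re s) * real M powr (- Re s)" by (simp add: mult.assoc)
  qed
  have hE: "E holomorphic_on A" unfolding E_def
  proof (rule holomorphic_series[OF oA])
    show "U (n + M) holomorphic_on A" for n
    proof -
      obtain k where k: "n + M = Suc k" using M by (cases "n + M") auto
      show ?thesis unfolding U_def k by (intro holomorphic_intros) (auto simp: A_def)
    qed
    fix x assume x: "x \<in> A"
    define d where "d = Re x / 2"
    have d: "d > 0" using x by (auto simp: d_def A_def)
    show "\<exists>d>0. \<exists>h. summable h \<and> (\<forall>n. \<forall>y\<in>ball x d \<inter> A. norm (U (n + M) y) \<le> h n)"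
    proof (intro exI[of _ d] exI[of _ "\<lambda>n. (norm x + d) * real (n + M) powr (- d - 1)"] conjI allI ballI)
      have "summable (\<lambda>n. real (Suc n + M) powr (- d - 1))"
        using summable_powr_tail(1)[OF d M] by simp
      then show "summable (\<lambda>n. (norm x + d) * real (n + M) powr (- d - 1))"
        by (intro summable_mult) (subst summable_Suc_iff[symmetric], simp)
      fix n y assume y: "y \<in> ball x d \<inter> A"
      then have n: "norm (x - y) < d" by (auto simp: dist_norm)
      then have re: "Re y \<ge> d" using abs_Re_le_cmod[of "x - y"]
        unfolding d_def minus_complex.sel abs_le_iff by (simp add: field_simps)
      have "norm y \<le> norm x + d" using n norm_triangle_ineq2[of y x] by (simp add: norm_minus_commute)
      then have "norm y * real (n + M) powr (- Re y - 1) \<le> (norm x + d) * real (n + M) powr (- d - 1)"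
        using re M d by (intro mult_mono powr_mono) auto
      then show "norm (U (n + M) y) \<le> (norm x + d) * real (n + M) powr (- d - 1)"
        using Ub[of y "n + M"] y M by auto
    qed (rule d)
  qed
  define F where "F s = zeta s - (\<Sum>n=1..M. of_nat n powr (- s)) - of_nat M powr (1 - s) / (s - 1)" for s
  have powrh: "(\<lambda>s. of_nat n powr f s) holomorphic_on A" if "n \<ge> 1" "f holomorphic_on A" for n f
    using holomorphic_nat_powr[of f A "n - 1"] that by auto
  have "F s = E s"
  proof (rule analytic_continuation_open[where f = F and g = E and s = "{s. Re s > 1}" and s' = A])
    show "open {s. Re s > 1}" by (rule open_halfspace_Re_gt)
    show "{s. Re s > 1} \<noteq> {}" by (auto intro!: exI[of _ 2])
    show "connected A" unfolding A_def
      by (intro connected_open_delete open_halfspace_Re_gt convex_connected convex_halfspace_Re_gt) auto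
    show "F holomorphic_on A" unfolding F_def
      using M by (intro holomorphic_intros powrh holomorphic_on_subset[OF holomorphic_zeta]) (auto simp: A_def)
    fix z assume "z \<in> {s. Re s > 1}"
    then have z: "Re z > 1" "z \<noteq> 1" by auto
    have "(\<lambda>n. of_nat (Suc n) powr (1 - z)) \<longlonglongrightarrow> 0"
      using z by (intro tendsto_nat_powr_zero) auto
    then have "(\<lambda>n. of_nat n powr (1 - z)) \<longlonglongrightarrow> 0" by (subst (asm) filterlim_sequentially_Suc)
    then have "(\<lambda>n. of_nat (n + M) powr (1 - z)) \<longlonglongrightarrow> 0" by (rule LIMSEQ_ignore_initial_segment)
    from telescope_sums[OF this]
    have t: "(\<lambda>n. (of_nat (Suc (n + M)) powr (1 - z) - of_nat (n + M) powr (1 - z)) / (1 - z)) sums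
        (- (of_nat M powr (1 - z)) / (1 - z))"
      by (intro sums_divide) simp
    have "(\<lambda>n. of_nat (Suc n) powr (- z)) sums zeta z"
      using dirichlet_zeta_sums[OF z(1)] zeta_eq_dirichlet_zeta[OF z(1)] by simp
    then have "(\<lambda>n. of_nat (Suc (n + M)) powr (- z)) sums (zeta z - (\<Sum>n<M. of_nat (Suc n) powr (- z)))"
      by (rule sums_split_initial_segment)
    from sums_diff[OF this t]
    have "(\<lambda>n. U (n + M) z) sums (zeta z - (\<Sum>n<M. of_nat (Suc n) powr (- z)) + of_nat M powr (1 - z) / (1 - z))"
      by (simp add: U_def)
    moreover have "(\<Sum>n<M. of_nat (Suc n) powr (- z)) = (\<Sum>n=1..M. of_nat n powr (- z))"
      by (rule sum.reindex_bij_witness[of _ "\<lambda>n. n - 1" Suc]) auto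
    moreover have "of_nat M powr (1 - z) / (1 - z) = - (of_nat M powr (1 - z) / (z - 1))"
      by (metis minus_diff_eq divide_minus_right)
    ultimately show "F z = E z" by (simp add: F_def E_def sums_iff)
  qed (use oA hE s in \<open>auto simp: A_def\<close>)
  then show ?thesis using sE(2)[of s] s by (simp add: F_def A_def)
qed

text \<open>Abel summation: for decreasing nonnegative weights the coefficients of the partial sums
  are nonnegative and add up to \<open>w a\<close>.\<close>

lemma norm_sum_antimono_weight:
  fixes e :: "nat \<Rightarrow> complex" and w :: "nat \<Rightarrow> real"
  assumes w: "\<And>n. a \<le> n \<Longrightarrow> n < b \<Longrightarrow> w (Suc n) \<le> w n" "\<And>n. a \<le> n \<Longrightarrow> 0 \<le> w n"
    and B: "\<And>c. c \<le> b \<Longrightarrow> norm (\<Sum>n\<in>{a..<c}. e n) \<le> B" and "a \<le> b"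
  shows "norm (\<Sum>n\<in>{a..<b}. of_real (w n) * e n) \<le> w a * B"
proof -
  define S where "S c = (\<Sum>n\<in>{a..<c}. e n)" for c
  have eq: "(\<Sum>n\<in>{a..<c}. of_real (w n) * e n) =
      of_real (w c) * S c + (\<Sum>n\<in>{a..<c}. of_real (w n - w (Suc n)) * S (Suc n))" if "a \<le> c" for c
    using that
  proof (induction c rule: dec_induct)
    case (step n)
    have "S (Suc n) = S n + e n" using step by (simp add: S_def)
    then show ?case using step by (simp add: algebra_simps)
  qed (simp add: S_def)
  have "norm (\<Sum>n\<in>{a..<b}. of_real (w n) * e n) \<le> w b * B + (\<Sum>n\<in>{a..<b}. (w n - w (Suc n)) * B)"
    unfolding eq[OF \<open>a \<le> b\<close>]
  proof (intro norm_triangle_mono sum_norm_le)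
    show "norm (of_real (w b) * S b) \<le> w b * B"
      using w(2)[OF \<open>a \<le> b\<close>] B[of b] by (auto simp: norm_mult S_def intro!: mult_left_mono)
    show "norm (of_real (w n - w (Suc n)) * S (Suc n)) \<le> (w n - w (Suc n)) * B" if "n \<in> {a..<b}" for n
      using w(1)[of n] B[of "Suc n"] that
      by (auto simp: norm_mult S_def simp flip: of_real_diff intro!: mult_left_mono)
  qed
  also have "(\<Sum>n\<in>{a..<b}. (w n - w (Suc n)) * B) = (w a - w b) * B"
    using sum_Suc_diff'[OF \<open>a \<le> b\<close>, of "\<lambda>n. - w n"]
    by (simp flip: sum_distrib_right)
  finally show ?thesis by (simp add: algebra_simps)
qed

text \<open>The phase is \<open>t / (2 * pi) * ln n\<close>. Its first differences are at most
  \<open>G\<close>; its second differences have size \<open>t / n^2\<close> and are at least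
  \<open>l\<close> on the block because \<open>n \<le> 2 * M\<close>. Taking
  \<open>d = sqrt l\<close> in the second derivative test balances \<open>d / l\<close> against
  \<open>1 / d\<close>.\<close>

lemma exponential_sum_block:
  fixes t :: real
  assumes t: "t > 0" and M: "M \<ge> 1" "sqrt t \<le> 10 * real M" and ab: "M \<le> a" "b \<le> Suc (2 * M)"
  shows "norm (\<Sum>n\<in>{a..<b}. of_nat n powr (- (\<i> * of_real t))) \<le> 44 * (sqrt t + real M / sqrt t)"
proof -
  define f where "f n = t / (2 * pi) * ln (real n)" for n
  define l where "l = t / (8 * pi * (real M)\<^sup>2)"
  define G where "G = t / (2 * pi * real M)"
  have l: "l > 0" using t M by (simp add: l_def)
  have df: "f (Suc n) - f n = t / (2 * pi) * ln (1 + 1 / real n)" if "n \<ge> 1" for n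
  proof -
    have "1 + 1 / real n = real (Suc n) / real n" using that by (simp add: field_simps)
    then show ?thesis using that by (simp add: f_def ln_div right_diff_distrib del: of_nat_Suc)
  qed
  have "norm (\<Sum>n\<in>{a..<b}. cis (2 * pi * f n)) \<le> (G + 1) * (2 * (sqrt l / l + 1) + 2 / sqrt l)"
  proof (rule second_derivative_test[OF l])
    show "0 < sqrt l" using l by simp
    show "0 \<le> G" using t by (simp add: G_def)
    fix n assume n: "a \<le> n" "n < b"
    have n1: "n \<ge> M" "real n > 0" using n ab M by auto
    have "ln (1 + 1 / real n) \<le> 1 / real n" using n1 by (intro ln_add_one_self_le_self) auto
    also have "\<dots> \<le> 1 / real M" using n1 M by (intro divide_left_mono) auto
    finally have "t / (2 * pi) * ln (1 + 1 / real n) \<le> t / (2 * pi) * (1 / real M)"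
      using t by (intro mult_left_mono) auto
    then show "0 \<le> f (Suc n) - f n \<and> f (Suc n) - f n \<le> G"
      using df[of n] n1 t M by (auto simp: G_def)
  next
    fix n assume n: "a \<le> n" "Suc n < b"
    then have n1: "n \<ge> 1" "Suc n \<le> 2 * M" using ab M by auto
    \<comment> \<open>The quotient of \<open>1 + 1 / n\<close> and \<open>1 + 1 / (n + 1)\<close> is
      \<open>1 + u\<close>, and \<open>u / (1 + u)\<close> is exactly
      \<open>1 / (n + 1)^2\<close>.\<close>
    define u where "u = 1 / (real n * (real n + 2))"
    have u: "u > 0" using n1 by (simp add: u_def)
    have "ln (1 + u) \<ge> u / (1 + u)"
    proof -
      have "ln (1 / (1 + u)) \<le> 1 / (1 + u) - 1" using u by (intro ln_le_minus_one) auto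
      then show ?thesis using u by (simp add: ln_div field_simps)
    qed
    also have "u / (1 + u) = 1 / (real (Suc n))\<^sup>2"
    proof -
      define p where "p = real n * (real n + 2)"
      have "p > 0" "(real (Suc n))\<^sup>2 = p + 1"
        using n1 by (auto simp: p_def power2_eq_square algebra_simps intro!: add_pos_pos)
      then show ?thesis by (simp add: u_def p_def[symmetric] field_simps)
    qed
    also have "1 / (real (Suc n))\<^sup>2 \<ge> 1 / (real (2 * M))\<^sup>2"
    proof -
      have "real (Suc n) \<le> real (2 * M)" using n1(2) by (simp only: of_nat_le_iff)
      then show ?thesis using M by (intro divide_left_mono power_mono mult_pos_pos zero_less_power) auto
    qed
    finally have lu: "ln (1 + u) \<ge> 1 / (real (2 * M))\<^sup>2" by simp
    have "ln (1 + 1 / real n) - ln (1 + 1 / real (Suc n)) = ln (1 + u)"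
    proof -
      have "1 + u = (1 + 1 / real n) / (1 + 1 / real (Suc n))"
        using n1 by (simp add: u_def divide_simps) (simp add: algebra_simps)
      moreover have "0 < 1 + 1 / real n" "0 < 1 + 1 / real (Suc n)" by (auto intro: add_pos_nonneg)
      ultimately show ?thesis by (simp add: ln_div)
    qed
    then have "f (Suc n) - f n - (f (Suc (Suc n)) - f (Suc n)) = t / (2 * pi) * ln (1 + u)"
      using df[of n] df[of "Suc n"] n1 by (simp only: flip: right_diff_distrib)
    also have "\<dots> \<ge> t / (2 * pi) * (1 / (real (2 * M))\<^sup>2)"
      using t lu by (intro mult_left_mono) auto
    also have "t / (2 * pi) * (1 / (real (2 * M))\<^sup>2) = l"
      by (simp add: l_def power_mult_distrib)
    finally show "l \<le> f (Suc n) - f n - (f (Suc (Suc n)) - f (Suc n))" .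
  qed
  also have "sqrt l / l = 1 / sqrt l" using l by (metis inverse_eq_divide less_imp_le real_div_sqrt sqrt_divide_self_eq)
  also have "1 / sqrt l \<le> 6 * real M / sqrt t"
  proof -
    have "sqrt (8 * pi) \<le> 6" using pi_less_4 by (intro real_le_lsqrt) auto
    have "sqrt l = sqrt t / (sqrt (8 * pi) * real M)"
      using t M by (simp add: l_def real_sqrt_divide real_sqrt_mult)
    then have "1 / sqrt l = sqrt (8 * pi) * real M / sqrt t" by simp
    also have "\<dots> \<le> 6 * real M / sqrt t"
      using \<open>sqrt (8 * pi) \<le> 6\<close> t by (intro divide_right_mono mult_right_mono) auto
    finally show ?thesis .
  qed
  then have "(G + 1) * (2 * (1 / sqrt l + 1) + 2 / sqrt l) \<le> (t / real M + 1) * (44 * real M / sqrt t)"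
  proof (intro mult_mono)
    assume l6: "1 / sqrt l \<le> 6 * real M / sqrt t"
    have "G = (t / real M) / (2 * pi)" by (simp add: G_def)
    also have "\<dots> \<le> (t / real M) / 1" using t M pi_gt3 by (intro divide_left_mono) auto
    finally show "G + 1 \<le> t / real M + 1" by simp
    have "1 \<le> 10 * real M / sqrt t" using M t by simp
    then show "2 * (1 / sqrt l + 1) + 2 / sqrt l \<le> 44 * real M / sqrt t"
    proof -
      \<comment> \<open>The hypothesis \<open>sqrt t \<le> 10 * M\<close> lets the additive constant
        be absorbed: \<open>4 * q + 2 \<le> 24 * p + 20 * p\<close>.\<close>
      define p q where "p = real M / sqrt t" and "q = 1 / sqrt l"
      have "1 \<le> 10 * p" "q \<le> 6 * p" using \<open>1 \<le> 10 * real M / sqrt t\<close> l6 by (auto simp: p_def q_def)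
      then have "2 * (q + 1) + 2 * q \<le> 44 * p" by simp
      then show ?thesis by (simp add: p_def q_def)
    qed
    show "0 \<le> t / real M + 1" using t by simp
    show "0 \<le> 2 * (1 / sqrt l + 1) + 2 / sqrt l" using l by simp
  qed
  also have "(t / real M + 1) * (44 * real M / sqrt t) = 44 * (sqrt t + real M / sqrt t)"
    using t M by (simp add: field_simps)
  finally have "norm (\<Sum>n\<in>{a..<b}. cis (2 * pi * f n)) \<le> 44 * (sqrt t + real M / sqrt t)" .
  \<comment> \<open>The test above wants nonnegative differences; conjugation reverses the sign of
    the phase and leaves the norm alone.\<close>
  also have "(\<Sum>n\<in>{a..<b}. cis (2 * pi * f n)) = cnj (\<Sum>n\<in>{a..<b}. of_nat n powr (- (\<i> * of_real t)))"
    unfolding cnj_sum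
  proof (intro sum.cong refl)
    fix n assume n: "n \<in> {a..<b}"
    have "of_nat n powr (- (\<i> * of_real t)) = exp (- (\<i> * of_real t) * of_real (ln (real n)))"
      using n ab M Ln_of_real[of "real n"] by (auto simp: powr_def)
    also have "\<dots> = cis (- (2 * pi * f n))"
      by (simp add: f_def cis_conv_exp mult_ac)
    finally show "cis (2 * pi * f n) = cnj (of_nat n powr (- (\<i> * of_real t)))"
      by (simp add: cis_cnj)
  qed
  finally show ?thesis unfolding complex_mod_cnj .
qed

text \<open>Abel summation removes the decreasing factor \<open>n powr (- Re s)\<close>; for its
  sake the unweighted bound is available on every sub-block \<open>{a..<b}\<close>.\<close>

lemma exponential_sum_block_weighted:
  fixes s :: complex
  assumes t: "Im s > 0" "Re s \<ge> 0" and M: "M \<ge> 1" "sqrt (Im s) \<le> 10 * real M"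
  shows "norm (\<Sum>n\<in>{Suc M..<Suc (2 * M)}. of_nat n powr (- s))
    \<le> real M powr (- Re s) * (44 * (sqrt (Im s) + real M / sqrt (Im s)))"
proof -
  have "norm (\<Sum>n\<in>{Suc M..<Suc (2 * M)}. of_real (real n powr (- Re s)) * of_nat n powr (- (\<i> * of_real (Im s))))
     \<le> real (Suc M) powr (- Re s) * (44 * (sqrt (Im s) + real M / sqrt (Im s)))"
  proof (rule norm_sum_antimono_weight)
    show "norm (\<Sum>n\<in>{Suc M..<c}. of_nat n powr (- (\<i> * of_real (Im s)))) \<le> 44 * (sqrt (Im s) + real M / sqrt (Im s))"
      if "c \<le> Suc (2 * M)" for c
      using that t M by (intro exponential_sum_block) auto
    show "real (Suc n) powr (- Re s) \<le> real n powr (- Re s)" if "Suc M \<le> n" for n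
      using that t by (intro powr_mono2') auto
  qed auto
  also have "real (Suc M) powr (- Re s) * (44 * (sqrt (Im s) + real M / sqrt (Im s)))
     \<le> real M powr (- Re s) * (44 * (sqrt (Im s) + real M / sqrt (Im s)))"
    using t M by (intro mult_right_mono powr_mono2') auto
  also have "(\<Sum>n\<in>{Suc M..<Suc (2 * M)}. of_real (real n powr (- Re s)) * of_nat n powr (- (\<i> * of_real (Im s)))) =
     (\<Sum>n\<in>{Suc M..<Suc (2 * M)}. of_nat n powr (- s))"
  proof (intro sum.cong refl)
    fix n assume "n \<in> {Suc M..<Suc (2 * M)}"
    then have "complex_of_real (real n powr (- Re s)) = of_nat n powr (- of_real (Re s))"
      by (subst powr_of_real[symmetric]) auto
    then have "of_real (real n powr (- Re s)) * of_nat n powr (- (\<i> * of_real (Im s))) =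
       of_nat n powr (- of_real (Re s) + - (\<i> * of_real (Im s)))"
      by (simp only: powr_add)
    also have "- of_real (Re s) + - (\<i> * of_real (Im s)) = - s"
      by (simp add: complex_eq_iff)
    finally show "of_real (real n powr (- Re s)) * of_nat n powr (- (\<i> * of_real (Im s))) = of_nat n powr (- s)" .
  qed
  finally show ?thesis .
qed

lemma sum_powers_sqrt2:
  shows "(\<Sum>j<J. 1 / sqrt (2 ^ j)) \<le> 4" and "(\<Sum>j<J. sqrt (2 ^ j)) \<le> 3 * sqrt (2 ^ J)"
proof -
  have r: "1.4 \<le> sqrt 2" by (rule real_le_rsqrt) (simp add: power2_eq_square)
  \<comment> \<open>Strengthened for the induction, which closes because
    \<open>4 / sqrt 2 \<le> 3\<close>.\<close>
  have "(\<Sum>j<J. 1 / sqrt (2 ^ j)) \<le> 4 - 4 / sqrt (2 ^ J)"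
  proof (induction J)
    case (Suc J)
    have "4 / sqrt 2 \<le> 3"
      using r by (simp add: field_simps)
    then have "4 / sqrt 2 / sqrt (2 ^ J) \<le> 3 / sqrt (2 ^ J)"
      by (intro divide_right_mono) auto
    moreover have "4 / sqrt (2 ^ Suc J) = 4 / sqrt 2 / sqrt (2 ^ J)" by (simp add: real_sqrt_mult)
    moreover have "4 / sqrt (2 ^ J) = 1 / sqrt (2 ^ J) + 3 / sqrt (2 ^ J)" by (simp flip: add_divide_distrib)
    ultimately show ?case using Suc by simp
  qed simp
  also have "\<dots> \<le> 4" by simp
  finally show "(\<Sum>j<J. 1 / sqrt (2 ^ j)) \<le> 4" .
  show "(\<Sum>j<J. sqrt (2 ^ j)) \<le> 3 * sqrt (2 ^ J)"
  proof (induction J)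
    case (Suc J)
    have "1.4 * sqrt (2 ^ J) \<le> sqrt 2 * sqrt (2 ^ J)" using r by (intro mult_right_mono) auto
    moreover have "(\<Sum>j<Suc J. sqrt (2 ^ j)) \<le> 4 * sqrt (2 ^ J)" using Suc by simp
    moreover have "3 * sqrt (2 ^ Suc J) = 3 * (sqrt 2 * sqrt (2 ^ J))" by (simp add: real_sqrt_mult)
    moreover have "0 \<le> sqrt (2 ^ J :: real)" by simp
    ultimately show ?case by linarith
  qed simp
qed

text \<open>The range \<open>n > N\<close> is cut at \<open>X\<close>, the first
  \<open>2 ^ J * N\<close> not below \<open>t powr (3/2)\<close>. At this size the error
  \<open>t * X powr (- Re s)\<close> of \<open>zeta_approx\<close> is just
  \<open>t powr (1/4)\<close> times \<open>X powr (1/2 - Re s)\<close>. Between \<open>N\<close> and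
  \<open>X\<close>, a dyadic block at \<open>M\<close> costs
  \<open>W * (sqrt (t / M) + sqrt (M / t))\<close>. Both parts sum geometrically and are governed by
  one end each: \<open>M = N\<close>, harmless by \<open>sqrt t \<le> 10 * N\<close>, and
  \<open>M = X\<close>, harmless by \<open>X \<le> 2 * t powr (3/2)\<close>. Either end is
  \<open>O (t powr (1/4))\<close>.\<close>

lemma zeta_remainder_bound:
  fixes s :: complex
  defines "t \<equiv> Im s"
  assumes t: "1 \<le> t" and s: "1/2 \<le> Re s" "Re s \<le> 2"
    and N: "N \<ge> 1" "sqrt t \<le> 10 * real N" "real N \<le> t powr (3/2)"
  shows "norm (zeta s - (\<Sum>n=1..N. of_nat n powr (- s))) \<le> 1000 * t powr (1/4) * real N powr (1/2 - Re s)"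
proof -
  define W where "W = real N powr (1/2 - Re s)"
  have W: "W \<ge> 0" by (simp add: W_def)
  define J where "J = (LEAST j. t powr (3/2) \<le> 2 ^ j * real N)"
  have "\<exists>j. t powr (3/2) \<le> 2 ^ j * real N"
  proof -
    obtain j where "t powr (3/2) < 2 ^ j" using real_arch_pow[of 2] by auto
    moreover have "2 ^ j * 1 \<le> 2 ^ j * real N" using N by (intro mult_left_mono) auto
    ultimately show ?thesis by (intro exI[of _ j]) linarith
  qed
  then have J1: "t powr (3/2) \<le> 2 ^ J * real N" unfolding J_def by (rule LeastI_ex)
  \<comment> \<open>Minimality of \<open>J\<close> bounds \<open>X\<close> from above; for
    \<open>J = 0\<close> the hypothesis \<open>N \<le> t powr (3/2)\<close> takes its place.\<close>
  have J2: "2 ^ J * real N \<le> 2 * t powr (3/2)"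
  proof (cases J)
    case (Suc j)
    have "\<not> t powr (3/2) \<le> 2 ^ j * real N" using not_less_Least[of j "\<lambda>j. t powr (3/2) \<le> 2 ^ j * real N"] Suc by (simp add: J_def)
    then show ?thesis using Suc by simp
  qed (use N in auto)
  define X where "X = 2 ^ J * N"
  have X: "real X = 2 ^ J * real N" "X \<ge> 1" using N by (auto simp: X_def)
  have Xpowr: "real X powr (1/2 - Re s) \<le> W"
    unfolding W_def using s N X by (intro powr_mono2') auto
  have s1: "s \<noteq> 1" using t by (auto simp: t_def)
  have tsq: "sqrt t = t powr (1/4) * t powr (1/4)" using t by (simp flip: powr_add powr_half_sqrt)
  have t4: "t powr (1/4) \<ge> 1" using t by (simp add: ge_one_powr_ge_zero)
  have sums: "(\<Sum>n=1..2 ^ J' * N. of_nat n powr (- s)) = (\<Sum>n=1..N. of_nat n powr (- s)) +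
       (\<Sum>j<J'. \<Sum>n\<in>{Suc (2 ^ j * N)..<Suc (2 * (2 ^ j * N))}. of_nat n powr (- s))" for J'
  proof (induction J')
    case (Suc j)
    have "{1..2 ^ Suc j * N} = {1..2 ^ j * N} \<union> {Suc (2 ^ j * N)..<Suc (2 * (2 ^ j * N))}"
      by auto
    then have "(\<Sum>n=1..2 ^ Suc j * N. of_nat n powr (- s)) = (\<Sum>n=1..2 ^ j * N. of_nat n powr (- s)) +
      (\<Sum>n\<in>{Suc (2 ^ j * N)..<Suc (2 * (2 ^ j * N))}. of_nat n powr (- s))"
      by (simp only:) (rule sum.union_disjoint, auto)
    then show ?case using Suc by simp
  qed simp
  have blk: "norm (\<Sum>n\<in>{Suc (2 ^ j * N)..<Suc (2 * (2 ^ j * N))}. of_nat n powr (- s))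
     \<le> 44 * W * (sqrt t / sqrt (real N) * (1 / sqrt (2 ^ j)) + sqrt (real N) / sqrt t * sqrt (2 ^ j))" for j
  proof -
    define M where "M = 2 ^ j * N"
    have M: "M \<ge> N" "M \<ge> 1" "real M = 2 ^ j * real N" using N by (auto simp: M_def)
    have "norm (\<Sum>n\<in>{Suc M..<Suc (2 * M)}. of_nat n powr (- s))
      \<le> real M powr (- Re s) * (44 * (sqrt (Im s) + real M / sqrt (Im s)))"
    proof (rule exponential_sum_block_weighted)
      have "10 * real N \<le> 10 * real M" using M by simp
      then show "sqrt (Im s) \<le> 10 * real M" using N(2) unfolding t_def by linarith
    qed (use t s M in \<open>auto simp: t_def\<close>)
    also have "real M powr (- Re s) = real M powr (1/2 - Re s) * (1 / sqrt (real M))"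
    proof -
      have "real M powr (- Re s) = real M powr (1/2 - Re s) * real M powr (- (1/2))"
        by (simp flip: powr_add)
      also have "real M powr (- (1/2)) = 1 / sqrt (real M)"
        using M by (simp add: powr_minus powr_half_sqrt divide_simps)
      finally show ?thesis .
    qed
    also have "real M powr (1/2 - Re s) * (1 / sqrt (real M)) * (44 * (sqrt (Im s) + real M / sqrt (Im s)))
       \<le> W * (1 / sqrt (real M)) * (44 * (sqrt (Im s) + real M / sqrt (Im s)))"
      unfolding W_def using s N M t by (intro mult_right_mono powr_mono2') (auto simp: t_def)
    also have "\<dots> = 44 * W * (sqrt t / sqrt (real M) + (real M / sqrt (real M)) / sqrt t)"
      by (simp add: t_def algebra_simps add_divide_distrib)
    also have "real M / sqrt (real M) = sqrt (real M)" by (simp add: real_div_sqrt)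
    also have "sqrt (real M) = sqrt (2 ^ j) * sqrt (real N)" by (simp add: M real_sqrt_mult)
    finally show ?thesis by (simp add: M_def mult_ac)
  qed
  have A: "norm (\<Sum>j<J. \<Sum>n\<in>{Suc (2 ^ j * N)..<Suc (2 * (2 ^ j * N))}. of_nat n powr (- s))
     \<le> 44 * W * (21 * t powr (1/4))"
  proof -
    have "norm (\<Sum>j<J. \<Sum>n\<in>{Suc (2 ^ j * N)..<Suc (2 * (2 ^ j * N))}. of_nat n powr (- s))
     \<le> (\<Sum>j<J. 44 * W * (sqrt t / sqrt (real N) * (1 / sqrt (2 ^ j)) + sqrt (real N) / sqrt t * sqrt (2 ^ j)))"
      by (intro sum_norm_le blk)
    also have "\<dots> = 44 * W * (sqrt t / sqrt (real N) * (\<Sum>j<J. 1 / sqrt (2 ^ j)) + sqrt (real N) / sqrt t * (\<Sum>j<J. sqrt (2 ^ j)))"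
      by (simp only: sum_distrib_left sum.distrib distrib_left)
    also have "\<dots> \<le> 44 * W * (sqrt t / sqrt (real N) * 4 + sqrt (real N) / sqrt t * (3 * sqrt (2 ^ J)))"
      using W t by (intro mult_left_mono add_mono sum_powers_sqrt2) auto
    also have "\<dots> \<le> 44 * W * (4 * t powr (1/4) * 4 + 5 * t powr (1/4))"
    proof (intro mult_left_mono add_mono mult_right_mono)
      \<comment> \<open>The factor 10 is rounded up to a square.\<close>
      have "sqrt (sqrt t) \<le> sqrt (16 * real N)" using N by (intro real_sqrt_le_mono) auto
      moreover have q: "sqrt (sqrt t) = t powr (1/4)"
        using t by (simp flip: powr_half_sqrt add: powr_powr)
      ultimately have "t powr (1/4) \<le> 4 * sqrt (real N)" by (simp add: real_sqrt_mult)
      then have "sqrt t \<le> t powr (1/4) * (4 * sqrt (real N))" unfolding tsq by (intro mult_left_mono) auto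
      then show "sqrt t / sqrt (real N) \<le> 4 * t powr (1/4)" using N by (simp add: field_simps)
      have "sqrt (real N) / sqrt t * (3 * sqrt (2 ^ J)) = 3 * sqrt (2 ^ J * real N) / sqrt t"
        by (simp add: real_sqrt_mult)
      also have "\<dots> \<le> 3 * sqrt (2 * t powr (3/2)) / sqrt t"
        using t J2 by (intro divide_right_mono mult_left_mono real_sqrt_le_mono) auto
      also have "sqrt (2 * t powr (3/2)) = sqrt 2 * (t powr (1/4) * sqrt t)"
        using t by (simp add: real_sqrt_mult flip: powr_half_sqrt powr_add add: powr_powr)
      also have "3 * (sqrt 2 * (t powr (1/4) * sqrt t)) / sqrt t = 3 * sqrt 2 * t powr (1/4)"
        using t by simp
      also have "\<dots> \<le> 5 * t powr (1/4)"
      proof (rule mult_right_mono)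
        have "sqrt 2 \<le> (5/3 :: real)" by (rule real_le_lsqrt) (auto simp: power2_eq_square)
        then show "3 * sqrt 2 \<le> (5::real)" by simp
      qed auto
      finally show "sqrt (real N) / sqrt t * (3 * sqrt (2 ^ J)) \<le> 5 * t powr (1/4)" .
    qed (use W in auto)
    finally show ?thesis by simp
  qed
  have B: "norm (of_nat X powr (1 - s) / (s - 1)) \<le> 2 * t powr (1/4) * W"
  proof -
    have "norm (of_nat X powr (1 - s)) = real X powr (1/2) * real X powr (1/2 - Re s)"
      using X by (subst norm_powr_real_powr) (auto simp flip: powr_add)
    also have "\<dots> \<le> real X powr (1/2) * W" using Xpowr by (intro mult_left_mono) auto
    also have "real X powr (1/2) \<le> (4 * t powr (3/2)) powr (1/2)"
      unfolding X(1) using J2 N by (intro powr_mono2) (auto intro: order_trans)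
    also have "(4 * t powr (3/2)) powr (1/2) = 2 * t powr (3/4)"
      using t by (simp add: powr_mult powr_powr powr_half_sqrt)
    finally have a: "norm (of_nat X powr (1 - s)) \<le> 2 * t powr (3/4) * W" using W by (simp add: mult_right_mono)
    have "t \<le> norm (s - 1)" using abs_Im_le_cmod[of "s - 1"] by (simp add: t_def)
    then have "norm (of_nat X powr (1 - s)) / norm (s - 1) \<le> 2 * t powr (3/4) * W / t"
      using a t W by (intro frac_le) auto
    \<comment> \<open>Dividing by \<open>sqrt t\<close> instead of \<open>t\<close> already reaches
      the exponent 1/4.\<close>
    also have "\<dots> \<le> 2 * t powr (3/4) * W / t powr (1/2)"
      using W t powr_mono[of "1/2" 1 t] by (intro divide_left_mono) auto
    also have "\<dots> = 2 * t powr (1/4) * W"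
    proof -
      have "t powr (3/4) = t powr (1/4) * t powr (1/2)" by (simp flip: powr_add)
      then show ?thesis using t by simp
    qed
    finally show ?thesis by (simp add: norm_divide)
  qed
  have C: "norm s * (1 + 1 / Re s) * real X powr (- Re s) \<le> 9 * t powr (1/4) * W"
  proof -
    have "norm s \<le> \<bar>Re s\<bar> + \<bar>Im s\<bar>" by (rule cmod_le)
    then have "norm s \<le> 3 * t" using s t by (simp add: t_def)
    moreover have "1 + 1 / Re s \<le> 3" using s by (simp add: field_simps)
    ultimately have "norm s * (1 + 1 / Re s) \<le> (3 * t) * 3" using s t by (intro mult_mono) auto
    moreover have "real X powr (- Re s) \<le> t powr (-3/4) * W"
    proof -
      have "real X powr (- Re s) = real X powr (-1/2) * real X powr (1/2 - Re s)" by (simp flip: powr_add)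
      also have "\<dots> \<le> (t powr (3/2)) powr (-1/2) * W"
        using J1 t X by (intro mult_mono Xpowr powr_mono2') auto
      also have "(t powr (3/2)) powr (-1/2) = t powr (-3/4)" by (simp add: powr_powr)
      finally show ?thesis .
    qed
    ultimately have "norm s * (1 + 1 / Re s) * real X powr (- Re s) \<le> (3 * t) * 3 * (t powr (-3/4) * W)"
      by (rule mult_mono) (use t in auto)
    also have "\<dots> = 9 * (t powr 1 * t powr (-3/4)) * W" using t by simp
    also have "t powr 1 * t powr (-3/4) = t powr (1/4)" by (subst powr_add[symmetric]) simp
    finally show ?thesis .
  qed
  define Sd where "Sd = (\<Sum>j<J. \<Sum>n\<in>{Suc (2 ^ j * N)..<Suc (2 * (2 ^ j * N))}. of_nat n powr (- s))"
  have "zeta s - (\<Sum>n=1..N. of_nat n powr (- s)) =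
     (zeta s - (\<Sum>n=1..X. of_nat n powr (- s)) - of_nat X powr (1 - s) / (s - 1)) + (Sd + of_nat X powr (1 - s) / (s - 1))"
    using sums[of J] by (simp add: X_def Sd_def)
  also have "norm \<dots> \<le> 9 * t powr (1/4) * W + (44 * W * (21 * t powr (1/4)) + 2 * t powr (1/4) * W)"
    using zeta_approx[of s X] C A B s s1 X unfolding Sd_def[symmetric]
    by (intro norm_triangle_mono) auto
  also have "\<dots> \<le> 1000 * t powr (1/4) * W"
    using mult_nonneg_nonneg[of "t powr (1/4)" W] W by (simp add: mult_ac)
  finally show ?thesis by (simp add: W_def)
qed

section \<open>Zeta on the critical line\<close>

lemma sum_inverse_sqrt_le: "(\<Sum>n=1..N. 1 / sqrt (real n)) \<le> 2 * sqrt (real N)"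
proof (induction N)
  case (Suc N)
  define a b where "a = sqrt (real N)" and "b = sqrt (real (Suc N))"
  have ab: "a\<^sup>2 = real N" "b\<^sup>2 = real N + 1" "b > 0" "a \<ge> 0" "a \<le> b" by (auto simp: a_def b_def)
  have "1 = (b - a) * (b + a)" using ab by (simp add: algebra_simps power2_eq_square)
  also have "\<dots> \<le> (b - a) * (2 * b)" using ab by (intro mult_left_mono) auto
  finally have "1 / b \<le> 2 * b - 2 * a" using ab by (simp add: field_simps)
  then show ?case using Suc by (simp add: a_def b_def)
qed simp

lemma norm_dirichlet_sum_half_le:
  assumes "Re s = 1/2"
  shows "norm (\<Sum>n=1..N. of_nat n powr (- s) :: complex) \<le> 2 * sqrt (real N)"
proof -
  have "norm (\<Sum>n=1..N. of_nat n powr (- s) :: complex) \<le> (\<Sum>n=1..N. 1 / sqrt (real n))"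
  proof (rule sum_norm_le)
    fix n assume "n \<in> {1..N}"
    then have "norm (of_nat n powr (- s) :: complex) = real n powr (- (1/2))"
      by (subst norm_powr_real_powr) (auto simp: assms)
    then show "norm (of_nat n powr (- s) :: complex) \<le> 1 / sqrt (real n)"
      by (simp add: powr_minus powr_half_sqrt divide_simps)
  qed
  then show ?thesis using sum_inverse_sqrt_le[of N] by linarith
qed

text \<open>With \<open>N\<close> near \<open>sqrt t\<close>, the partial sum, estimated term by
  term, and the remainder are both \<open>O (t powr (1/4))\<close>. This is what the
  \<open>O (1 / t)\<close> error in the branch of the square root can afford:
  \<open>t powr (-3/4)\<close> integrates to order \<open>t powr (1/4)\<close>.\<close>

lemma zeta_half_line_bound:
  assumes "t \<ge> 1"
  shows "norm (zeta (Complex (1/2) t)) \<le> 1002 * t powr (1/4)"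
proof -
  define N where "N = nat \<lfloor>sqrt t\<rfloor>"
  have s1: "sqrt t \<ge> 1" using assms by simp
  have N: "real N \<le> sqrt t" "sqrt t < real N + 1" using s1 by (auto simp: N_def)
  have N1: "N \<ge> 1" using N s1 by linarith
  have "norm (zeta (Complex (1/2) t) - (\<Sum>n=1..N. of_nat n powr (- Complex (1/2) t))) \<le>
      1000 * Im (Complex (1/2) t) powr (1/4) * real N powr (1/2 - Re (Complex (1/2) t))"
  proof (rule zeta_remainder_bound)
    have "sqrt t \<le> t powr (3/2)"
      using assms powr_mono[of "1/2" "3/2" t] by (simp add: powr_half_sqrt)
    then show "real N \<le> Im (Complex (1/2) t) powr (3/2)" using N by simp
  qed (use N N1 assms in auto)
  moreover have "norm (\<Sum>n=1..N. of_nat n powr (- Complex (1/2) t) :: complex) \<le> 2 * t powr (1/4)"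
  proof -
    have "sqrt (real N) \<le> sqrt (sqrt t)" using N by simp
    also have "\<dots> = t powr (1/4)" using assms by (simp flip: powr_half_sqrt add: powr_powr)
    finally show ?thesis using norm_dirichlet_sum_half_le[of "Complex (1/2) t" N] by simp
  qed
  ultimately have "norm (zeta (Complex (1/2) t) - (\<Sum>n=1..N. of_nat n powr (- Complex (1/2) t)) +
     (\<Sum>n=1..N. of_nat n powr (- Complex (1/2) t))) \<le> 1000 * t powr (1/4) + 2 * t powr (1/4)"
    using N1 by (intro norm_triangle_mono) auto
  then show ?thesis by simp
qed

section \<open>Stirling's formula\<close>

definition stirling_term :: "complex \<Rightarrow> complex" where
  "stirling_term w = (w + 1/2) * (Ln (w + 1) - Ln w) - 1"

text \<open>The term is the error of the trapezoidal rule for \<open>Ln\<close> on \<open>[w, w + 1]\<close>.\<close>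
lemma norm_stirling_term_le:
  assumes w: "Re w > 0"
  shows "norm (stirling_term w) \<le> 1 / (norm w)\<^sup>2"
proof -
  define S where "S = closed_segment w (w + 1)"
  have S: "Re v > 0" "norm v \<ge> norm w" if vS: "v \<in> S" for v
  proof -
    obtain u where u: "v = w + of_real u" "0 \<le> u"
      using vS by (auto simp: S_def in_segment algebra_simps scaleR_conv_of_real)
    then show "Re v > 0" using w by simp
    show "norm v \<ge> norm w" unfolding cmod_def u
      using u w by (auto intro!: power_mono)
  qed
  have nz: "w \<noteq> 0" using w by auto
  have nn: "v \<notin> \<real>\<^sub>\<le>\<^sub>0" "v \<noteq> 0" if "v \<in> S" for v
    using S(1)[OF that] by (auto simp: complex_nonpos_Reals_iff)
  have bd: "norm (- 1 / v\<^sup>2) \<le> 1 / (norm w)\<^sup>2" if "v \<in> S" for v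
    using S[OF that] nz nn[OF that]
    by (auto simp: norm_divide norm_power intro!: divide_left_mono power_mono mult_pos_pos)
  have ends: "w \<in> S" "w + 1 \<in> S" "convex S" by (auto simp: S_def)
  \<comment> \<open>Successive derivatives, beginning with the antiderivative
    \<open>v * Ln v - v\<close> of the logarithm, so that one list serves both Taylor
    expansions.\<close>
  define f :: "nat \<Rightarrow> complex \<Rightarrow> complex"
    where "f i = [\<lambda>v. v * Ln v - v, Ln, \<lambda>v. 1 / v, \<lambda>v. - 1 / v\<^sup>2] ! i" for i
  have R1: "norm (f 0 (w + 1) - (\<Sum>i\<le>2. f i w * (w + 1 - w) ^ i / fact i)) \<le> 1 / (norm w)\<^sup>2 * norm (w + 1 - w) ^ Suc 2 / fact 2"
  proof (rule complex_Taylor[OF ends(3)])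
    show "(f i has_field_derivative f (Suc i) v) (at v within S)" if "v \<in> S" "i \<le> 2" for i v
    proof -
      from that have "i = 0 \<or> i = 1 \<or> i = 2" by auto
      then show ?thesis using nn[OF that(1)]
        by (elim disjE) (auto simp: f_def numeral_2_eq_2 intro!: derivative_eq_intros simp: divide_simps power2_eq_square)
    qed
    show "norm (f (Suc 2) v) \<le> 1 / (norm w)\<^sup>2" if "v \<in> S" for v
      using bd[OF that] by (simp add: f_def numeral_2_eq_2)
  qed (use ends in auto)
  define g where "g i = f (Suc i)" for i
  have R2: "norm (g 0 (w + 1) - (\<Sum>i\<le>1. g i w * (w + 1 - w) ^ i / fact i)) \<le> 1 / (norm w)\<^sup>2 * norm (w + 1 - w) ^ Suc 1 / fact 1"
  proof (rule complex_Taylor[OF ends(3)])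
    show "(g i has_field_derivative g (Suc i) v) (at v within S)" if "v \<in> S" "i \<le> 1" for i v
    proof -
      from that have "i = 0 \<or> i = 1" by auto
      then show ?thesis using nn[OF that(1)]
        by (elim disjE) (auto simp: g_def f_def numeral_2_eq_2 intro!: derivative_eq_intros simp: divide_simps power2_eq_square)
    qed
    show "norm (g (Suc 1) v) \<le> 1 / (norm w)\<^sup>2" if "v \<in> S" for v
      using bd[OF that] by (simp add: g_def f_def numeral_2_eq_2)
  qed (use ends in auto)
  \<comment> \<open>\<open>r1\<close> is the Taylor remainder for the integral of \<open>Ln\<close>
    over \<open>[w, w + 1]\<close>, \<open>r2\<close> the one for \<open>Ln (w + 1)\<close>. In
    \<open>r1 - r2 / 2\<close> the terms in \<open>1 / w\<close> cancel and the trapezoidal error is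
    left.\<close>
  define r1 r2 where "r1 = (w + 1) * Ln (w + 1) - (w + 1) - (w * Ln w - w + Ln w + 1 / w / 2)"
    and "r2 = Ln (w + 1) - (Ln w + 1 / w)"
  have "norm r1 \<le> 1 / (norm w)\<^sup>2 / 2"
    using R1 by (simp add: f_def r1_def numeral_2_eq_2)
  moreover have "norm r2 \<le> 1 / (norm w)\<^sup>2"
    using R2 by (simp add: g_def f_def r2_def)
  moreover have "stirling_term w = r1 - r2 / 2"
    by (simp add: r1_def r2_def stirling_term_def field_simps)
  ultimately show ?thesis
    using norm_triangle_ineq4[of r1 "r2 / 2"] by (simp add: norm_divide)
qed

text \<open>Gudermann's series for Binet's function, the error term in Stirling's formula for the
  logarithm of Gamma.\<close>

definition stirling_sum :: "complex \<Rightarrow> complex" where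
  "stirling_sum z = (\<Sum>n. stirling_term (z + of_nat n))"

lemma sum_stirling_term:
  "(\<Sum>n<M. stirling_term (z + of_nat n)) =
     (z + of_nat M - 1/2) * Ln (z + of_nat M) - (z - 1/2) * Ln z - (\<Sum>n<M. Ln (z + of_nat n)) - of_nat M"
  by (induction M) (simp_all add: stirling_term_def algebra_simps)

lemma summable_stirling_term:
  assumes z: "Re z > 0"
  shows "summable (\<lambda>n. norm (stirling_term (z + of_nat n)))"
proof -
  have s: "summable (\<lambda>n. 1 / (real (Suc n))\<^sup>2)"
    using inverse_squares_sums by (auto simp: sums_iff add_ac)
  show ?thesis
  proof (subst summable_Suc_iff[symmetric], rule summable_comparison_test'[OF s, of 0])
    fix n
    have "norm (stirling_term (z + of_nat (Suc n))) \<le> 1 / (norm (z + of_nat (Suc n)))\<^sup>2"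
      using z by (intro norm_stirling_term_le) auto
    also have "\<dots> \<le> 1 / (real (Suc n))\<^sup>2"
    proof (intro divide_left_mono power_mono)
      show "real (Suc n) \<le> norm (z + of_nat (Suc n))"
        using complex_Re_le_cmod[of "z + of_nat (Suc n)"] z by simp
    qed (use z in \<open>auto simp: complex_eq_iff intro!: mult_pos_pos\<close>)
    finally show "norm (norm (stirling_term (z + of_nat (Suc n)))) \<le> 1 / (real (Suc n))\<^sup>2" by simp
  qed
qed

text \<open>Uniform in \<open>Re z > 0\<close>, because the real part only helps:
  \<open>(norm (z + n))^2 \<ge> (n + y)^2 / 2\<close>. The majorant
  \<open>1 / ((n + y)^2 - 1/4)\<close> telescopes, which is the reason for the shift by 1/2 in
  \<open>h\<close>.\<close>

lemma norm_stirling_sum_le: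
  assumes z: "Re z > 0" "Im z \<ge> 1"
  shows "norm (stirling_sum z) \<le> 4 / Im z"
proof -
  define y where "y = Im z"
  define h where "h n = 1 / (real n + y - 1/2)" for n
  have y: "y \<ge> 1" using z by (simp add: y_def)
  have b: "norm (stirling_term (z + of_nat n)) \<le> 2 * (h n - h (Suc n))" for n
  proof -
    have "(real n + y)\<^sup>2 \<le> 2 * ((real n)\<^sup>2 + y\<^sup>2)"
      using sum_squares_bound[of "real n" y] by (simp add: power2_sum)
    also have "(real n)\<^sup>2 + y\<^sup>2 \<le> (norm (z + of_nat n))\<^sup>2"
      unfolding cmod_power2 using z by (auto simp: y_def intro!: add_mono power_mono)
    finally have n: "(real n + y)\<^sup>2 \<le> 2 * (norm (z + of_nat n))\<^sup>2" by simp
    have p: "(real n + y)\<^sup>2 > 1/4"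
    proof -
      have "1\<^sup>2 \<le> (real n + y)\<^sup>2" using y by (intro power_mono) auto
      then show ?thesis by simp
    qed
    have "norm (stirling_term (z + of_nat n)) \<le> 1 / (norm (z + of_nat n))\<^sup>2"
      using z by (intro norm_stirling_term_le) auto
    also have "\<dots> = 2 / (2 * (norm (z + of_nat n))\<^sup>2)" by simp
    also have "\<dots> \<le> 2 / (real n + y)\<^sup>2"
      using n p by (intro divide_left_mono mult_pos_pos) auto
    also have "\<dots> \<le> 2 / ((real n + y)\<^sup>2 - 1/4)"
      using p by (intro divide_left_mono mult_pos_pos) auto
    also have "\<dots> = 2 * (h n - h (Suc n))"
    proof -
      define v where "v = real n + y - 1/2"
      have v: "v > 0" using y by (simp add: v_def)
      have e1: "(real n + y)\<^sup>2 - 1/4 = v * (v + 1)"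
        by (simp add: v_def power2_eq_square algebra_simps)
      have e2: "h n = 1 / v" "h (Suc n) = 1 / (v + 1)"
        by (simp_all add: h_def v_def algebra_simps)
      show ?thesis unfolding e1 e2 using v by (simp add: divide_simps)
    qed
    finally show ?thesis .
  qed
  have "norm (stirling_sum z) \<le> (\<Sum>n. norm (stirling_term (z + of_nat n)))"
    unfolding stirling_sum_def using summable_stirling_term[OF z(1)] by (rule summable_norm)
  also have "\<dots> \<le> 2 * h 0"
  proof (rule suminf_le_const[OF summable_stirling_term[OF z(1)]])
    fix k
    have "(\<Sum>n<k. norm (stirling_term (z + of_nat n))) \<le> (\<Sum>n<k. 2 * (h n - h (Suc n)))"
      by (intro sum_mono b)
    also have "\<dots> = 2 * (h 0 - h k)"
      using sum_lessThan_telescope'[of h k] unfolding sum_distrib_left[symmetric] by simp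
    also have "\<dots> \<le> 2 * h 0" using y by (simp add: h_def)
    finally show "(\<Sum>n<k. norm (stirling_term (z + of_nat n))) \<le> 2 * h 0" .
  qed
  also have "\<dots> \<le> 4 / y" using y by (simp add: h_def field_simps)
  finally show ?thesis by (simp add: y_def)
qed

lemma pochhammer_eq_exp_sum_Ln:
  assumes "Re z > 0"
  shows "pochhammer z M = exp (\<Sum>n<M. Ln (z + of_nat n))"
proof -
  have "z + of_nat n \<noteq> 0" for n using assms by (auto simp: complex_eq_iff)
  then show ?thesis
    by (simp add: pochhammer_prod exp_sum atLeast0LessThan)
qed

text \<open>With \<open>z + M + 1 = M * (1 + u)\<close> the logarithms of \<open>M\<close> cancel,
  and what is left behaves like \<open>M * Ln (1 + u)\<close>, where \<open>M * u = z + 1\<close>.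
  This limit remains when the partial sums of Stirling terms are set against Euler's limit formula
  for Gamma.\<close>

lemma tendsto_stirling_correction:
  assumes z: "Re z > 0"
  shows "(\<lambda>M. (z + of_nat M + 1/2) * Ln (z + of_nat M + 1) - z * of_real (ln (real M)) -
      (of_nat M + 1/2) * of_real (ln (real M))) \<longlonglongrightarrow> z + 1"
proof -
  define u where "u M = (z + 1) / of_nat M" for M :: nat
  have u0: "u \<longlonglongrightarrow> 0" unfolding u_def by (rule lim_const_over_n)
  have zn: "z + 1 \<noteq> 0" using z by (auto simp: complex_eq_iff)
  have "(Ln has_field_derivative 1) (at 1)" by (auto intro!: derivative_eq_intros)
  then have "((\<lambda>h. Ln (1 + h) / h) \<longlongrightarrow> 1) (at 0)" by (simp add: DERIV_def)
  moreover have "filterlim u (at 0) sequentially"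
    unfolding filterlim_at using u0 zn by (auto simp: u_def eventually_sequentially intro!: exI[of _ 1])
  ultimately have l1: "(\<lambda>M. Ln (1 + u M) / u M) \<longlonglongrightarrow> 1" by (rule filterlim_compose)
  have l2: "(\<lambda>M. (z + 1/2) * Ln (1 + u M)) \<longlonglongrightarrow> (z + 1/2) * Ln (1 + 0)"
    by (intro tendsto_intros u0) auto
  have "(\<lambda>M. (z + 1) * (Ln (1 + u M) / u M) + (z + 1/2) * Ln (1 + u M)) \<longlonglongrightarrow> (z + 1) * 1 + (z + 1/2) * Ln (1 + 0)"
    by (intro tendsto_add l2 tendsto_mult_left l1)
  then have "(\<lambda>M. (z + 1) * (Ln (1 + u M) / u M) + (z + 1/2) * Ln (1 + u M)) \<longlonglongrightarrow> z + 1" by simp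
  moreover have "eventually (\<lambda>M. (z + 1) * (Ln (1 + u M) / u M) + (z + 1/2) * Ln (1 + u M) =
      (z + of_nat M + 1/2) * Ln (z + of_nat M + 1) - z * of_real (ln (real M)) -
      (of_nat M + 1/2) * of_real (ln (real M))) sequentially"
    using eventually_gt_at_top[of 0]
  proof eventually_elim
    case (elim M)
    have p: "Re (1 + u M) > 0"
      using z elim by (auto simp: u_def Re_divide_of_nat intro!: add_pos_nonneg divide_nonneg_nonneg)
    have "1 + u M \<noteq> 0"
    proof
      assume "1 + u M = 0"
      with p show False by (metis less_irrefl zero_complex.sel(1))
    qed
    have "z + of_nat M + 1 = of_real (real M) * (1 + u M)"
      using elim by (simp add: u_def field_simps)
    also have "Ln \<dots> = of_real (ln (real M)) + Ln (1 + u M)"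
      using elim \<open>1 + u M \<noteq> 0\<close> by (subst Ln_times_of_real) auto
    finally have L: "Ln (z + of_nat M + 1) = of_real (ln (real M)) + Ln (1 + u M)" .
    have "(z + 1) / u M = of_nat M" using elim zn by (simp add: u_def)
    then have "(z + 1) * (Ln (1 + u M) / u M) = of_nat M * Ln (1 + u M)"
      by (metis mult.commute times_divide_eq_left times_divide_eq_right)
    then show ?case unfolding L by (simp add: algebra_simps)
  qed
  ultimately show ?thesis by (rule Lim_transform_eventually)
qed

text \<open>The sequence \<open>d M\<close> does not involve \<open>z\<close>, yet for every
  \<open>z\<close> it converges to the quotient of \<open>Gamma z\<close> and the exponential. The
  quotient is therefore the same for all \<open>z\<close>, and \<open>c\<close> is its value at
  \<open>z = 1\<close>.\<close>

lemma Gamma_stirling: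
  "\<exists>c\<noteq>0. \<forall>z. Re z > 0 \<longrightarrow> Gamma z = c * exp ((z - 1/2) * Ln z - z + stirling_sum z)"
proof -
  define d :: "nat \<Rightarrow> complex" where "d M = fact M * exp (of_nat M - (of_nat M + 1/2) * of_real (ln (real M)))" for M
  have lim: "d \<longlonglongrightarrow> Gamma z * exp (- ((z - 1/2) * Ln z - z + stirling_sum z))" if z: "Re z > 0" for z
  proof -
    define r where "r M = (z + of_nat M + 1/2) * Ln (z + of_nat M + 1) - z * of_real (ln (real M)) -
      (of_nat M + 1/2) * of_real (ln (real M))" for M
    \<comment> \<open>The Stirling terms cancel the logarithms of the Pochhammer product. These are
      taken factor by factor, so no branch of the logarithm of a product arises.\<close>
    have dM: "d M = Gamma_series z M * exp (- ((z - 1/2) * Ln z + (\<Sum>n<Suc M. stirling_term (z + of_nat n)))) * exp (r M - 1)" for M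
    proof -
      have "Gamma_series z M = fact M * exp (z * of_real (ln (real M))) / exp (\<Sum>n<Suc M. Ln (z + of_nat n))"
        unfolding Gamma_series_def pochhammer_eq_exp_sum_Ln[OF z] by simp
      then have "Gamma_series z M = fact M * exp (z * of_real (ln (real M)) - (\<Sum>n<Suc M. Ln (z + of_nat n)))"
        by (simp add: exp_diff)
      then have "Gamma_series z M * exp (- ((z - 1/2) * Ln z + (\<Sum>n<Suc M. stirling_term (z + of_nat n)))) * exp (r M - 1)
        = fact M * exp (z * of_real (ln (real M)) - (\<Sum>n<Suc M. Ln (z + of_nat n)) +
            - ((z - 1/2) * Ln z + (\<Sum>n<Suc M. stirling_term (z + of_nat n))) + (r M - 1))"
        by (simp only: exp_add mult.assoc)
      also have "z * of_real (ln (real M)) - (\<Sum>n<Suc M. Ln (z + of_nat n)) +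
            - ((z - 1/2) * Ln z + (\<Sum>n<Suc M. stirling_term (z + of_nat n))) + (r M - 1)
          = of_nat M - (of_nat M + 1/2) * of_real (ln (real M))"
        unfolding sum_stirling_term r_def by (simp add: algebra_simps)
      finally show ?thesis by (simp add: d_def)
    qed
    have l: "(\<lambda>M. Gamma_series z M * exp (- ((z - 1/2) * Ln z + (\<Sum>n<Suc M. stirling_term (z + of_nat n)))) * exp (r M - 1))
       \<longlonglongrightarrow> Gamma z * exp (- ((z - 1/2) * Ln z + stirling_sum z)) * exp (z + 1 - 1)"
    proof (intro tendsto_intros)
      show "r \<longlonglongrightarrow> z + 1" unfolding r_def by (rule tendsto_stirling_correction[OF z])
      have "(\<lambda>M. \<Sum>n<M. stirling_term (z + of_nat n)) \<longlonglongrightarrow> stirling_sum z"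
        unfolding stirling_sum_def
        by (rule summable_LIMSEQ[OF summable_norm_cancel[OF summable_stirling_term[OF z]]])
      then show "(\<lambda>M. \<Sum>n<Suc M. stirling_term (z + of_nat n)) \<longlonglongrightarrow> stirling_sum z"
        by (rule LIMSEQ_Suc)
    qed
    have e: "Gamma z * exp (- ((z - 1/2) * Ln z + stirling_sum z)) * exp (z + 1 - 1) =
        Gamma z * exp (- ((z - 1/2) * Ln z - z + stirling_sum z))"
      by (simp add: mult.assoc algebra_simps flip: exp_add)
    show ?thesis using l unfolding e dM[symmetric] .
  qed
  define c where "c = Gamma 1 * exp (- ((1 - 1/2) * Ln 1 - 1 + stirling_sum 1))"
  have c: "c \<noteq> 0" by (simp add: c_def)
  show ?thesis
  proof (intro exI[of _ c] conjI c allI impI)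
    fix z :: complex assume z: "Re z > 0"
    have "c = Gamma z * exp (- ((z - 1/2) * Ln z - z + stirling_sum z))"
      using LIMSEQ_unique[OF lim[of 1] lim[OF z]] by (simp add: c_def)
    then have "c * exp ((z - 1/2) * Ln z - z + stirling_sum z) = Gamma z"
      unfolding exp_minus by (metis exp_not_eq_zero mult.assoc left_inverse mult.right_neutral)
    then show "Gamma z = c * exp ((z - 1/2) * Ln z - z + stirling_sum z)" ..
  qed
qed

section \<open>Uniform bounds for the Gamma function\<close>

lemma arctan_le_self:
  fixes x :: real
  assumes "x \<ge> 0" shows "arctan x \<le> x"
proof (cases "x = 0")
  case False
  then have x: "x > 0" using assms by simp
  have "\<exists>z>0. z < x \<and> arctan x - arctan 0 = (x - 0) * inverse (1 + z\<^sup>2)"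
    using x by (intro MVT2 DERIV_arctan) 
  then obtain z where "arctan x = x * inverse (1 + z\<^sup>2)" by auto
  moreover have "inverse (1 + z\<^sup>2) \<le> 1" by (simp add: inverse_le_1_iff)
  ultimately show ?thesis using x mult_left_mono[of "inverse (1 + z\<^sup>2)" 1 x] by simp
qed simp

text \<open>In Stirling's formula \<open>- y * Im (Ln z)\<close> equals
  \<open>- pi * y / 2 + y * arctan (x / y)\<close>; the second part is at most \<open>x\<close>, and
  the term \<open>- z\<close> takes this away again. So no exponential in \<open>x\<close> survives
  and the bound is uniform in \<open>x > 0\<close>, as the right shift requires, which reaches
  \<open>x = P\<close>.\<close>

lemma Gamma_upper_bound:
  "\<exists>C>0. \<forall>x y. x > 0 \<longrightarrow> y \<ge> 1 \<longrightarrow>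
      norm (Gamma (Complex x y)) * exp (pi * y / 2) \<le> C * norm (Complex x y) powr (x - 1/2)"
proof -
  obtain c where c: "c \<noteq> 0" "\<And>z. Re z > 0 \<Longrightarrow> Gamma z = c * exp ((z - 1/2) * Ln z - z + stirling_sum z)"
    using Gamma_stirling by blast
  have "norm (Gamma (Complex x y)) * exp (pi * y / 2) \<le> norm c * exp 4 * norm (Complex x y) powr (x - 1/2)"
    if x: "x > 0" and y: "y \<ge> 1" for x y
  proof -
    define z where "z = Complex x y"
    have nz: "z \<noteq> 0" using x by (auto simp: z_def complex_eq_iff)
    have "Im (Ln z) = arctan (y / x)"
      using x nz arg_conv_arctan[of z] by (simp add: z_def Arg_eq_Im_Ln)
    also have "\<dots> = pi / 2 - arctan (x / y)"
      using x y arctan_inverse[of "x / y"] by simp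
    finally have im: "Im (Ln z) = pi / 2 - arctan (x / y)" .
    have re: "Re (Ln z) = ln (norm z)" using nz by simp
    have "y * arctan (x / y) \<le> y * (x / y)"
      using x y by (intro mult_left_mono arctan_le_self) auto
    then have at: "y * arctan (x / y) \<le> x" using y by simp
    have mu: "Re (stirling_sum z) \<le> 4"
    proof -
      have "norm (stirling_sum z) \<le> 4 / y" using norm_stirling_sum_le[of z] x y by (simp add: z_def)
      also have "\<dots> \<le> 4" using y by (simp add: divide_le_eq)
      finally show ?thesis using complex_Re_le_cmod[of "stirling_sum z"] by linarith
    qed
    have "Re ((z - 1/2) * Ln z - z + stirling_sum z) + pi * y / 2 =
        (x - 1/2) * Re (Ln z) - y * Im (Ln z) - x + Re (stirling_sum z) + pi * y / 2"
      by (simp add: z_def)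
    also have "\<dots> = (x - 1/2) * ln (norm z) + (y * arctan (x / y) - x) + Re (stirling_sum z)"
      unfolding re im by (simp add: algebra_simps)
    also have "\<dots> \<le> (x - 1/2) * ln (norm z) + 4" using at mu by simp
    finally have le: "Re ((z - 1/2) * Ln z - z + stirling_sum z) + pi * y / 2 \<le> (x - 1/2) * ln (norm z) + 4" .
    have "norm (Gamma z) * exp (pi * y / 2) = norm c * exp (Re ((z - 1/2) * Ln z - z + stirling_sum z) + pi * y / 2)"
      using c(2)[of z] x by (simp add: z_def norm_mult exp_add)
    also have "\<dots> \<le> norm c * exp ((x - 1/2) * ln (norm z) + 4)"
      using le by (intro mult_left_mono) auto
    also have "\<dots> = norm c * exp 4 * norm z powr (x - 1/2)"
      using nz by (simp add: powr_def exp_add)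
    finally show ?thesis by (simp add: z_def)
  qed
  then show ?thesis using c(1) by (intro exI[of _ "norm c * exp 4"]) auto
qed

text \<open>The strip \<open>1/2 \<le> x \<le> 3/2\<close> follows from the previous bound. Further
  left, \<open>Gamma z = Gamma (z + 1) / z\<close> with \<open>norm z \<ge> y\<close> lowers the
  exponent of \<open>y\<close> by one and leaves the constant unchanged, so the bound is uniform
  however far left.\<close>

lemma Gamma_upper_bound_left:
  "\<exists>C>0. \<forall>x y. x \<le> 3/2 \<longrightarrow> y \<ge> 1 \<longrightarrow>
      norm (Gamma (Complex x y)) * exp (pi * y / 2) \<le> C * y powr (x - 1/2)"
proof -
  obtain C where C: "C > 0" "\<And>x y. x > 0 \<Longrightarrow> y \<ge> 1 \<Longrightarrow>
      norm (Gamma (Complex x y)) * exp (pi * y / 2) \<le> C * norm (Complex x y) powr (x - 1/2)"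
    using Gamma_upper_bound by blast
  have main: "norm (Gamma (Complex x y)) * exp (pi * y / 2) \<le> 3 * C * y powr (x - 1/2)"
    if "1/2 - real k \<le> x" "x \<le> 3/2" and y: "y \<ge> 1" for x y k
    using that(1,2)
  proof (induction k arbitrary: x)
    case 0
    have "norm (Complex x y) \<le> \<bar>x\<bar> + \<bar>y\<bar>" using cmod_le[of "Complex x y"] by simp
    also have "\<dots> \<le> 3 * y" using 0 y by simp
    finally have "norm (Complex x y) powr (x - 1/2) \<le> (3 * y) powr (x - 1/2)"
      using 0 by (intro powr_mono2) auto
    also have "\<dots> = 3 powr (x - 1/2) * y powr (x - 1/2)" using y by (simp add: powr_mult)
    also have "\<dots> \<le> 3 powr 1 * y powr (x - 1/2)" using 0 by (intro mult_right_mono powr_mono) auto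
    finally have "C * norm (Complex x y) powr (x - 1/2) \<le> C * (3 * y powr (x - 1/2))"
      using C(1) by (intro mult_left_mono) auto
    then show ?case using C(2)[of x y] 0 y by simp
  next
    case (Suc k)
    show ?case
    proof (cases "x \<ge> 1/2 - real k")
      case True then show ?thesis using Suc by simp
    next
      case False
      define z where "z = Complex x y"
      have z: "z \<notin> \<int>\<^sub>\<le>\<^sub>0" using y by (auto simp: z_def complex_eq_iff elim!: nonpos_Ints_cases)
      then have nz: "z \<noteq> 0" by auto
      have zy: "norm z \<ge> y" using abs_Im_le_cmod[of z] by (simp add: z_def)
      have z1: "z + 1 = Complex (x + 1) y" by (simp add: z_def complex_eq_iff)
      have "norm (Gamma z) = norm (Gamma (z + 1)) / norm z"
        using Gamma_plus1[OF z] nz by (simp add: norm_mult)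
      also have "\<dots> \<le> norm (Gamma (z + 1)) / y"
        using zy y nz by (intro divide_left_mono) auto
      finally have "norm (Gamma z) * exp (pi * y / 2) \<le> norm (Gamma (z + 1)) / y * exp (pi * y / 2)"
        by (intro mult_right_mono) auto
      also have "\<dots> \<le> 3 * C * y powr (x + 1 - 1/2) / y"
        using Suc.IH[of "x + 1"] Suc.prems False y unfolding z1
        by (simp add: divide_right_mono)
      also have "\<dots> = 3 * C * y powr (x - 1/2)"
      proof -
        have "y powr (x + 1 - 1/2) = y powr (x - 1/2) * y powr 1" by (subst powr_add[symmetric]) simp
        then show ?thesis using y by simp
      qed
      finally show ?thesis by (simp add: z_def)
    qed
  qed
  show ?thesis
  proof (intro exI[of _ "3 * C"] conjI allI impI)
    fix x y :: real assume xy: "x \<le> 3/2" "y \<ge> 1"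
    obtain k :: nat where "1/2 - x \<le> real k" using real_arch_simple by blast
    then show "norm (Gamma (Complex x y)) * exp (pi * y / 2) \<le> 3 * C * y powr (x - 1/2)"
      using main[of k x y] xy by simp
  qed (use C in simp)
qed

lemma norm_exp_minus_one_le: "norm (exp z - 1) \<le> exp (norm z) * norm (z :: complex)"
proof -
  have "norm (exp z - 1) \<le> exp \<bar>Re z\<bar> * norm z"
    using Taylor_exp[of z 0] by simp
  also have "\<dots> \<le> exp (norm z) * norm z"
    using abs_Re_le_cmod[of z] by (intro mult_right_mono) auto
  finally show ?thesis .
qed

text \<open>The factors next to Gamma strip off the modulus
  \<open>exp (- pi * y / 2) * y powr (x - 1/2)\<close> and the rotating phase
  \<open>y * ln y - y\<close> of Stirling's main term. That phase is independent of
  \<open>x\<close>, which allows the branch, given by \<open>x = 1/4\<close>, to be compared with a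
  function on \<open>x = 1/2\<close>.\<close>

lemma Gamma_vertical_asymptotics:
  "\<exists>c\<noteq>0. \<forall>x. 0 < x \<longrightarrow> x \<le> 1/2 \<longrightarrow> (\<exists>C. \<forall>y\<ge>1.
     norm (Gamma (Complex x y) * of_real (exp (pi * y / 2) * y powr (1/2 - x)) * cis (y - y * ln y)
       - c * cis (pi * (x - 1/2) / 2)) \<le> C / y)"
proof -
  obtain c where c: "c \<noteq> 0" "\<And>z. Re z > 0 \<Longrightarrow> Gamma z = c * exp ((z - 1/2) * Ln z - z + stirling_sum z)"
    using Gamma_stirling by blast
  have "norm (Gamma (Complex x y) * of_real (exp (pi * y / 2) * y powr (1/2 - x)) * cis (y - y * ln y)
       - c * cis (pi * (x - 1/2) / 2)) \<le> norm c * exp 6 * 6 / y"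
    if x: "0 < x" "x \<le> 1/2" and y: "y \<ge> 1" for x y
  proof -
    define z where "z = Complex x y"
    \<comment> \<open>Chosen so that \<open>z = \<i> * y * (1 + u)\<close>: the logarithm splits at
      \<open>\<i> * y\<close>, and \<open>u\<close> has size \<open>1 / y\<close>.\<close>
    define u where "u = - (\<i> * of_real (x / y))"
    have nu: "norm u = x / y" using x y by (simp add: u_def norm_mult norm_divide)
    have xy: "x / y \<le> 1/2" using x y by (simp add: divide_le_eq)
    have nuh: "norm u \<le> 1/2" unfolding nu by (rule xy)
    have w0: "Re (1 + u) > 0" by (simp add: u_def)
    then have wn: "1 + u \<noteq> 0" by (metis less_irrefl zero_complex.sel(1))
    have zeq: "z = of_real y * (\<i> * (1 + u))"
      using y by (simp add: z_def u_def complex_eq_iff)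
    have "Ln (\<i> * (1 + u)) = Ln \<i> + Ln (1 + u)"
    proof (rule Ln_times_simple)
      have "\<bar>Im (Ln (1 + u))\<bar> < pi / 2" by (rule Re_Ln_pos_lt_imp[OF w0]) 
      then show "- pi < Im (Ln \<i>) + Im (Ln (1 + u))" "Im (Ln \<i>) + Im (Ln (1 + u)) \<le> pi"
        by auto
    qed (use wn in auto)
    then have L: "Ln z = of_real (ln y) + \<i> * of_real (pi / 2) + Ln (1 + u)"
      unfolding zeq using y wn by (subst Ln_times_of_real) (auto simp: Ln_of_real)
    define e where "e = Ln (1 + u) - u"
    have ne: "norm e \<le> 2 * (x / y)\<^sup>2"
    proof -
      have "norm e \<le> (norm u)\<^sup>2 / (1 - norm u)"
        unfolding e_def
      proof (rule Ln_approx_linear)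
        show "norm u < 1" using nuh by simp
      qed
      also have "\<dots> \<le> (norm u)\<^sup>2 / (1/2)" using nuh by (intro divide_left_mono) auto
      finally show ?thesis using nu by simp
    qed
    \<comment> \<open>Everything of size \<open>1 / y\<close>. Of the product
      \<open>(z - 1/2) * u\<close> only the part \<open>\<i> * y * u = x\<close> is larger, and it
      cancels against the real part of \<open>- z\<close>.\<close>
    define D where "D = (of_real x - 1/2) * u + (z - 1/2) * e + stirling_sum z"
    have main: "(z - 1/2) * Ln z - z + stirling_sum z =
       - of_real (pi * y / 2) - of_real ((1/2 - x) * ln y) - \<i> * of_real (y - y * ln y) + \<i> * of_real (pi * (x - 1/2) / 2) + D"
    proof -
      have zz: "z = of_real x + \<i> * of_real y" by (simp add: z_def complex_eq_iff)
      have yu: "of_real y * u = - (\<i> * of_real x)" using y by (simp add: u_def)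
      have "Ln (1 + u) = u + e" by (simp add: e_def)
      then have "(z - 1/2) * Ln z = (z - 1/2) * (of_real (ln y) + \<i> * of_real (pi / 2)) + (of_real x - 1/2) * u
          + \<i> * (of_real y * u) + (z - 1/2) * e"
        unfolding L by (simp add: zz algebra_simps)
      then show ?thesis unfolding yu D_def
        by (simp add: zz algebra_simps add_divide_distrib diff_divide_distrib)
    qed
    have nD: "norm D \<le> 6 / y"
    proof -
      have "norm ((of_real x - 1/2) * u) \<le> (1/2) * (1 / (2 * y))"
      proof -
        have "norm (complex_of_real x - 1/2) = norm (complex_of_real (x - 1/2))" by simp
        also have "\<dots> \<le> 1/2" using x by (simp only: norm_of_real)
        finally have a: "norm (complex_of_real x - 1/2) \<le> 1/2" .
        have "norm u \<le> 1 / (2 * y)" unfolding nu using x y by (simp add: field_simps)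
        then show ?thesis unfolding norm_mult using a by (intro mult_mono) auto
      qed
      moreover have "norm ((z - 1/2) * e) \<le> (2 * y) * (2 * (1 / (2 * y))\<^sup>2)"
      proof -
        have "norm (z - 1/2) \<le> \<bar>x - 1/2\<bar> + \<bar>y\<bar>" using cmod_le[of "z - 1/2"] by (simp add: z_def)
        also have "\<dots> \<le> 2 * y" using x y by simp
        finally have a: "norm (z - 1/2) \<le> 2 * y" .
        have "x / y \<le> 1 / (2 * y)" using x y by (simp add: field_simps)
        then have "2 * (x / y)\<^sup>2 \<le> 2 * (1 / (2 * y))\<^sup>2" using x y by (intro mult_left_mono power_mono) auto
        then have "norm e \<le> 2 * (1 / (2 * y))\<^sup>2" using ne by linarith
        then show ?thesis unfolding norm_mult using a y by (intro mult_mono) auto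
      qed
      moreover have "(2 * y) * (2 * (1 / (2 * y))\<^sup>2) = 1 / y" using y by (simp add: power2_eq_square)
      moreover have "norm (stirling_sum z) \<le> 4 / y"
        using norm_stirling_sum_le[of z] x y by (simp add: z_def)
      ultimately have "norm D \<le> (1/2) * (1 / (2 * y)) + 1 / y + 4 / y"
        unfolding D_def by (intro norm_triangle_mono) auto
      also have "\<dots> \<le> 6 / y" using y by (simp add: field_simps)
      finally show ?thesis .
    qed
    have "Gamma z * of_real (exp (pi * y / 2) * y powr (1/2 - x)) * cis (y - y * ln y) =
       c * (exp ((z - 1/2) * Ln z - z + stirling_sum z) * exp (of_real (pi * y / 2)) * exp (of_real ((1/2 - x) * ln y))
         * exp (\<i> * of_real (y - y * ln y)))"
    proof -
      have p: "y powr (1/2 - x) = exp ((1/2 - x) * ln y)" using y by (simp add: powr_def)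
      have "Re z > 0" using x by (simp add: z_def)
      note G = c(2)[OF this]
      show ?thesis unfolding G p exp_of_real cis_conv_exp unfolding of_real_mult by (simp only: mult.assoc)
    qed
    also have "\<dots> = c * exp ((z - 1/2) * Ln z - z + stirling_sum z + of_real (pi * y / 2) + of_real ((1/2 - x) * ln y)
         + \<i> * of_real (y - y * ln y))"
      by (simp only: exp_add)
    also have "(z - 1/2) * Ln z - z + stirling_sum z + of_real (pi * y / 2) + of_real ((1/2 - x) * ln y)
         + \<i> * of_real (y - y * ln y) = \<i> * of_real (pi * (x - 1/2) / 2) + D"
      unfolding main by (simp add: algebra_simps)
    also have "c * exp \<dots> = c * cis (pi * (x - 1/2) / 2) * exp D"
      by (simp add: exp_add cis_conv_exp)
    finally have "Gamma z * of_real (exp (pi * y / 2) * y powr (1/2 - x)) * cis (y - y * ln y) - c * cis (pi * (x - 1/2) / 2)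
        = c * cis (pi * (x - 1/2) / 2) * (exp D - 1)" by (simp add: algebra_simps)
    also have "norm \<dots> = norm c * norm (exp D - 1)" by (simp add: norm_mult)
    also have "\<dots> \<le> norm c * (exp 6 * (6 / y))"
    proof (intro mult_left_mono order_trans[OF norm_exp_minus_one_le] mult_mono)
      have "6 / y \<le> 6" using y by (simp add: divide_le_eq)
      then show "exp (norm D) \<le> exp 6" using nD by simp
    qed (use nD in auto)
    finally show ?thesis by (simp add: z_def)
  qed
  then show ?thesis using c(1) by blast
qed

section \<open>The branch of the square root\<close>

text \<open>The reflection formula removes the sine and the duplication formula removes
  \<open>Gamma (1 - s)\<close>, which gives \<open>chi\<close> the symmetric form
  \<open>pi powr (s - 1/2) * Gamma ((1 - s) / 2) / Gamma (s / 2)\<close>. On the critical line the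
  two Gamma values are conjugate.\<close>

lemma chi_critical_line:
  "chi (Complex (1/2) t) = cis (t * ln pi) * Gamma (Complex (1/4) (- t / 2)) / Gamma (Complex (1/4) (t / 2))"
proof -
  define s where "s = Complex (1/2) t"
  have nn: "Complex x y \<notin> \<int>\<^sub>\<le>\<^sub>0" if "x > 0" for x y
    using that by (auto simp: complex_eq_iff elim!: nonpos_Ints_cases)
  have s2: "s / 2 = Complex (1/4) (t / 2)" "1 - s / 2 = Complex (3/4) (- t / 2)"
      "(1 - s) / 2 = Complex (1/4) (- t / 2)" "(1 - s) / 2 + 1/2 = 1 - s / 2" "2 * ((1 - s) / 2) = 1 - s"
      "1 - 2 * ((1 - s) / 2) = s"
    by (auto simp: s_def complex_eq_iff)
  have n1: "1 - s / 2 \<notin> \<int>\<^sub>\<le>\<^sub>0" unfolding s2(2) by (rule nn) simp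
  have n2: "s / 2 \<notin> \<int>\<^sub>\<le>\<^sub>0" "(1 - s) / 2 \<notin> \<int>\<^sub>\<le>\<^sub>0" unfolding s2(1,3) by (rule nn; simp)+
  define A B D where "A = Gamma (s / 2)" and "B = Gamma (1 - s / 2)" and "D = Gamma ((1 - s) / 2)"
  have AB: "A \<noteq> 0" "B \<noteq> 0"
    using n1 n2 by (auto simp: A_def B_def Gamma_eq_zero_iff)
  have "A * B = of_real pi / sin (of_real pi * (s / 2))"
    unfolding A_def B_def by (rule Gamma_reflection_complex)
  then have sn: "sin (of_real pi * s / 2) = of_real pi / (A * B)"
    using AB by (auto simp: field_simps)
  have "D * B = exp (s * of_real (ln 2)) * of_real (sqrt pi) * Gamma (1 - s)"
    using Gamma_legendre_duplication[of "(1 - s) / 2"] n1 n2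
    unfolding D_def B_def s2(4-6) by simp
  moreover have "exp (s * of_real (ln 2)) = 2 powr s"
    using Ln_of_real[of 2] by (simp add: powr_def)
  ultimately have DB: "2 powr s * Gamma (1 - s) = D * B / of_real (sqrt pi)" by (simp add: field_simps)
  have pp: "of_real pi = complex_of_real (sqrt pi) * of_real (sqrt pi)"
    by (simp flip: of_real_mult)
  have "of_real pi powr (s - 1) * of_real (sqrt pi) = of_real pi powr (s - 1) * of_real pi powr (1/2)"
    using powr_of_real[of pi "1/2"] by (simp add: powr_half_sqrt)
  also have "\<dots> = of_real pi powr (\<i> * of_real t)"
    by (simp add: s_def complex_eq_iff flip: powr_add) (simp add: Complex_eq)
  also have "\<dots> = cis (t * ln pi)"
    using Ln_of_real[of pi] by (simp add: powr_def cis_conv_exp mult_ac)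
  finally have pw: "of_real pi powr (s - 1) * of_real (sqrt pi) = cis (t * ln pi)" .
  have "chi s = of_real pi powr (s - 1) * sin (of_real pi * s / 2) * (2 powr s * Gamma (1 - s))"
    by (simp add: chi_def)
  also have "\<dots> = (of_real pi powr (s - 1) * of_real (sqrt pi)) * D / A"
    unfolding sn DB using AB by (subst pp) (simp add: field_simps)
  finally show ?thesis unfolding pw by (simp add: A_def D_def s2) (simp add: s_def)
qed

text \<open>For \<open>W = Gamma (1/4 + \<i> * t / 2)\<close> the preceding formula reads
  \<open>chi = cis (t * ln pi) * cnj W / W\<close>, and \<open>W / cnj W\<close> is the square of
  \<open>sgn W\<close>. Gamma has no zeros, so \<open>sgn W\<close> is continuous; it is 1 at
  \<open>t = 0\<close> because \<open>Gamma (1/4) > 0\<close>. Uniqueness of the branch does the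
  rest.\<close>

lemma chi_inv_sqrt_eq:
  "chi_inv_sqrt t = cis (- (t / 2 * ln pi)) * sgn (Gamma (Complex (1/4) (t / 2)))"
proof -
  define g where "g u = cis (- (u / 2 * ln pi)) * sgn (Gamma (Complex (1/4) (u / 2)))" for u
  have nn: "Complex (1/4) y \<notin> \<int>\<^sub>\<le>\<^sub>0" for y
    by (auto simp: complex_eq_iff elim!: nonpos_Ints_cases)
  then have nz: "Gamma (Complex (1/4) y) \<noteq> 0" for y by (simp add: Gamma_eq_zero_iff)
  have "continuous_on UNIV (\<lambda>t. Gamma (Complex (1/4) (t / 2)))"
  proof (intro continuous_at_imp_continuous_on ballI isCont_Gamma)
    show "isCont (\<lambda>t. Complex (1/4) (t / 2)) t" for t
      by (auto simp: Complex_eq intro!: continuous_intros)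
  qed (rule nn)
  then have "continuous_on UNIV g"
    unfolding g_def sgn_div_norm using nz by (intro continuous_intros) auto
  moreover have "(g t)\<^sup>2 = inverse (chi (Complex (1/2) t))" for t
  proof -
    define W where "W = Gamma (Complex (1/4) (t / 2))"
    have W: "W \<noteq> 0" using nz by (simp add: W_def)
    have "Complex (1/4) (- t / 2) = cnj (Complex (1/4) (t / 2))" by (simp add: complex_eq_iff)
    then have "chi (Complex (1/2) t) = cis (t * ln pi) * cnj W / W"
      unfolding chi_critical_line W_def by (simp add: cnj_Gamma)
    then have "inverse (chi (Complex (1/2) t)) = cis (- (t * ln pi)) * (W / cnj W)"
      by (simp add: field_simps flip: cis_inverse)
    moreover have "(sgn W)\<^sup>2 = W / cnj W"
      using W complex_norm_square[of W]
      by (simp add: sgn_div_norm scaleR_conv_of_real power2_eq_square field_simps)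
    moreover have "(cis (- (t / 2 * ln pi)))\<^sup>2 = cis (- (t * ln pi))"
      unfolding power2_eq_square cis_mult by simp
    ultimately show ?thesis by (simp add: g_def W_def power_mult_distrib)
  qed
  moreover have "g 0 = 1"
  proof -
    have "Complex (1/4) 0 = complex_of_real (1/4)" by (simp add: complex_eq_iff)
    then have "Gamma (Complex (1/4) 0) = of_real (Gamma (1/4))" by (simp only: Gamma_complex_of_real)
    moreover have "Gamma (1/4 :: real) > 0" by (rule Gamma_real_pos) simp
    ultimately show ?thesis by (simp add: g_def sgn_of_real)
  qed
  ultimately have "chi_inv_sqrt = g"
    unfolding chi_inv_sqrt_def by (intro the1_equality[OF chi_inv_sqrt_ex1]) blast
  then show ?thesis unfolding g_def by (rule fun_cong)
qed

text \<open>The function \<open>H\<close>, with \<open>ln pi + \<i> * pi / 2\<close> as logarithm of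
  \<open>\<i> * pi\<close>; the resulting factor \<open>exp (pi * y / 2)\<close> in the modulus
  compensates the decay of Gamma in the upper half-plane.\<close>

definition theta_factor :: "complex \<Rightarrow> complex" where
  "theta_factor z = Gamma z * exp (- z * (of_real (ln pi) + \<i> * of_real (pi / 2)))"

text \<open>Both points are first divided by the common length \<open>norm b\<close>; what remains
  is the defect of lengths \<open>norm b - norm a\<close>, bounded by the same distance.\<close>

lemma norm_sgn_diff_le:
  fixes a b :: complex
  assumes "b \<noteq> 0"
  shows "norm (sgn a - sgn b) \<le> 2 * norm (a - b) / norm b"
proof (cases "a = 0")
  case False
  have "sgn a - sgn b = (a - b) / of_real (norm b) + sgn a * of_real ((norm b - norm a) / norm b)"
    using assms False by (simp add: sgn_div_norm scaleR_conv_of_real field_simps)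
  also have "norm \<dots> \<le> norm (a - b) / norm b + norm (a - b) / norm b"
  proof (rule norm_triangle_mono)
    have "norm (sgn a * of_real ((norm b - norm a) / norm b)) = \<bar>norm b - norm a\<bar> / norm b"
      using False by (simp add: norm_mult norm_divide norm_sgn del: of_real_diff of_real_divide)
    also have "\<dots> \<le> norm (a - b) / norm b"
      using norm_triangle_ineq3[of b a] by (intro divide_right_mono) (auto simp: norm_minus_commute)
    finally show "norm (sgn a * of_real ((norm b - norm a) / norm b)) \<le> norm (a - b) / norm b" .
  qed (simp add: norm_divide)
  finally show ?thesis by simp
qed (use assms in \<open>simp add: norm_sgn\<close>)

text \<open>On \<open>Re z = 1/2\<close> the power of \<open>y\<close> in the modulus of Gamma
  disappears, so the modulus of \<open>theta_factor\<close> is asymptotically constant; this singles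
  out the line. Both functions carry the same rotating phase: the branch is
  \<open>E * sgn (A y)\<close>, and \<open>theta_factor\<close> is \<open>K * E * B y\<close>. As
  \<open>A y\<close> and \<open>B y\<close> tend to \<open>a\<close> and \<open>c\<close>,
  \<open>\<kappa>\<close> is the constant that matches these limits.\<close>

lemma chi_inv_sqrt_approx:
  "\<exists>\<kappa> C. \<forall>y\<ge>1. norm (chi_inv_sqrt (2 * y) - \<kappa> * theta_factor (Complex (1/2) y)) \<le> C / y"
proof -
  obtain c where c: "c \<noteq> 0" "\<And>x. 0 < x \<Longrightarrow> x \<le> 1/2 \<Longrightarrow> \<exists>C. \<forall>y\<ge>1.
     norm (Gamma (Complex x y) * of_real (exp (pi * y / 2) * y powr (1/2 - x)) * cis (y - y * ln y)
       - c * cis (pi * (x - 1/2) / 2)) \<le> C / y"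
    using Gamma_vertical_asymptotics by blast
  define A where "A y = Gamma (Complex (1/4) y) * of_real (exp (pi * y / 2) * y powr (1/2 - 1/4)) * cis (y - y * ln y)" for y
  define B where "B y = Gamma (Complex (1/2) y) * of_real (exp (pi * y / 2)) * cis (y - y * ln y)" for y
  define a where "a = c * cis (pi * (1/4 - 1/2) / 2)"
  have a0: "a \<noteq> 0" using c(1) by (simp add: a_def)
  obtain C1 where C1: "\<And>y. y \<ge> 1 \<Longrightarrow> norm (A y - a) \<le> C1 / y"
    using c(2)[of "1/4"] by (auto simp: A_def a_def)
  obtain C2 where C2: "\<And>y. y \<ge> 1 \<Longrightarrow> norm (B y - c) \<le> C2 / y"
  proof -
    obtain C where "\<forall>y\<ge>1. norm (Gamma (Complex (1/2) y) * of_real (exp (pi * y / 2) * y powr (1/2 - 1/2)) * cis (y - y * ln y)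
       - c * cis (pi * (1/2 - 1/2) / 2)) \<le> C / y" using c(2)[of "1/2"] by auto
    then have "norm (B y - c) \<le> C / y" if "y \<ge> 1" for y using that by (auto simp: B_def)
    then show ?thesis using that by blast
  qed
  define K where "K = exp (- of_real (ln pi) / 2 - \<i> * of_real (pi / 4))"
  have K0: "K \<noteq> 0" by (simp add: K_def)
  define \<kappa> where "\<kappa> = sgn a / (c * K)"
  have "norm (chi_inv_sqrt (2 * y) - \<kappa> * theta_factor (Complex (1/2) y)) \<le> (2 * C1 / norm a + C2 / norm c) / y"
    if y: "y \<ge> 1" for y
  proof -
    define E where "E = cis (- (y * ln pi)) * cis (- (y - y * ln y))"
    have nE: "norm E = 1" by (simp add: E_def norm_mult)
    have EE: "cis (- (y - y * ln y)) * cis (y - y * ln y) = 1" by (simp add: cis_mult)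
    have "sgn (A y) = sgn (Gamma (Complex (1/4) y)) * cis (y - y * ln y)"
    proof -
      have "sgn (complex_of_real (exp (pi * y / 2) * y powr (1/2 - 1/4))) = 1"
        using y by (simp add: sgn_of_real sgn_mult del: of_real_mult)
      moreover have "sgn (cis (y - y * ln y)) = cis (y - y * ln y)" by (simp add: sgn_div_norm)
      ultimately show ?thesis by (simp only: A_def sgn_mult mult_1_right)
    qed
    then have X: "chi_inv_sqrt (2 * y) = E * sgn (A y)"
      using EE by (simp add: chi_inv_sqrt_eq E_def mult_ac)
    have "exp (- Complex (1/2) y * (of_real (ln pi) + \<i> * of_real (pi / 2))) = K * cis (- (y * ln pi)) * of_real (exp (pi * y / 2))"
      unfolding K_def cis_conv_exp exp_of_real[symmetric] exp_add[symmetric]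
      by (rule arg_cong[of _ _ exp]) (simp add: complex_eq_iff field_simps)
    then have "theta_factor (Complex (1/2) y) = K * E * B y"
      using EE by (simp add: theta_factor_def B_def E_def mult_ac)
    then have "chi_inv_sqrt (2 * y) - \<kappa> * theta_factor (Complex (1/2) y) = E * (sgn (A y) - sgn a * (B y / c))"
      using X K0 c(1) by (simp add: \<kappa>_def field_simps)
    also have "\<dots> = E * ((sgn (A y) - sgn a) + sgn a * ((c - B y) / c))"
      using c(1) by (simp add: field_simps)
    also have "norm \<dots> = norm ((sgn (A y) - sgn a) + sgn a * ((c - B y) / c))"
      using nE by (simp add: norm_mult)
    also have "\<dots> \<le> 2 * (C1 / y) / norm a + (C2 / y) / norm c"
    proof (rule norm_triangle_mono)
      have "norm (sgn (A y) - sgn a) \<le> 2 * norm (A y - a) / norm a" by (rule norm_sgn_diff_le[OF a0])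
      also have "\<dots> \<le> 2 * (C1 / y) / norm a" using C1[OF y] by (intro divide_right_mono) auto
      finally show "norm (sgn (A y) - sgn a) \<le> 2 * (C1 / y) / norm a" .
      have "norm (sgn a * ((c - B y) / c)) = norm (B y - c) / norm c"
        using a0 by (simp add: norm_mult norm_divide norm_sgn norm_minus_commute)
      also have "\<dots> \<le> (C2 / y) / norm c" using C2[OF y] by (intro divide_right_mono) auto
      finally show "norm (sgn a * ((c - B y) / c)) \<le> (C2 / y) / norm c" .
    qed
    finally show ?thesis using y by (simp add: add_divide_distrib mult.commute)
  qed
  then show ?thesis by blast
qed

section \<open>Small terms: shift to the left\<close>

lemma contour_integral_linepath_same_Im:
  assumes "a < b"
  shows "contour_integral (linepath (Complex a c) (Complex b c)) f = integral {a..b} (\<lambda>x. f (Complex x c))"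
proof -
  define g where "g z = f (z + Complex 0 c)" for z
  have "contour_integral (linepath (Complex a c) (Complex b c)) f =
      of_real (b - a) * integral {0..1} (\<lambda>x. f (linepath (Complex a c) (Complex b c) x))"
    by (simp add: contour_integral_integral Complex_eq)
  also have "(\<lambda>x. f (linepath (Complex a c) (Complex b c) x)) = (\<lambda>x. g (linepath (of_real a) (of_real b) x))"
    by (simp add: g_def linepath_def scaleR_conv_of_real Complex_eq algebra_simps)
  also have "of_real (b - a) * integral {0..1} (\<lambda>x. g (linepath (of_real a) (of_real b) x)) =
      contour_integral (linepath (of_real a) (of_real b)) g"
    by (simp add: contour_integral_integral)
  also have "\<dots> = integral {a..b} (\<lambda>x. g (of_real x))"
    using assms by (subst contour_integral_linepath_Reals_eq) auto
  also have "\<dots> = integral {a..b} (\<lambda>x. f (Complex x c))"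
    by (simp add: g_def Complex_eq)
  finally show ?thesis .
qed

lemma contour_integral_rectpath_eq:
  assumes ab: "a1 < b1" "a2 < b2" and f: "continuous_on (path_image (rectpath (Complex a1 a2) (Complex b1 b2))) f"
  shows "contour_integral (rectpath (Complex a1 a2) (Complex b1 b2)) f =
     integral {a1..b1} (\<lambda>x. f (Complex x a2)) + \<i> * integral {a2..b2} (\<lambda>y. f (Complex b1 y))
     - integral {a1..b1} (\<lambda>x. f (Complex x b2)) - \<i> * integral {a2..b2} (\<lambda>y. f (Complex a1 y))"
proof -
  define A B C D where "A = Complex a1 a2" and "B = Complex b1 a2" and "C = Complex b1 b2" and "D = Complex a1 b2"
  have rp: "rectpath A C = linepath A B +++ linepath B C +++ linepath C D +++ linepath D A"
    by (simp add: rectpath_def Let_def A_def B_def C_def D_def)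
  have img: "path_image (rectpath A C) = closed_segment A B \<union> (closed_segment B C \<union> (closed_segment C D \<union> closed_segment D A))"
    unfolding rp by (simp add: path_image_join)
  have c: "continuous_on (closed_segment A B) f" "continuous_on (closed_segment B C) f"
      "continuous_on (closed_segment C D) f" "continuous_on (closed_segment D A) f"
    using f unfolding A_def[symmetric] C_def[symmetric] img by (auto intro: continuous_on_subset)
  then have i: "f contour_integrable_on linepath A B" "f contour_integrable_on linepath B C"
      "f contour_integrable_on linepath C D" "f contour_integrable_on linepath D A"
    by (auto intro: contour_integrable_continuous_linepath)
  have "contour_integral (rectpath A C) f = contour_integral (linepath A B) f + (contour_integral (linepath B C) f
      + (contour_integral (linepath C D) f + contour_integral (linepath D A) f))"
    unfolding rp using i by (simp add: contour_integrable_joinI)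
  also have "contour_integral (linepath C D) f = - contour_integral (linepath D C) f"
    by (rule contour_integral_reverse_linepath[OF c(3)])
  also have "contour_integral (linepath D A) f = - contour_integral (linepath A D) f"
    by (rule contour_integral_reverse_linepath[OF c(4)])
  also have "contour_integral (linepath A B) f = integral {a1..b1} (\<lambda>x. f (Complex x a2))"
    unfolding A_def B_def by (rule contour_integral_linepath_same_Im[OF ab(1)])
  also have "contour_integral (linepath D C) f = integral {a1..b1} (\<lambda>x. f (Complex x b2))"
    unfolding D_def C_def by (rule contour_integral_linepath_same_Im[OF ab(1)])
  also have "contour_integral (linepath B C) f = \<i> * integral {a2..b2} (\<lambda>y. f (Complex b1 y))"
    by (rule contour_integral_linepath_same_Re) (use ab in \<open>auto simp: B_def C_def\<close>)
  also have "contour_integral (linepath A D) f = \<i> * integral {a2..b2} (\<lambda>y. f (Complex a1 y))"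
    by (rule contour_integral_linepath_same_Re) (use ab in \<open>auto simp: A_def D_def\<close>)
  finally show ?thesis by (simp add: A_def C_def)
qed

lemma Cauchy_rectangle:
  assumes ab: "a1 < b1" "a2 < b2" and S: "convex S" "f holomorphic_on S" "cbox (Complex a1 a2) (Complex b1 b2) \<subseteq> S"
  shows "\<i> * integral {a2..b2} (\<lambda>y. f (Complex a1 y)) =
     integral {a1..b1} (\<lambda>x. f (Complex x a2)) + \<i> * integral {a2..b2} (\<lambda>y. f (Complex b1 y))
     - integral {a1..b1} (\<lambda>x. f (Complex x b2))"
proof -
  have sub: "path_image (rectpath (Complex a1 a2) (Complex b1 b2)) \<subseteq> S"
    using ab S(3) path_image_rectpath_subset_cbox[of "Complex a1 a2" "Complex b1 b2"] by auto
  have "(f has_contour_integral 0) (rectpath (Complex a1 a2) (Complex b1 b2))"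
    using sub S by (intro Cauchy_theorem_convex_simple) auto
  then have "contour_integral (rectpath (Complex a1 a2) (Complex b1 b2)) f = 0"
    by (rule contour_integral_unique)
  moreover have "continuous_on (path_image (rectpath (Complex a1 a2) (Complex b1 b2))) f"
    using sub S by (meson continuous_on_subset holomorphic_on_imp_continuous_on)
  ultimately show ?thesis using contour_integral_rectpath_eq[OF ab, of f] by (simp add: algebra_simps)
qed

text \<open>The kernel \<open>Gamma z * (\<i> * X) powr (- z)\<close>, from which Mellin inversion
  produces \<open>cis (- X)\<close>.\<close>

definition mellin_kernel :: "real \<Rightarrow> complex \<Rightarrow> complex" where
  "mellin_kernel X z = Gamma z * exp (- z * (of_real (ln X) + \<i> * of_real (pi / 2)))"

lemma norm_mellin_kernel:
  "norm (mellin_kernel X (Complex x y)) = norm (Gamma (Complex x y)) * exp (pi * y / 2) * exp (- x * ln X)"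
  by (simp add: mellin_kernel_def norm_mult exp_add[symmetric] mult.assoc)

lemma holomorphic_mellin_kernel:
  assumes "A \<inter> \<int>\<^sub>\<le>\<^sub>0 = {}"
  shows "mellin_kernel X holomorphic_on A"
  unfolding mellin_kernel_def using assms by (intro holomorphic_intros) auto

lemma continuous_on_mellin_kernel:
  assumes "A \<inter> \<int>\<^sub>\<le>\<^sub>0 = {}"
  shows "continuous_on A (mellin_kernel X)"
  using holomorphic_mellin_kernel[OF assms] by (rule holomorphic_on_imp_continuous_on)

lemma Complex_notin_nonpos_Ints:
  assumes "x \<notin> \<int> \<or> x > 0 \<or> y \<noteq> 0"
  shows "Complex x y \<notin> \<int>\<^sub>\<le>\<^sub>0"
  using assms by (auto simp: complex_eq_iff elim!: nonpos_Ints_cases)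

lemma Gamma_cnj_norm: "norm (Gamma (Complex x (- y))) = norm (Gamma (Complex x y))"
proof -
  have "Complex x (- y) = cnj (Complex x y)" by (simp add: complex_eq_iff)
  then show ?thesis by (metis cnj_Gamma complex_mod_cnj)
qed

lemma integral_exp_le:
  fixes L :: real
  assumes "L > 0" "a \<le> b"
  shows "integral {a..b} (\<lambda>x. exp (L * x)) \<le> exp (L * b) / L" "(\<lambda>x. exp (L * x)) integrable_on {a..b}"
proof -
  have "((\<lambda>x. exp (L * x)) has_integral (exp (L * b) / L - exp (L * a) / L)) {a..b}"
    using assms by (intro fundamental_theorem_of_calculus)
      (auto intro!: derivative_eq_intros simp flip: has_real_derivative_iff_has_vector_derivative)
  then show "integral {a..b} (\<lambda>x. exp (L * x)) \<le> exp (L * b) / L" "(\<lambda>x. exp (L * x)) integrable_on {a..b}"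
    using assms by (auto simp: has_integral_iff)
qed

text \<open>Gamma has residue \<open>(-1) ^ k / fact k\<close> at \<open>- k\<close>, and the
  exponential contributes \<open>(\<i> * X) ^ k\<close>: the residues are the terms of the
  exponential series at \<open>- \<i> * X\<close>.\<close>

lemma residue_mellin_kernel:
  assumes "X > 0"
  shows "residue (mellin_kernel X) (- of_nat k) = (- \<i> * of_real X) ^ k / fact k"
proof (rule residue_simple')
  show "open (- (\<int>\<^sub>\<le>\<^sub>0 - {-of_nat k}) :: complex set)"
    by (intro open_Compl closed_subset_Ints) auto
  show "mellin_kernel X holomorphic_on (- (\<int>\<^sub>\<le>\<^sub>0 - {-of_nat k}) - {- of_nat k})"
    by (rule holomorphic_mellin_kernel) auto
  have "(\<lambda>w. (Gamma w * (w + of_nat k)) * exp (- w * (of_real (ln X) + \<i> * of_real (pi / 2)))) \<midarrow>(- of_nat k)\<rightarrow>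
      ((-1) ^ k / fact k) * exp (- (- of_nat k) * (of_real (ln X) + \<i> * of_real (pi / 2)))"
    by (intro tendsto_mult Gamma_residues tendsto_intros)
  also have "exp (- (- of_nat k) * (of_real (ln X) + \<i> * of_real (pi / 2))) = (of_real X * \<i>) ^ k"
  proof -
    have "exp (of_real (ln X) + \<i> * of_real (pi / 2)) = of_real X * \<i>"
      unfolding exp_add exp_of_real cis_conv_exp[symmetric] cis_pi_half using assms by simp
    then show ?thesis by (simp only: minus_minus exp_of_nat_mult)
  qed
  also have "((-1) ^ k / fact k) * (of_real X * \<i>) ^ k = (- \<i> * of_real X) ^ k / (fact k :: complex)"
    by (simp flip: power_mult_distrib add: mult.commute)
  finally show "(\<lambda>w. mellin_kernel X w * (w - - of_nat k)) \<midarrow>(- of_nat k)\<rightarrow> (- \<i> * of_real X) ^ k / fact k"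
    by (simp add: mellin_kernel_def mult_ac)
qed auto

text \<open>The left side runs midway between the poles \<open>- K\<close> and
  \<open>- K - 1\<close>, so exactly the poles from \<open>0\<close> down to \<open>- K\<close> are
  enclosed.\<close>

lemma mellin_kernel_rectangle:
  fixes K :: nat and a X Y :: real
  assumes X: "X > 0" and Y: "Y > 0"
  defines "a \<equiv> - real K - 1/2"
  shows "integral {a..1/2} (\<lambda>x. mellin_kernel X (Complex x (- Y))) + \<i> * integral {- Y..Y} (\<lambda>y. mellin_kernel X (Complex (1/2) y))
     - integral {a..1/2} (\<lambda>x. mellin_kernel X (Complex x Y)) - \<i> * integral {- Y..Y} (\<lambda>y. mellin_kernel X (Complex a y))
    = 2 * pi * \<i> * (\<Sum>k\<le>K. (- \<i> * of_real X) ^ k / fact k)"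
proof -
  define R where "R = rectpath (Complex a (- Y)) (Complex (1/2) Y)"
  define S where "S = {z. Re z > - real K - 1}"
  define pts where "pts = (\<lambda>k. - complex_of_nat k) ` {..K}"
  have ab: "a < 1/2" "- Y < Y" using Y by (auto simp: a_def)
  have img: "path_image R = cbox (Complex a (- Y)) (Complex (1/2) Y) - box (Complex a (- Y)) (Complex (1/2) Y)"
    unfolding R_def using ab by (intro path_image_rectpath_cbox_minus_box) auto
  have inb: "p \<in> box (Complex a (- Y)) (Complex (1/2) Y)" if "p \<in> pts" for p
    using that Y by (auto simp: pts_def in_box_complex_iff a_def)
  have cS: "cbox (Complex a (- Y)) (Complex (1/2) Y) \<subseteq> S"
    by (auto simp: S_def in_cbox_complex_iff a_def)
  have imS: "path_image R \<subseteq> S - pts" using img inb cS by auto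
  have SI: "(S - pts) \<inter> \<int>\<^sub>\<le>\<^sub>0 = {}"
    by (force simp: S_def pts_def elim!: nonpos_Ints_cases')
  have "contour_integral R (mellin_kernel X) = 2 * pi * \<i> * (\<Sum>p\<in>pts. winding_number R p * residue (mellin_kernel X) p)"
  proof (rule Residue_theorem[where S = S])
    show "open S" "connected S"
      unfolding S_def by (auto intro!: open_halfspace_Re_gt convex_connected convex_halfspace_Re_gt)
    show "mellin_kernel X holomorphic_on S - pts" using SI by (rule holomorphic_mellin_kernel)
    show "\<forall>z. z \<notin> S \<longrightarrow> winding_number R z = 0"
      unfolding R_def using ab cS by (intro allI impI winding_number_rectpath_outside) auto
  qed (use imS in \<open>auto simp: R_def pts_def\<close>)
  also have "(\<Sum>p\<in>pts. winding_number R p * residue (mellin_kernel X) p) = (\<Sum>p\<in>pts. residue (mellin_kernel X) p)"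
    using inb by (intro sum.cong refl) (simp add: R_def winding_number_rectpath)
  also have "\<dots> = (\<Sum>k\<le>K. (- \<i> * of_real X) ^ k / fact k)"
    unfolding pts_def using X
    by (subst sum.reindex) (auto simp: inj_on_def residue_mellin_kernel)
  finally have "contour_integral R (mellin_kernel X) = 2 * pi * \<i> * (\<Sum>k\<le>K. (- \<i> * of_real X) ^ k / fact k)" .
  moreover have "continuous_on (path_image R) (mellin_kernel X)"
    using SI imS by (intro continuous_on_mellin_kernel) auto
  ultimately show ?thesis
    using contour_integral_rectpath_eq[OF ab, of "mellin_kernel X"] unfolding R_def by simp
qed

text \<open>The error comes from the horizontal sides, on which the kernel decays
  exponentially to the left because \<open>X < Y\<close>.\<close>
lemma mellin_kernel_truncated_inversion:
  "\<exists>C>0. \<forall>X Y. 0 < X \<longrightarrow> X < Y \<longrightarrow> 1 \<le> Y \<longrightarrow>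
     norm (integral {- Y..Y} (\<lambda>y. mellin_kernel X (Complex (1/2) y)) - 2 * of_real pi * cis (- X))
       \<le> C / sqrt X / ln (Y / X)"
proof -
  obtain C where C: "C > 0" "\<And>x y. x \<le> 3/2 \<Longrightarrow> y \<ge> 1 \<Longrightarrow>
      norm (Gamma (Complex x y)) * exp (pi * y / 2) \<le> C * y powr (x - 1/2)"
    using Gamma_upper_bound_left by blast
  have "norm (integral {- Y..Y} (\<lambda>y. mellin_kernel X (Complex (1/2) y)) - 2 * of_real pi * cis (- X)) \<le> 2 * C / sqrt X / ln (Y / X)"
    if X: "0 < X" "X < Y" and Y: "1 \<le> Y" for X Y
  proof -
    define L where "L = ln (Y / X)"
    have L: "L > 0" using X by (simp add: L_def)
    define a where "a K = - real K - 1/2" for K :: nat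
    define J where "J = integral {- Y..Y} (\<lambda>y. mellin_kernel X (Complex (1/2) y))"
    define B where "B = C / sqrt X / L"
    \<comment> \<open>The size \<open>Y powr (x - 1/2)\<close> of Gamma against
      \<open>X powr (- x)\<close> leaves \<open>(Y / X) powr x / sqrt Y\<close>. On the lower side
      the factor \<open>exp (pi * y / 2)\<close> is even smaller, so one bound serves both.\<close>
    have hb: "norm (mellin_kernel X (Complex x Y')) \<le> C / sqrt Y * exp (L * x)" if "x \<le> 1/2" "Y' = Y \<or> Y' = - Y" for x Y'
    proof -
      have "norm (mellin_kernel X (Complex x Y')) \<le> norm (Gamma (Complex x Y)) * exp (pi * Y / 2) * exp (- x * ln X)"
        using that Y Gamma_cnj_norm[of x Y] unfolding norm_mellin_kernel
        by (intro mult_right_mono) (auto intro!: mult_left_mono)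
      also have "\<dots> \<le> C * Y powr (x - 1/2) * exp (- x * ln X)"
        using C(2)[of x Y] that Y by (intro mult_right_mono) auto
      also have "Y powr (x - 1/2) = exp (x * ln Y) * (1 / sqrt Y)"
        using Y by (simp add: powr_diff powr_half_sqrt) (simp add: powr_def)
      also have "C * (exp (x * ln Y) * (1 / sqrt Y)) * exp (- x * ln X) = C / sqrt Y * exp (L * x)"
      proof -
        have "exp (L * x) = exp (x * ln Y) * exp (- x * ln X)"
          using X by (simp add: L_def ln_div algebra_simps flip: exp_add)
        then show ?thesis by simp
      qed
      finally show ?thesis .
    qed
    have hor: "norm (integral {a K..1/2} (\<lambda>x. mellin_kernel X (Complex x Y'))) \<le> B" if Y': "Y' = Y \<or> Y' = - Y" for K Y'
    proof -
      have aK: "a K \<le> 1/2" by (simp add: a_def)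
      have "Y' \<noteq> 0" using Y' Y by auto
      then have "continuous_on {a K..1/2} (\<lambda>x. mellin_kernel X (Complex x Y'))"
        by (intro continuous_on_compose2[OF continuous_on_mellin_kernel[of "{z. Im z = Y'}"]])
           (auto simp: Complex_eq intro!: continuous_intros elim!: nonpos_Ints_cases)
      then have "norm (integral {a K..1/2} (\<lambda>x. mellin_kernel X (Complex x Y')))
         \<le> integral {a K..1/2} (\<lambda>x. C / sqrt Y * exp (L * x))"
        using hb Y' L aK by (intro integral_norm_bound_integral integrable_continuous_interval continuous_intros) auto
      also have "\<dots> = C / sqrt Y * integral {a K..1/2} (\<lambda>x. exp (L * x))" by simp
      also have "\<dots> \<le> C / sqrt Y * (exp (L * (1/2)) / L)"
        using C(1) Y integral_exp_le[OF L aK] by (intro mult_left_mono) auto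
      also have "exp (L * (1/2)) = sqrt Y / sqrt X"
      proof -
        have "exp (L * (1/2)) = (Y / X) powr (1/2)" using X by (simp add: L_def powr_def mult.commute)
        then show ?thesis using X by (simp add: powr_half_sqrt real_sqrt_divide)
      qed
      also have "C / sqrt Y * (sqrt Y / sqrt X / L) = B" using Y by (simp add: B_def)
      finally show ?thesis .
    qed
    \<comment> \<open>For the left side a compactness bound on \<open>Re z = -1/2\<close> is enough:
      each further step to the left divides by at least \<open>Suc K\<close>, so Gamma is
      \<open>O (1 / fact K)\<close> there.\<close>
    have "continuous_on {- Y..Y} (\<lambda>y. Gamma (Complex (-1/2) y))"
    proof (intro continuous_at_imp_continuous_on ballI isCont_Gamma)
      have "Complex (-1/2) = (\<lambda>y. of_real (-1/2) + \<i> * of_real y)" by (simp add: fun_eq_iff Complex_eq)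
      then show "isCont (Complex (-1/2)) y" for y
        by (auto intro!: continuous_intros)
      have "- 1 / 2 \<notin> (\<int> :: real set)"
      proof
        assume "- 1 / 2 \<in> (\<int> :: real set)"
        then obtain n :: int where "- 1 / 2 = real_of_int n" by (auto elim: Ints_cases)
        then have "real_of_int (2 * n) = real_of_int (- 1)" by simp
        then have "2 * n = - 1" by (simp only: of_int_eq_iff)
        then show False by presburger
      qed
      then show "Complex (-1/2) y \<notin> \<int>\<^sub>\<le>\<^sub>0" for y by (intro Complex_notin_nonpos_Ints) auto
    qed
    then have "bounded ((\<lambda>y. Gamma (Complex (-1/2) y)) ` {- Y..Y})"
      by (intro compact_imp_bounded compact_continuous_image) auto
    then obtain M where M: "\<forall>y\<in>{- Y..Y}. norm (Gamma (Complex (-1/2) y)) \<le> M"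
      by (auto simp: bounded_iff)
    have M0: "M \<ge> 0" using M[rule_format, of 0] Y by (auto intro: order_trans[OF norm_ge_zero])
    have aI: "a K \<notin> \<int>" for K
    proof
      assume "a K \<in> \<int>"
      then obtain n :: int where "- real K - 1/2 = real_of_int n" by (auto simp: a_def elim: Ints_cases)
      then have "real_of_int (2 * n) = real_of_int (- 1 - 2 * int K)" by simp
      then have "2 * n = - 1 - 2 * int K" by (simp only: of_int_eq_iff)
      then show False by presburger
    qed
    have GK: "norm (Gamma (Complex (a K) y)) \<le> M / fact K" if y: "y \<in> {- Y..Y}" for K y
    proof (induction K)
      case 0
      then show ?case using M y by (simp add: a_def)
    next
      case (Suc K)
      define z where "z = Complex (a (Suc K)) y"
      have z: "z \<notin> \<int>\<^sub>\<le>\<^sub>0" unfolding z_def using aI by (intro Complex_notin_nonpos_Ints) auto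
      then have nz: "z \<noteq> 0" by auto
      have z1: "z + 1 = Complex (a K) y" by (simp add: z_def complex_eq_iff a_def)
      have zK: "norm z \<ge> real (Suc K)" using abs_Re_le_cmod[of z] by (simp add: z_def a_def)
      have "norm (Gamma z) = norm (Gamma (z + 1)) / norm z"
        using Gamma_plus1[OF z] nz by (simp add: norm_mult)
      also have "\<dots> \<le> (M / fact K) / real (Suc K)"
        unfolding z1 using Suc zK M0 by (intro frac_le) auto
      also have "\<dots> = M / fact (Suc K)" by (simp add: field_simps)
      finally show ?case by (simp add: z_def)
    qed
    define D where "D = 2 * Y * M * exp (pi * Y / 2) * sqrt X"
    have lef: "norm (integral {- Y..Y} (\<lambda>y. mellin_kernel X (Complex (a K) y))) \<le> D * (X ^ K / fact K)" for K
    proof -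
      have "continuous_on {- Y..Y} (\<lambda>y. mellin_kernel X (Complex (a K) y))"
        using aI[of K]
      proof (intro continuous_on_compose2[OF continuous_on_mellin_kernel[of "{z. Re z = a K}"]])
        show "{z. Re z = a K} \<inter> \<int>\<^sub>\<le>\<^sub>0 = {}"
          using aI[of K] by (auto elim!: nonpos_Ints_cases) (metis Ints_of_int)
      qed (auto simp: Complex_eq intro!: continuous_intros)
      then have "norm (integral {- Y..Y} (\<lambda>y. mellin_kernel X (Complex (a K) y))) \<le>
         (M / fact K * exp (pi * Y / 2) * exp (- a K * ln X)) * (Y - - Y)"
      proof (intro integral_bound)
        fix y assume y: "y \<in> {- Y..Y}"
        show "norm (mellin_kernel X (Complex (a K) y)) \<le> M / fact K * exp (pi * Y / 2) * exp (- a K * ln X)"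
          unfolding norm_mellin_kernel using GK[OF y] y M0 by (intro mult_mono) auto
      qed (use Y in auto)
      also have "exp (- a K * ln X) = X powr (real K + 1/2)"
        using X by (simp add: a_def powr_def)
      also have "X powr (real K + 1/2) = X ^ K * sqrt X"
        using X by (simp add: powr_add powr_realpow powr_half_sqrt)
      also have "M / fact K * exp (pi * Y / 2) * (X ^ K * sqrt X) * (Y - - Y) = D * (X ^ K / fact K)"
        by (simp add: D_def)
      finally show ?thesis .
    qed
    \<comment> \<open>\<open>B\<close> and \<open>D\<close> do not depend on \<open>K\<close>: in
      the limit the left side vanishes and the residues complete the exponential series.\<close>
    have key: "norm (\<i> * J - 2 * pi * \<i> * (\<Sum>k\<le>K. (- \<i> * of_real X) ^ k / fact k)) \<le> 2 * B + D * (X ^ K / fact K)" for K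
    proof -
      define i1 i2 i3 where "i1 = integral {a K..1/2} (\<lambda>x. mellin_kernel X (Complex x (- Y)))"
        and "i2 = integral {a K..1/2} (\<lambda>x. mellin_kernel X (Complex x Y))"
        and "i3 = integral {- Y..Y} (\<lambda>y. mellin_kernel X (Complex (a K) y))"
      have "i1 + \<i> * J - i2 - \<i> * i3 = 2 * pi * \<i> * (\<Sum>k\<le>K. (- \<i> * of_real X) ^ k / fact k)"
        unfolding i1_def i2_def i3_def J_def a_def using X Y by (intro mellin_kernel_rectangle) auto
      then have "\<i> * J - 2 * pi * \<i> * (\<Sum>k\<le>K. (- \<i> * of_real X) ^ k / fact k) = (i2 + \<i> * i3) - i1"
        by (simp add: algebra_simps)
      also have "norm \<dots> \<le> (B + D * (X ^ K / fact K)) + B"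
        using hor[of Y K] hor[of "- Y" K] lef[of K] unfolding i1_def i2_def i3_def
        by (intro norm_triangle_le_diff add_mono norm_triangle_le) (auto simp: norm_mult)
      finally show ?thesis by simp
    qed
    have "(\<lambda>k. (- \<i> * of_real X) ^ k / fact k) sums exp (- \<i> * of_real X)"
      using exp_converges[of "- \<i> * of_real X"] by (simp add: scaleR_conv_of_real field_simps)
    then have "(\<lambda>K. \<Sum>k\<le>K. (- \<i> * of_real X) ^ k / fact k) \<longlonglongrightarrow> exp (- \<i> * of_real X)"
      by (simp add: sums_def_le)
    then have "(\<lambda>K. norm (\<i> * J - 2 * pi * \<i> * (\<Sum>k\<le>K. (- \<i> * of_real X) ^ k / fact k))) \<longlonglongrightarrow>
        norm (\<i> * J - 2 * pi * \<i> * exp (- \<i> * of_real X))"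
      by (intro tendsto_intros)
    moreover have "(\<lambda>K. 2 * B + D * (X ^ K / fact K)) \<longlonglongrightarrow> 2 * B + D * 0"
    proof (intro tendsto_intros)
      have "summable (\<lambda>K. X ^ K / fact K)" using summable_exp[of X] by (simp add: field_simps)
      then show "(\<lambda>K. X ^ K / fact K) \<longlonglongrightarrow> 0" by (rule summable_LIMSEQ_zero)
    qed
    ultimately have "norm (\<i> * J - 2 * pi * \<i> * exp (- \<i> * of_real X)) \<le> 2 * B + D * 0"
      by (rule LIMSEQ_le) (use key in blast)
    moreover have "\<i> * J - 2 * pi * \<i> * exp (- \<i> * of_real X) = \<i> * (J - 2 * of_real pi * cis (- X))"
      by (simp add: cis_conv_exp algebra_simps)
    ultimately show ?thesis by (simp add: norm_mult J_def B_def L_def)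
  qed
  then show ?thesis using C(1) by (intro exI[of _ "2 * C"]) auto
qed

text \<open>The power \<open>n powr (- 2 * z)\<close> joins \<open>pi powr (- z)\<close>, so the
  \<open>n\<close>-th term is the kernel at \<open>X = pi * n^2\<close>, where
  \<open>cis (- X)\<close> is a sign; the leftover \<open>n powr (1/2)\<close> becomes the
  weight.\<close>

lemma theta_factor_eq_mellin_kernel:
  assumes "n \<ge> 1"
  shows "theta_factor z * of_nat n powr (- (2 * z - 1/2)) = of_real (sqrt (real n)) * mellin_kernel (pi * (real n)\<^sup>2) z"
proof -
  have ln: "ln (pi * (real n)\<^sup>2) = ln pi + 2 * ln (real n)"
    using assms by (simp add: ln_mult ln_realpow)
  have "of_nat n powr (- (2 * z - 1/2)) = exp (- (2 * z - 1/2) * of_real (ln (real n)))"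
    using assms Ln_of_real[of "real n"] by (auto simp: powr_def)
  moreover have "of_real (sqrt (real n)) = exp (complex_of_real (ln (real n) / 2))"
    using assms by (simp only: exp_of_real) (simp flip: powr_half_sqrt add: powr_def)
  moreover have "- z * (of_real (ln pi) + \<i> * of_real (pi / 2)) + (- (2 * z - 1/2) * of_real (ln (real n))) =
     complex_of_real (ln (real n) / 2) + (- z * (of_real (ln (pi * (real n)\<^sup>2)) + \<i> * of_real (pi / 2)))"
    unfolding ln by (simp add: algebra_simps)
  ultimately show ?thesis
    by (simp only: theta_factor_def mellin_kernel_def mult.assoc exp_add[symmetric] mult.left_commute[of _ "Gamma z"])
qed

lemma norm_theta_factor:
  "norm (theta_factor (Complex x y)) = norm (Gamma (Complex x y)) * exp (pi * y / 2) * pi powr (- x)"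
proof -
  have eq: "theta_factor = mellin_kernel pi" by (simp add: fun_eq_iff theta_factor_def mellin_kernel_def)
  show ?thesis unfolding eq norm_mellin_kernel powr_def by simp
qed

text \<open>By reflection, \<open>(norm (Gamma (1/2 + \<i> * y)))^2 = pi / cosh (pi * y)\<close>, so
  \<open>theta_factor\<close> is bounded for positive and decays exponentially for negative
  \<open>y\<close>. The bound serves on \<open>[- Y, 1]\<close>, to discard the part of the
  inversion integral below height 1.\<close>

lemma norm_theta_factor_half_le: "norm (theta_factor (Complex (1/2) y)) \<le> 2 * exp y"
proof -
  define z where "z = Complex (1/2) y"
  define h where "h = (exp (pi * y) + exp (- pi * y)) / 2"
  have z1: "1 - z = cnj z" by (simp add: z_def complex_eq_iff)
  have "of_real (norm (Gamma z) ^ 2) = Gamma z * cnj (Gamma z)"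
    using complex_norm_square[of "Gamma z"] by simp
  also have "\<dots> = Gamma z * Gamma (1 - z)" by (simp add: z1 cnj_Gamma)
  also have "\<dots> = of_real pi / sin (of_real pi * z)" by (rule Gamma_reflection_complex)
  also have "of_real pi * z = of_real (pi / 2) + \<i> * of_real (pi * y)"
    by (simp add: z_def complex_eq_iff)
  also have "sin \<dots> = of_real (h)"
  proof -
    have "cos (\<i> * complex_of_real (pi * y)) = of_real h"
      by (simp add: cos_exp_eq h_def mult.assoc[symmetric] exp_of_real[symmetric])
    then show ?thesis unfolding sin_add sin_of_real cos_of_real by simp
  qed
  finally have "norm (Gamma z) ^ 2 = pi / h"
    by (metis of_real_divide of_real_eq_iff)
  moreover have "h \<ge> exp (- pi * y) / 2" by (simp add: h_def)
  moreover have "h \<ge> exp (pi * y) / 2" by (simp add: h_def)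
  moreover have cp: "h > 0" by (simp add: h_def add_pos_pos)
  ultimately have g: "norm (Gamma z) ^ 2 \<le> 2 * pi * exp (pi * y)" "norm (Gamma z) ^ 2 \<le> 2 * pi * exp (- pi * y)"
  proof -
    assume a: "norm (Gamma z) ^ 2 = pi / h" and b: "h \<ge> exp (- pi * y) / 2"
      and c: "h \<ge> exp (pi * y) / 2"
    have "pi / h \<le> pi / (exp (- pi * y) / 2)" using b cp by (intro divide_left_mono) auto
    then show "norm (Gamma z) ^ 2 \<le> 2 * pi * exp (pi * y)" using a by (simp add: exp_minus field_simps)
    have "pi / h \<le> pi / (exp (pi * y) / 2)" using c cp by (intro divide_left_mono) auto
    then show "norm (Gamma z) ^ 2 \<le> 2 * pi * exp (- pi * y)" using a by (simp add: exp_minus field_simps)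
  qed
  have "norm (theta_factor z) ^ 2 = norm (Gamma z) ^ 2 * exp (pi * y) / pi"
  proof -
    have "(exp (pi * y / 2)) ^ 2 = exp (pi * y)" by (simp flip: exp_double)
    moreover have "(pi powr (- (1/2))) ^ 2 = 1 / pi" by (simp add: powr_minus powr_half_sqrt power_inverse divide_simps)
    ultimately show ?thesis by (simp add: z_def norm_theta_factor power_mult_distrib)
  qed
  also have "\<dots> \<le> 4 * exp (2 * y)"
  proof (cases "y \<ge> 0")
    case True
    have "norm (Gamma z) ^ 2 * exp (pi * y) / pi \<le> 2 * pi * exp (- pi * y) * exp (pi * y) / pi"
      using g by (intro divide_right_mono mult_right_mono) auto
    also have "\<dots> = 2" by (simp add: exp_minus)
    also have "\<dots> \<le> 4 * exp (2 * y)" using True one_le_exp_iff[of "2 * y"] by linarith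
    finally show ?thesis .
  next
    case False
    have "norm (Gamma z) ^ 2 * exp (pi * y) / pi \<le> 2 * pi * exp (pi * y) * exp (pi * y) / pi"
      using g by (intro divide_right_mono mult_right_mono) auto
    also have "\<dots> = 2 * exp (2 * (pi * y))" by (simp add: exp_double power2_eq_square)
    also have "\<dots> \<le> 2 * exp (2 * y)"
    proof -
      have "pi * y \<le> 1 * y" using False pi_gt3 by (intro mult_right_mono_neg) auto
      then show ?thesis by simp
    qed
    finally show ?thesis by (smt (verit) exp_ge_zero)
  qed
  also have "4 * exp (2 * y) = (2 * exp y) ^ 2" by (simp add: exp_double power_mult_distrib)
  finally show ?thesis unfolding z_def by (rule power2_le_imp_le) auto
qed

text \<open>As \<open>n^2\<close> and \<open>n\<close> have the same parity,
  \<open>cis (- pi * n^2)\<close> is \<open>(-1) ^ n\<close>. This cancellation is the saving in the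
  residues: with absolute values the sum has order \<open>N powr (3/2)\<close>.\<close>

lemma norm_alternating_sum_sqrt: "norm (\<Sum>n=1..N. complex_of_real (sqrt (real n)) * cis (- (pi * (real n)\<^sup>2))) \<le> sqrt (real N)"
proof -
  define T where "T N = (\<Sum>n=1..N. (-1) ^ n * sqrt (real n))" for N
  \<comment> \<open>The last term is the largest, so a partial sum has the sign of its last term and
    never exceeds it in size.\<close>
  have "0 \<le> (-1) ^ N * T N \<and> (-1) ^ N * T N \<le> sqrt (real N)" for N
  proof (induction N)
    case (Suc N)
    have "(-1) ^ Suc N * T (Suc N) = sqrt (real (Suc N)) - (-1) ^ N * T N"
      by (simp add: T_def algebra_simps flip: power_mult_distrib)
    moreover have "sqrt (real N) \<le> sqrt (real (Suc N))" by simp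
    ultimately show ?case using Suc by linarith
  qed (simp add: T_def)
  then have "\<bar>(-1) ^ N * T N\<bar> \<le> sqrt (real N)" for N by (smt (verit))
  then have T: "\<bar>T N\<bar> \<le> sqrt (real N)" for N by (simp add: abs_mult)
  have "cis (- (pi * (real n)\<^sup>2)) = (-1) ^ n" for n
  proof -
    have "cis (- (pi * (real n)\<^sup>2)) = cis (- (pi * real n)) ^ n"
      unfolding Complex.DeMoivre by (simp add: power2_eq_square mult_ac)
    also have "cis (- (pi * real n)) = (-1) ^ n"
    proof -
      have "cis (- pi) = -1" by (simp add: complex_eq_iff)
      then show ?thesis using Complex.DeMoivre[of "- pi" n] by (simp add: mult_ac)
    qed
    also have "((-1) ^ n) ^ n = (-1 :: complex) ^ n"
      by (cases "even n") auto
    finally show ?thesis .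
  qed
  then have "(\<Sum>n=1..N. complex_of_real (sqrt (real n)) * cis (- (pi * (real n)\<^sup>2))) = of_real (T N)"
    by (simp add: T_def mult.commute)
  then show ?thesis using T by simp
qed

lemma sum_inverse_le_ln: "N \<ge> 1 \<Longrightarrow> (\<Sum>m=1..N. 1 / real m) \<le> 1 + ln (real N)"
proof (induction N rule: nat_induct_at_least)
  case (Suc N)
  have "1 - 1 / (1 + 1 / real N) \<le> ln (1 + 1 / real N)"
  proof -
    have "ln (1 / (1 + 1 / real N)) \<le> 1 / (1 + 1 / real N) - 1" 
      by (intro ln_le_minus_one) (auto intro!: add_pos_nonneg)
    moreover have "1 + 1 / real N > 0" by (intro add_pos_nonneg) auto
    ultimately show ?thesis by (simp add: ln_div)
  qed
  also have "1 - 1 / (1 + 1 / real N) = 1 / real (Suc N)" using Suc.hyps by (simp add: field_simps)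
  also have "1 + 1 / real N = real (Suc N) / real N" using Suc.hyps by (simp add: field_simps)
  also have "ln \<dots> = ln (real (Suc N)) - ln (real N)" using Suc.hyps by (simp add: ln_div)
  finally show ?case using Suc.IH by simp
qed simp

lemma continuous_on_theta_factor_line:
  "x > 0 \<Longrightarrow> continuous_on A (\<lambda>y. theta_factor (Complex x y))"
  unfolding theta_factor_def
proof (intro continuous_intros continuous_at_imp_continuous_on ballI isCont_Gamma)
  have "Complex x = (\<lambda>y. of_real x + \<i> * of_real y)" by (simp add: fun_eq_iff Complex_eq)
  then show "isCont (Complex x) y" for y
    by (auto intro!: continuous_intros)
qed (auto simp: Complex_eq intro!: continuous_intros Complex_notin_nonpos_Ints simp flip: Complex_eq)

text \<open>For \<open>n = r\<close> the truncation error of the inversion is at most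
  \<open>C * P / (r * (P - r))\<close>, since \<open>ln (P / r) \<ge> (P - r) / P\<close>. The
  hypothesis \<open>N + 1 \<le> P\<close> makes \<open>P - r\<close> at least
  \<open>N + 1 - n\<close>, so the weighted errors sum to a harmonic sum times
  \<open>sqrt P\<close>, at the cost of one logarithm.\<close>

lemma theta_factor_dirichlet_sum_bound:
  "\<exists>C. \<forall>Y N. 10 \<le> Y \<longrightarrow> 1 \<le> N \<longrightarrow> real N + 1 \<le> sqrt (Y / pi) \<longrightarrow>
     norm (integral {1..Y} (\<lambda>y. theta_factor (Complex (1/2) y) * (\<Sum>n=1..N. of_nat n powr (- Complex (1/2) (2 * y)))))
      \<le> C * sqrt (sqrt (Y / pi)) * (1 + ln (sqrt (Y / pi)))"
proof -
  obtain C where C: "C > 0" "\<And>X Y. 0 < X \<Longrightarrow> X < Y \<Longrightarrow> 1 \<le> Y \<Longrightarrow>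
     norm (integral {- Y..Y} (\<lambda>y. mellin_kernel X (Complex (1/2) y)) - 2 * of_real pi * cis (- X)) \<le> C / sqrt X / ln (Y / X)"
    using mellin_kernel_truncated_inversion by blast
  have "norm (integral {1..Y} (\<lambda>y. theta_factor (Complex (1/2) y) * (\<Sum>n=1..N. of_nat n powr (- Complex (1/2) (2 * y)))))
      \<le> (3 * C + 2 * pi + 4 * exp 1) * sqrt P * (1 + ln P)"
    if Y: "10 \<le> Y" and N: "1 \<le> N" "real N + 1 \<le> P" and P: "P = sqrt (Y / pi)" for Y N P
  proof -
    define F where "F y = theta_factor (Complex (1/2) y) * (\<Sum>n=1..N. of_nat n powr (- Complex (1/2) (2 * y)))" for y
    have P2: "pi * P\<^sup>2 = Y" using Y by (simp add: P)
    have P1: "P \<ge> 2" using N by linarith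
    have lnP: "ln P \<ge> 0" using P1 by simp
    have contk: "continuous_on A (\<lambda>y. mellin_kernel X (Complex (1/2) y))" for A X
      by (intro continuous_on_compose2[OF continuous_on_mellin_kernel[of "{z. Re z = 1/2}"]])
         (auto simp: Complex_eq intro!: continuous_intros elim!: nonpos_Ints_cases)
    have Feq: "F y = (\<Sum>n=1..N. of_real (sqrt (real n)) * mellin_kernel (pi * (real n)\<^sup>2) (Complex (1/2) y))" for y
    proof -
      have "2 * Complex (1/2) y - 1/2 = Complex (1/2) (2 * y)" by (simp add: complex_eq_iff)
      then have "theta_factor (Complex (1/2) y) * of_nat n powr (- Complex (1/2) (2 * y)) =
          of_real (sqrt (real n)) * mellin_kernel (pi * (real n)\<^sup>2) (Complex (1/2) y)" if "n \<ge> 1" for n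
        using theta_factor_eq_mellin_kernel[OF that, of "Complex (1/2) y"] by simp
      then show ?thesis unfolding F_def sum_distrib_left by (intro sum.cong) auto
    qed
    have contF: "continuous_on A F" for A
      unfolding Feq[abs_def] by (intro continuous_intros contk)
    define I where "I n = integral {- Y..Y} (\<lambda>y. mellin_kernel (pi * (real n)\<^sup>2) (Complex (1/2) y))" for n
    have "integral {- Y..Y} F = (\<Sum>n=1..N. of_real (sqrt (real n)) * I n)"
      unfolding Feq[abs_def] I_def
      by (subst integral_sum) (auto intro!: integrable_continuous_interval continuous_intros contk)
    also have "\<dots> = 2 * of_real pi * (\<Sum>n=1..N. complex_of_real (sqrt (real n)) * cis (- (pi * (real n)\<^sup>2))) +
       (\<Sum>n=1..N. of_real (sqrt (real n)) * (I n - 2 * of_real pi * cis (- (pi * (real n)\<^sup>2))))"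
      unfolding sum_distrib_left sum.distrib[symmetric] by (intro sum.cong) (auto simp: algebra_simps)
    also have "norm \<dots> \<le> 2 * pi * sqrt (real N) + (\<Sum>n=1..N. C * (1 / sqrt (real n) + sqrt P / real (Suc N - n)))"
    proof (intro norm_triangle_mono sum_norm_le)
      show "norm (2 * of_real pi * (\<Sum>n=1..N. complex_of_real (sqrt (real n)) * cis (- (pi * (real n)\<^sup>2)))) \<le> 2 * pi * sqrt (real N)"
        using norm_alternating_sum_sqrt[of N] by (simp add: norm_mult)
      fix n assume n: "n \<in> {1..N}"
      define r where "r = real n"
      have r: "1 \<le> r" "r < P" "real (Suc N - n) \<le> P - r" "real (Suc N - n) > 0"
        using n N by (auto simp: r_def of_nat_diff)
      have X: "0 < pi * r\<^sup>2" "pi * r\<^sup>2 < Y"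
      proof -
        show "0 < pi * r\<^sup>2" using r by simp
        have "r\<^sup>2 < P\<^sup>2" using r by (intro power_strict_mono) auto
        then show "pi * r\<^sup>2 < Y" unfolding P2[symmetric] by simp
      qed
      have "Y / (pi * r\<^sup>2) = (P / r)\<^sup>2" unfolding P2[symmetric] by (simp add: power_divide)
      then have l1: "ln (Y / (pi * r\<^sup>2)) = 2 * ln (P / r)" using r P1 by (simp add: ln_realpow)
      have l2: "ln (P / r) \<ge> (P - r) / P"
      proof -
        have "ln (r / P) \<le> r / P - 1" using r by (intro ln_le_minus_one) auto
        moreover have "ln (r / P) = - ln (P / r)" using r by (simp add: ln_div)
        ultimately show ?thesis using r by (simp add: field_simps)
      qed
      have lp: "(P - r) / P > 0" using r by simp
      have "norm (I n - 2 * of_real pi * cis (- (pi * r\<^sup>2))) \<le> C / sqrt (pi * r\<^sup>2) / ln (Y / (pi * r\<^sup>2))"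
        unfolding I_def r_def[symmetric] using X Y by (intro C(2)) auto
      also have "\<dots> \<le> C / r / ((P - r) / P)"
      proof (intro frac_le)
        have "r = sqrt (1 * r\<^sup>2)" using r by simp
        also have "\<dots> \<le> sqrt (pi * r\<^sup>2)" using pi_gt3 r by (intro real_sqrt_le_mono mult_right_mono) auto
        finally show "r \<le> sqrt (pi * r\<^sup>2)" .
        show "(P - r) / P \<le> ln (Y / (pi * r\<^sup>2))" unfolding l1 using l2 lp by linarith
      qed (use C r lp in auto)
      finally have b: "norm (I n - 2 * of_real pi * cis (- (pi * r\<^sup>2))) \<le> C / r / ((P - r) / P)" .
      have "norm (of_real (sqrt r) * (I n - 2 * of_real pi * cis (- (pi * r\<^sup>2)))) \<le> sqrt r * (C / r / ((P - r) / P))"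
        unfolding norm_mult using b r by (intro mult_mono) auto
      \<comment> \<open>Partial fractions for \<open>P / (sqrt r * (P - r))\<close>.\<close>
      also have "\<dots> = C * (1 / sqrt r + sqrt r / (P - r))"
      proof -
        define q where "q = sqrt r"
        have q: "q > 0" "r = q * q" using r by (auto simp: q_def)
        show ?thesis unfolding q_def[symmetric] using q r by (simp add: field_simps)
      qed
      also have "\<dots> \<le> C * (1 / sqrt r + sqrt P / real (Suc N - n))"
        using C r by (intro mult_left_mono add_left_mono frac_le) auto
      finally show "norm (of_real (sqrt (real n)) * (I n - 2 * of_real pi * cis (- (pi * (real n)\<^sup>2)))) \<le> C * (1 / sqrt (real n) + sqrt P / real (Suc N - n))"
        by (simp add: r_def)
    qed
    also have "(\<Sum>n=1..N. C * (1 / sqrt (real n) + sqrt P / real (Suc N - n))) =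
        C * ((\<Sum>n=1..N. 1 / sqrt (real n)) + sqrt P * (\<Sum>n=1..N. 1 / real (Suc N - n)))"
      by (simp add: sum_distrib_left sum.distrib algebra_simps)
    also have "(\<Sum>n=1..N. 1 / real (Suc N - n)) = (\<Sum>m=1..N. 1 / real m)"
      by (rule sum.reindex_bij_witness[of _ "\<lambda>m. Suc N - m" "\<lambda>m. Suc N - m"]) auto
    also have "2 * pi * sqrt (real N) + C * ((\<Sum>n=1..N. 1 / sqrt (real n)) + sqrt P * (\<Sum>m=1..N. 1 / real m))
       \<le> 2 * pi * (sqrt P * (1 + ln P)) + C * (2 * (sqrt P * (1 + ln P)) + sqrt P * (1 + ln P))"
    proof (intro add_mono mult_left_mono)
      have s: "sqrt (real N) \<le> sqrt P * (1 + ln P)"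
      proof -
        have "sqrt (real N) \<le> sqrt P * 1" using N by simp
        also have "\<dots> \<le> sqrt P * (1 + ln P)" using lnP P1 by (intro mult_left_mono) auto
        finally show ?thesis .
      qed
      then show "sqrt (real N) \<le> sqrt P * (1 + ln P)" .
      show "(\<Sum>n=1..N. 1 / sqrt (real n)) \<le> 2 * (sqrt P * (1 + ln P))"
        using sum_inverse_sqrt_le[of N] s by linarith
      have "ln (real N) \<le> ln P" using N by simp
      then show "(\<Sum>m=1..N. 1 / real m) \<le> 1 + ln P" using sum_inverse_le_ln[OF N(1)] by linarith
    qed (use C P1 in auto)
    finally have full: "norm (integral {- Y..Y} F) \<le> (3 * C + 2 * pi) * sqrt P * (1 + ln P)"
      by (simp add: algebra_simps)
    have "norm (integral {- Y..1} F) \<le> integral {- Y..1} (\<lambda>y. 4 * sqrt (real N) * exp (1 * y))"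
    proof (rule integral_norm_bound_integral)
      fix y :: real
      show "norm (F y) \<le> 4 * sqrt (real N) * exp (1 * y)"
        unfolding F_def norm_mult
        using mult_mono[OF norm_theta_factor_half_le[of y] norm_dirichlet_sum_half_le[of "Complex (1/2) (2 * y)" N]]
        by (simp add: mult_ac)
    qed (auto intro!: integrable_continuous_interval contF continuous_intros)
    also have "\<dots> = 4 * sqrt (real N) * integral {- Y..1} (\<lambda>y. exp (1 * y))" by simp
    also have "\<dots> \<le> 4 * sqrt (real N) * (exp (1 * 1) / 1)"
      using Y integral_exp_le(1)[of 1 "- Y" 1] by (intro mult_left_mono) auto
    also have "\<dots> \<le> 4 * exp 1 * (sqrt P * 1)" using N by simp
    also have "\<dots> \<le> 4 * exp 1 * (sqrt P * (1 + ln P))" using P1 lnP by (intro mult_left_mono) auto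
    finally have low: "norm (integral {- Y..1} F) \<le> 4 * exp 1 * (sqrt P * (1 + ln P))" .
    have "integral {- Y..1} F + integral {1..Y} F = integral {- Y..Y} F"
      using Y by (intro Henstock_Kurzweil_Integration.integral_combine integrable_continuous_interval contF) auto
    then have "integral {1..Y} F = integral {- Y..Y} F - integral {- Y..1} F" by (simp add: algebra_simps)
    also have "norm \<dots> \<le> (3 * C + 2 * pi) * sqrt P * (1 + ln P) + 4 * exp 1 * (sqrt P * (1 + ln P))"
      by (intro norm_triangle_le_diff add_mono full low)
    finally show ?thesis unfolding F_def by (simp add: algebra_simps)
  qed
  then show ?thesis by blast
qed

section \<open>The remainder: shift to the right\<close>

lemma zeta_remainder_bound_abs:
  assumes s: "Re s > 1" and N: "N \<ge> 1"
  shows "norm (zeta s - (\<Sum>n=1..N. of_nat n powr (- s))) \<le> real N powr (1 - Re s) / (Re s - 1)"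
proof -
  have "(\<lambda>n. of_nat (Suc n) powr (- s)) sums zeta s"
    using dirichlet_zeta_sums[OF s] zeta_eq_dirichlet_zeta[OF s] by simp
  then have "(\<lambda>n. of_nat (Suc (n + N)) powr (- s)) sums (zeta s - (\<Sum>n<N. of_nat (Suc n) powr (- s)))"
    by (rule sums_split_initial_segment)
  moreover have "(\<Sum>n<N. of_nat (Suc n) powr (- s)) = (\<Sum>n=1..N. of_nat n powr (- s) :: complex)"
    by (rule sum.reindex_bij_witness[of _ "\<lambda>n. n - 1" Suc]) auto
  ultimately have sm: "(\<lambda>n. of_nat (Suc (n + N)) powr (- s)) sums (zeta s - (\<Sum>n=1..N. of_nat n powr (- s)))" by simp
  have a: "Re s - 1 > 0" using s by simp
  have nrm: "norm (of_nat (Suc (n + N)) powr (- s) :: complex) = real (Suc (n + N)) powr (- (Re s - 1) - 1)" for n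
    by (simp only: norm_nat_powr uminus_complex.sel) simp
  note t = summable_powr_tail[OF a N]
  have "norm (\<Sum>n. of_nat (Suc (n + N)) powr (- s) :: complex) \<le> (\<Sum>n. norm (of_nat (Suc (n + N)) powr (- s) :: complex))"
    by (rule summable_norm) (use t(1) in \<open>simp only: nrm\<close>)
  also have "\<dots> \<le> real N powr (- (Re s - 1)) / (Re s - 1)"
    using t(2) by (simp only: nrm)
  finally show ?thesis using sm by (simp add: sums_iff)
qed

section \<open>The sides of the rectangle with opposite corners \<open>1/2 + \<i>\<close> and
  \<open>P + \<i> * Y\<close>\<close>

context
  fixes C Y P :: real and N :: nat
  assumes C: "C > 0" "\<And>x y. x > 0 \<Longrightarrow> y \<ge> 1 \<Longrightarrow>
      norm (Gamma (Complex x y)) * exp (pi * y / 2) \<le> C * norm (Complex x y) powr (x - 1/2)"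
    and Y: "10 \<le> Y" and P: "P = sqrt (Y / pi)" and N: "1 \<le> N" "real N + 1 \<le> P" "P \<le> real N + 2"
begin

private lemma P2: "pi * P\<^sup>2 = Y" using Y by (simp add: P)

private lemma P_ge: "P \<ge> 2" using N by linarith

private lemma P_le: "P \<le> 3 * real N" using N by linarith

text \<open>The Gamma bound with \<open>Y\<close> as reference height. Going down from
  \<open>Y\<close> to \<open>y\<close> multiplies \<open>x^2 + Y^2\<close> by at most
  \<open>exp (- (Y - y) / (2 * Y))\<close>, the source of the decay. Replacing
  \<open>x^2 + Y^2\<close> by \<open>Y^2\<close> costs only \<open>exp 1\<close>, because
  \<open>x \<le> P\<close> and \<open>P^2 \<le> Y\<close>. The powers of \<open>Y\<close> and
  \<open>pi\<close> then combine to one of \<open>P\<close>.\<close>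

private lemma theta_factor_bound:
  assumes x: "1/2 \<le> x" "x \<le> P" and y: "1 \<le> y" "y \<le> Y"
  shows "norm (theta_factor (Complex x y)) \<le> C * exp 1 * P powr (2 * x - 1) * exp (- ((x - 1/2) / (4 * Y) * (Y - y)))"
proof -
  \<comment> \<open>Half the exponent, as the estimates concern the square of the modulus.\<close>
  define q where "q = (x - 1/2) / 2"
  have q: "0 \<le> q" "q \<le> x / 2" using x by (auto simp: q_def)
  have PY: "P\<^sup>2 \<le> Y"
  proof -
    have "1 * P\<^sup>2 \<le> pi * P\<^sup>2" using pi_gt3 by (intro mult_right_mono) auto
    then show ?thesis using P2 by simp
  qed
  have xP: "x\<^sup>2 \<le> P\<^sup>2" using x by (intro power_mono) auto
  have x2: "x\<^sup>2 \<le> Y" using xP PY by simp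
  have YY: "Y \<le> Y\<^sup>2" using Y by (simp add: power2_eq_square)
  have Ypos: "Y\<^sup>2 > 0" using Y by simp
  have r1: "x\<^sup>2 + y\<^sup>2 \<le> (x\<^sup>2 + Y\<^sup>2) * exp (- ((Y - y) / (2 * Y)))"
  proof -
    define d where "d = (Y\<^sup>2 - y\<^sup>2) / (x\<^sup>2 + Y\<^sup>2)"
    have pos: "x\<^sup>2 + Y\<^sup>2 > 0" using Ypos by (simp add: add_nonneg_pos)
    have "(Y - y) / (2 * Y) = (Y * (Y - y)) / (2 * Y\<^sup>2)" using Y by (simp add: power2_eq_square)
    also have "\<dots> \<le> (Y\<^sup>2 - y\<^sup>2) / (x\<^sup>2 + Y\<^sup>2)"
    proof (rule frac_le)
      have "y * y \<le> y * Y" using y by (intro mult_left_mono) auto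
      then show "Y * (Y - y) \<le> Y\<^sup>2 - y\<^sup>2" using y Y by (simp add: power2_eq_square algebra_simps)
      show "0 \<le> Y\<^sup>2 - y\<^sup>2" using y by (simp add: power_mono)
      show "x\<^sup>2 + Y\<^sup>2 \<le> 2 * Y\<^sup>2" using x2 YY by simp
    qed (use pos in auto)
    finally have "(Y - y) / (2 * Y) \<le> d" by (simp add: d_def)
    then have "exp (- d) \<le> exp (- ((Y - y) / (2 * Y)))" by simp
    moreover have "1 - d \<le> exp (- d)" using exp_ge_add_one_self[of "- d"] by simp
    ultimately have "1 - d \<le> exp (- ((Y - y) / (2 * Y)))" by linarith
    then have "(x\<^sup>2 + Y\<^sup>2) * (1 - d) \<le> (x\<^sup>2 + Y\<^sup>2) * exp (- ((Y - y) / (2 * Y)))"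
      using pos by (intro mult_left_mono) auto
    moreover have "(x\<^sup>2 + Y\<^sup>2) * (1 - d) = x\<^sup>2 + y\<^sup>2"
    proof -
      have "(x\<^sup>2 + Y\<^sup>2) * d = Y\<^sup>2 - y\<^sup>2" using pos unfolding d_def
        by (metis less_irrefl nonzero_mult_div_cancel_left times_divide_eq_right)
      then show ?thesis by (simp add: right_diff_distrib)
    qed
    ultimately show ?thesis by simp
  qed
  have r2: "x\<^sup>2 + Y\<^sup>2 \<le> Y\<^sup>2 * exp (x\<^sup>2 / Y\<^sup>2)"
  proof -
    have "Y\<^sup>2 * (1 + x\<^sup>2 / Y\<^sup>2) \<le> Y\<^sup>2 * exp (x\<^sup>2 / Y\<^sup>2)"
      by (intro mult_left_mono exp_ge_add_one_self) auto
    moreover have "Y\<^sup>2 * (1 + x\<^sup>2 / Y\<^sup>2) = x\<^sup>2 + Y\<^sup>2" using Ypos Y by (simp add: distrib_left)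
    ultimately show ?thesis by simp
  qed
  have x3: "x\<^sup>2 / Y\<^sup>2 * q \<le> 1"
  proof -
    have "x \<le> Y" using x P_ge PY by (smt (verit) power2_eq_square mult_le_cancel_right1)
    then have "x\<^sup>2 * q \<le> Y * Y" using x2 q x by (intro mult_mono) auto
    then show ?thesis using Ypos by (simp add: divide_le_eq power2_eq_square)
  qed
  have "norm (Complex x y) powr (x - 1/2) = ((norm (Complex x y))\<^sup>2) powr q"
  proof -
    have "norm (Complex x y) > 0" using y by (simp add: complex_eq_iff)
    moreover have "2 * q = x - 1/2" by (simp add: q_def)
    ultimately show ?thesis by (simp add: powr_powr flip: powr_numeral)
  qed
  also have "\<dots> = (x\<^sup>2 + y\<^sup>2) powr q" by (simp add: cmod_power2)
  also have "\<dots> \<le> (Y\<^sup>2 * exp (x\<^sup>2 / Y\<^sup>2) * exp (- ((Y - y) / (2 * Y)))) powr q"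
  proof (rule powr_mono2)
    show "x\<^sup>2 + y\<^sup>2 \<le> Y\<^sup>2 * exp (x\<^sup>2 / Y\<^sup>2) * exp (- ((Y - y) / (2 * Y)))"
      by (rule order_trans[OF r1 mult_right_mono[OF r2]]) simp
  qed (use q in auto)
  also have "\<dots> = Y powr (x - 1/2) * exp (x\<^sup>2 / Y\<^sup>2 * q) * exp (- ((x - 1/2) / (4 * Y) * (Y - y)))"
  proof -
    have "2 * q = x - 1/2" by (simp add: q_def)
    then have "(Y\<^sup>2) powr q = Y powr (x - 1/2)" using Y by (simp add: powr_powr flip: powr_numeral)
    moreover have "exp a powr q = exp (a * q)" for a by (simp add: powr_def mult.commute)
    ultimately show ?thesis using Y by (simp add: powr_mult q_def)
  qed
  also have "\<dots> \<le> Y powr (x - 1/2) * exp 1 * exp (- ((x - 1/2) / (4 * Y) * (Y - y)))"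
    using x3 by (intro mult_right_mono mult_left_mono) auto
  finally have n: "norm (Complex x y) powr (x - 1/2) \<le> Y powr (x - 1/2) * exp 1 * exp (- ((x - 1/2) / (4 * Y) * (Y - y)))" .
  have "norm (theta_factor (Complex x y)) \<le> C * norm (Complex x y) powr (x - 1/2) * pi powr (- x)"
    unfolding norm_theta_factor using C(2)[of x y] x y by (intro mult_right_mono) auto
  also have "\<dots> \<le> C * (Y powr (x - 1/2) * exp 1 * exp (- ((x - 1/2) / (4 * Y) * (Y - y)))) * pi powr (- x)"
    using n C(1) by (intro mult_right_mono mult_left_mono) auto
  also have "\<dots> = C * exp 1 * (Y powr (x - 1/2) * pi powr (- x)) * exp (- ((x - 1/2) / (4 * Y) * (Y - y)))"
    by (simp add: mult_ac)
  also have "\<dots> \<le> C * exp 1 * P powr (2 * x - 1) * exp (- ((x - 1/2) / (4 * Y) * (Y - y)))"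
  proof (intro mult_right_mono mult_left_mono)
    have "Y powr (x - 1/2) = (pi * P\<^sup>2) powr (x - 1/2)" by (simp add: P2)
    also have "\<dots> = pi powr (x - 1/2) * P powr (2 * x - 1)"
      using P_ge by (simp add: powr_mult powr_powr algebra_simps flip: powr_numeral)
    finally have "Y powr (x - 1/2) * pi powr (- x) = (pi powr (x - 1/2) * pi powr (- x)) * P powr (2 * x - 1)"
      by simp
    also have "pi powr (x - 1/2) * pi powr (- x) = pi powr (- 1/2)" by (simp flip: powr_add)
    also have "pi powr (- 1/2) \<le> pi powr 0" using pi_gt3 by (intro powr_mono) auto
    finally show "Y powr (x - 1/2) * pi powr (- x) \<le> P powr (2 * x - 1)"
      using P_ge by (simp add: mult_right_mono)
  qed (use C(1) in auto)
  finally show ?thesis .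
qed

private definition zeta_tail :: "complex \<Rightarrow> complex" where
  "zeta_tail z = zeta (2 * z - 1/2) - (\<Sum>n=1..N. of_nat n powr (- (2 * z - 1/2)))"

private lemma dbl: "2 * Complex x y - 1/2 = Complex (2 * x - 1/2) (2 * y)"
  by (simp add: complex_eq_iff)

text \<open>The growth \<open>P powr (2 * x - 1)\<close> of \<open>theta_factor\<close> meets the
  decay \<open>N powr (3/2 - 2 * x)\<close> of the tail, which leaves
  \<open>(P / N) powr (2 * x - 3/2) * sqrt P\<close>. Since \<open>P / N \<le> exp (2 / N)\<close>
  and \<open>x \<le> P \<le> 3 * N\<close>, the power is at most \<open>exp 12\<close>. From
  \<open>x = 5/4\<close> on, \<open>2 * x - 3/2 \<ge> 4/5 * x\<close>, whence the factor
  \<open>1 / x\<close>.\<close>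

private lemma ratio_bound:
  assumes "5/4 \<le> x" "x \<le> P"
  shows "P powr (2 * x - 1) * norm (zeta_tail (Complex x y)) \<le> 5/4 * exp 12 * sqrt P / x"
proof -
  have "norm (zeta_tail (Complex x y)) \<le> real N powr (3/2 - 2 * x) / (2 * x - 3/2)"
    using zeta_remainder_bound_abs[of "Complex (2 * x - 1/2) (2 * y)" N] assms N
    unfolding zeta_tail_def dbl by simp
  also have "\<dots> \<le> real N powr (3/2 - 2 * x) / (4/5 * x)"
    using assms by (intro divide_left_mono) auto
  finally have "P powr (2 * x - 1) * norm (zeta_tail (Complex x y)) \<le> P powr (2 * x - 1) * (real N powr (3/2 - 2 * x) / (4/5 * x))"
    by (intro mult_left_mono) auto
  also have "\<dots> = 5/4 * (P / real N) powr (2 * x - 3/2) * sqrt P / x"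
  proof -
    have "P powr (2 * x - 1) = P powr (2 * x - 3/2) * P powr (1/2)" by (simp flip: powr_add)
    moreover have "real N powr (3/2 - 2 * x) = 1 / real N powr (2 * x - 3/2)"
      using powr_minus_divide[of "real N" "2 * x - 3/2"] by simp
    ultimately show ?thesis using P_ge N by (simp add: powr_divide powr_half_sqrt)
  qed
  also have "(P / real N) powr (2 * x - 3/2) \<le> exp (2 / real N) powr (2 * x - 3/2)"
  proof (rule powr_mono2)
    have "P / real N \<le> (real N + 2) / real N" using N by (intro divide_right_mono) auto
    also have "\<dots> = 1 + 2 / real N" using N by (simp add: field_simps)
    also have "\<dots> \<le> exp (2 / real N)" by (rule exp_ge_add_one_self)
    finally show "P / real N \<le> exp (2 / real N)" .
  qed (use assms P_ge N in auto)
  also have "\<dots> = exp (2 / real N * (2 * x - 3/2))" by (simp add: powr_def mult.commute)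
  also have "\<dots> \<le> exp 12"
  proof -
    have "2 / real N * (2 * x - 3/2) \<le> 2 / real N * (2 * (3 * real N))"
      using assms P_le by (intro mult_left_mono) auto
    then show ?thesis using N by simp
  qed
  finally show ?thesis using assms P_ge by (simp add: divide_right_mono mult_right_mono)
qed

text \<open>The shape \<open>sqrt P / x\<close> makes the integral over the side cost just one
  logarithm. At \<open>x = 5/4\<close> the argument \<open>2 * z - 1/2\<close> of zeta has real part
  2, the end of the range of \<open>zeta_remainder_bound\<close>, so the two estimates of the tail
  meet there. Left of it the constant is \<open>2000 * 9\<close>, and \<open>x < 5/4\<close> brings
  \<open>18000 * x\<close> below 30000.\<close>

private lemma top_bound:
  assumes x: "1/2 \<le> x" "x \<le> P"
  shows "norm (theta_factor (Complex x Y) * zeta_tail (Complex x Y)) \<le> C * exp 1 * (30000 + 2 * exp 12) * sqrt P / x"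
proof -
  have th: "norm (theta_factor (Complex x Y)) \<le> C * exp 1 * P powr (2 * x - 1)"
    using theta_factor_bound[of x Y] x Y by simp
  have "P powr (2 * x - 1) * norm (zeta_tail (Complex x Y)) \<le> (30000 + 2 * exp 12) * sqrt P / x"
  proof (cases "x \<ge> 5/4")
    case True
    have "5/4 * exp 12 * sqrt P / x \<le> (30000 + 2 * exp 12) * sqrt P / x"
      using True P_ge by (intro divide_right_mono mult_right_mono) auto
    then show ?thesis using ratio_bound[OF True x(2), of Y] by linarith
  next
    case False
    \<comment> \<open>Together with \<open>P \<le> 3 * N\<close> this gives \<open>9 * N\<close>,
      within the allowance \<open>10 * N\<close> of \<open>zeta_remainder_bound\<close>.\<close>
    have Yq: "sqrt (2 * Y) \<le> 3 * P"
    proof (rule real_le_lsqrt)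
      have "2 * Y = 2 * pi * P\<^sup>2" by (simp flip: P2)
      also have "\<dots> \<le> 9 * P\<^sup>2" using pi_less_4 by (intro mult_right_mono) auto
      finally show "2 * Y \<le> (3 * P)\<^sup>2" by (simp add: power_mult_distrib)
    qed (use Y P_ge in auto)
    have "norm (zeta_tail (Complex x Y)) \<le> 1000 * (2 * Y) powr (1/4) * real N powr (1 - 2 * x)"
    proof -
      have "norm (zeta_tail (Complex x Y)) \<le> 1000 * Im (Complex (2 * x - 1/2) (2 * Y)) powr (1/4) * real N powr (1/2 - Re (Complex (2 * x - 1/2) (2 * Y)))"
        unfolding zeta_tail_def dbl
      proof (rule zeta_remainder_bound)
        show "sqrt (Im (Complex (2 * x - 1/2) (2 * Y))) \<le> 10 * real N" using Yq P_le by simp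
        have "real N \<le> sqrt (2 * Y)"
        proof -
          have "P \<le> sqrt (2 * Y)" unfolding P using Y pi_gt3
            by (intro real_sqrt_le_mono) (simp add: divide_le_eq)
          then show ?thesis using N by linarith
        qed
        also have "\<dots> \<le> (2 * Y) powr (3/2)"
          using Y powr_mono[of "1/2" "3/2" "2 * Y"] by (simp add: powr_half_sqrt)
        finally show "real N \<le> Im (Complex (2 * x - 1/2) (2 * Y)) powr (3/2)" by simp
      qed (use x Y N False in auto)
      then show ?thesis by simp
    qed
    also have "(2 * Y) powr (1/4) \<le> 2 * sqrt P"
    proof -
      have "(2 * Y) powr (1/4) = sqrt (sqrt (2 * Y))" using Y by (simp flip: powr_half_sqrt add: powr_powr)
      also have "\<dots> \<le> sqrt (4 * P)" using Yq P_ge by (intro real_sqrt_le_mono) auto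
      finally show ?thesis by (simp add: real_sqrt_mult)
    qed
    finally have r: "norm (zeta_tail (Complex x Y)) \<le> 1000 * (2 * sqrt P) * real N powr (1 - 2 * x)"
      by (simp add: mult_right_mono)
    then have "P powr (2 * x - 1) * norm (zeta_tail (Complex x Y)) \<le> P powr (2 * x - 1) * (1000 * (2 * sqrt P) * real N powr (1 - 2 * x))"
      by (intro mult_left_mono) auto
    also have "\<dots> = 2000 * sqrt P * (P / real N) powr (2 * x - 1)"
    proof -
      have "real N powr (1 - 2 * x) = 1 / real N powr (2 * x - 1)"
        using powr_minus_divide[of "real N" "2 * x - 1"] by simp
      then show ?thesis using P_ge N by (simp add: powr_divide)
    qed
    also have "\<dots> \<le> 2000 * sqrt P * 3 powr 2"
    proof (rule mult_left_mono)
      have "(P / real N) powr (2 * x - 1) \<le> 3 powr (2 * x - 1)"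
        using P_le N x P_ge by (intro powr_mono2) (auto simp: divide_le_eq)
      also have "\<dots> \<le> 3 powr 2" using False by (intro powr_mono) auto
      finally show "(P / real N) powr (2 * x - 1) \<le> 3 powr 2" .
    qed (use P_ge in auto)
    also have "2000 * sqrt P * 3 powr 2 = 18000 * sqrt P" by simp
    also have "\<dots> \<le> (30000 + 2 * exp 12) * sqrt P / x"
    proof -
      have "18000 * x \<le> 30000 + 2 * exp 12" using False exp_ge_zero[of "12::real"] by linarith
      then have "18000 * sqrt P * x \<le> (30000 + 2 * exp 12) * sqrt P"
        using P_ge mult_right_mono[of "18000 * x" "30000 + 2 * exp 12" "sqrt P"] by (simp add: mult_ac)
      then show ?thesis using x by (simp add: pos_le_divide_eq)
    qed
    finally show ?thesis .
  qed
  then have "C * exp 1 * (P powr (2 * x - 1) * norm (zeta_tail (Complex x Y))) \<le> C * exp 1 * ((30000 + 2 * exp 12) * sqrt P / x)"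
    using C(1) by (intro mult_left_mono) auto
  moreover have "norm (theta_factor (Complex x Y) * zeta_tail (Complex x Y)) \<le> C * exp 1 * P powr (2 * x - 1) * norm (zeta_tail (Complex x Y))"
    unfolding norm_mult using th by (intro mult_right_mono) auto
  ultimately show ?thesis by (simp add: mult.assoc)
qed

text \<open>At height 1 the argument of zeta has imaginary part 2, too small for
  \<open>zeta_remainder_bound\<close> when \<open>N\<close> is large. For \<open>x < 5/4\<close> the
  tail is instead read off from \<open>zeta_approx\<close> with \<open>M = N\<close>, whose main
  term and error are both \<open>O (sqrt P)\<close>, and \<open>theta_factor\<close> is bounded by a
  constant there.\<close>

private lemma bottom_bound:
  assumes x: "1/2 \<le> x" "x \<le> P"
  shows "norm (theta_factor (Complex x 1) * zeta_tail (Complex x 1)) \<le> C * exp 1 * (30000 + 2 * exp 12) * sqrt P / x"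
proof (cases "x \<ge> 5/4")
  case True
  have "exp (- ((x - 1/2) / (4 * Y) * (Y - 1))) \<le> 1" using x Y by simp
  then have "C * exp 1 * P powr (2 * x - 1) * exp (- ((x - 1/2) / (4 * Y) * (Y - 1))) \<le> C * exp 1 * P powr (2 * x - 1) * 1"
    using C(1) by (intro mult_left_mono) auto
  then have "norm (theta_factor (Complex x 1)) \<le> C * exp 1 * P powr (2 * x - 1)"
    using theta_factor_bound[of x 1] x Y by linarith
  then have "norm (theta_factor (Complex x 1) * zeta_tail (Complex x 1)) \<le> C * exp 1 * P powr (2 * x - 1) * norm (zeta_tail (Complex x 1))"
    unfolding norm_mult by (intro mult_right_mono) auto
  also have "\<dots> = C * exp 1 * (P powr (2 * x - 1) * norm (zeta_tail (Complex x 1)))" by (simp add: mult.assoc)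
  also have "\<dots> \<le> C * exp 1 * (5/4 * exp 12 * sqrt P / x)"
    using C(1) ratio_bound[OF True x(2), of 1] by (intro mult_left_mono) auto
  also have "\<dots> \<le> C * exp 1 * ((30000 + 2 * exp 12) * sqrt P / x)"
    using C(1) x P_ge by (intro mult_left_mono divide_right_mono mult_right_mono) auto
  finally show ?thesis by simp
next
  case False
  define s where "s = Complex (2 * x - 1/2) 2"
  have s: "1/2 \<le> Re s" "Re s \<le> 2" "Im s = 2" using x False by (auto simp: s_def)
  have s1: "s \<noteq> 1" using s by auto
  have "norm (Complex x 1) \<le> 3"
    using cmod_le[of "Complex x 1"] x False by simp
  then have "norm (Complex x 1) powr (x - 1/2) \<le> 3 powr (x - 1/2)"
    using x by (intro powr_mono2) auto
  also have "\<dots> \<le> 3 powr 1" using False by (intro powr_mono) auto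
  finally have n3: "norm (Complex x 1) powr (x - 1/2) \<le> 3" by simp
  have th: "norm (theta_factor (Complex x 1)) \<le> C * 3"
  proof -
    have "norm (Gamma (Complex x 1)) * exp (pi * 1 / 2) \<le> C * norm (Complex x 1) powr (x - 1/2)"
      using C(2)[of x 1] x by simp
    also have "\<dots> \<le> C * 3" using n3 C(1) by (intro mult_left_mono) auto
    finally have "norm (Gamma (Complex x 1)) * exp (pi * 1 / 2) * pi powr (- x) \<le> C * 3 * pi powr 0"
    proof (rule mult_mono)
      show "pi powr (- x) \<le> pi powr 0" using pi_gt3 x by (intro powr_mono) auto
    qed (use C(1) in auto)
    then show ?thesis unfolding norm_theta_factor by simp
  qed
  have "norm (zeta_tail (Complex x 1)) \<le> 13 * sqrt P"
  proof -
    define W where "W = of_nat N powr (1 - s) / (s - 1)"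
    have NP: "sqrt (real N) \<le> sqrt P" using N by simp
    have "norm W \<le> sqrt P / 1"
      unfolding W_def norm_divide
    proof (rule frac_le)
      have "norm (of_nat N powr (1 - s)) = real N powr (1 - Re s)"
        using N by (subst norm_powr_real_powr) auto
      also have "\<dots> \<le> real N powr (1/2)" using N s by (intro powr_mono) auto
      also have "\<dots> = sqrt (real N)" by (simp add: powr_half_sqrt)
      finally show "norm (of_nat N powr (1 - s)) \<le> sqrt P" using NP by (rule order_trans)
      show "1 \<le> norm (s - 1)" using abs_Im_le_cmod[of "s - 1"] s by simp
    qed (use P_ge in auto)
    moreover have "norm (zeta_tail (Complex x 1) - W) \<le> 12 * sqrt P"
    proof -
      have "norm (zeta_tail (Complex x 1) - W) \<le> norm s * (1 + 1 / Re s) * real N powr (- Re s)"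
        unfolding zeta_tail_def dbl W_def using zeta_approx[of s N] s s1 N by (simp add: s_def)
      also have "\<dots> \<le> 4 * 3 * sqrt P"
      proof (intro mult_mono)
        show "norm s \<le> 4" using cmod_le[of s] s by simp
        show "1 + 1 / Re s \<le> 3" using s by (simp add: divide_le_eq)
        have "real N powr (- Re s) \<le> real N powr (1/2)" using N s by (intro powr_mono) auto
        also have "\<dots> = sqrt (real N)" by (simp add: powr_half_sqrt)
        finally show "real N powr (- Re s) \<le> sqrt P" using NP by (rule order_trans)
      qed (use s in auto)
      finally show ?thesis by simp
    qed
    ultimately have "norm ((zeta_tail (Complex x 1) - W) + W) \<le> 12 * sqrt P + sqrt P / 1"
      by (intro norm_triangle_mono)
    then show ?thesis by simp
  qed
  then have "norm (theta_factor (Complex x 1) * zeta_tail (Complex x 1)) \<le> C * 3 * (13 * sqrt P)"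
    unfolding norm_mult using th C(1) by (intro mult_mono) auto
  also have "\<dots> \<le> C * exp 1 * (30000 + 2 * exp 12) * sqrt P / x"
  proof -
    have e: "exp 1 * (30000 + 2 * exp 12) \<ge> 1 * (30000 + 2 * (0::real))"
      by (intro mult_mono add_mono) auto
    have "39 * x \<le> exp 1 * (30000 + 2 * exp 12)" using e False by simp
    then have "C * sqrt P * (39 * x) \<le> C * sqrt P * (exp 1 * (30000 + 2 * exp 12))"
      using C(1) P_ge by (intro mult_left_mono) auto
    then show ?thesis using x by (simp add: pos_le_divide_eq mult_ac)
  qed
  finally show ?thesis .
qed

text \<open>On the right side \<open>theta_factor\<close> decays away from \<open>y = Y\<close> at
  the rate \<open>L\<close>, about \<open>P / (4 * Y)\<close>, so the effective length
  \<open>1 / L\<close> is of order \<open>P\<close>. The integrand is \<open>O (sqrt P / P)\<close>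
  there, and the side contributes \<open>O (sqrt P)\<close>; the logarithm comes from the horizontal
  sides.\<close>

lemma theta_factor_zeta_remainder_bound:
  "norm (integral {1..Y} (\<lambda>y. theta_factor (Complex (1/2) y) *
      (zeta (Complex (1/2) (2 * y)) - (\<Sum>n=1..N. of_nat n powr (- Complex (1/2) (2 * y))))))
   \<le> C * (4 * exp 1 * (30000 + 2 * exp 12) + 40 * exp 13) * sqrt P * (1 + ln P)"
proof -
  define f where "f z = theta_factor z * zeta_tail z" for z
  define K where "K = C * exp 1 * (30000 + 2 * exp 12)"
  define S where "S = {z. Re z > 0} \<inter> {z. Im z > 0}"
  have K: "K > 0" unfolding K_def using C(1) by (intro mult_pos_pos add_pos_pos) auto
  have PP: "1/2 < P" "1 < Y" using P_ge Y by auto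
  have lnP: "ln P \<ge> 0" using P_ge by simp
  have hf: "f holomorphic_on S"
  proof -
    have "(\<lambda>z. zeta (2 * z - 1/2)) holomorphic_on S"
    proof -
      have "zeta \<circ> (\<lambda>z. 2 * z - 1/2) holomorphic_on S"
        by (rule holomorphic_on_compose_gen[OF _ holomorphic_zeta])
           (auto intro!: holomorphic_intros simp: S_def complex_eq_iff)
      then show ?thesis by (simp add: o_def)
    qed
    moreover have "(\<lambda>z. of_nat n powr (- (2 * z - 1/2))) holomorphic_on S" if nN: "n \<in> {1..N}" for n
    proof -
      obtain k where "n = Suc k" using nN by (cases n) auto
      then show ?thesis by (simp only:) (intro holomorphic_nat_powr holomorphic_intros)
    qed
    moreover have "theta_factor holomorphic_on S"
      unfolding theta_factor_def by (intro holomorphic_intros) (auto simp: S_def elim!: nonpos_Ints_cases)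
    ultimately show ?thesis
      unfolding f_def zeta_tail_def by (intro holomorphic_intros) auto
  qed
  have cS: "convex S" unfolding S_def
    by (intro convex_Int convex_halfspace_Re_gt convex_halfspace_Im_gt)
  have cf: "continuous_on S f" using hf by (rule holomorphic_on_imp_continuous_on)
  have cv: "continuous_on {1..Y} (\<lambda>y. f (Complex x y))" if "x > 0" for x
    using that by (intro continuous_on_compose2[OF cf]) (auto simp: Complex_eq S_def intro!: continuous_intros)
  have ch: "continuous_on {1/2..P} (\<lambda>x. f (Complex x y))" if "y > 0" for y
    using that by (intro continuous_on_compose2[OF cf]) (auto simp: Complex_eq S_def intro!: continuous_intros)
  have rect: "\<i> * integral {1..Y} (\<lambda>y. f (Complex (1/2) y)) =
     integral {1/2..P} (\<lambda>x. f (Complex x 1)) + \<i> * integral {1..Y} (\<lambda>y. f (Complex P y))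
     - integral {1/2..P} (\<lambda>x. f (Complex x Y))"
    by (rule Cauchy_rectangle[OF PP cS hf]) (auto simp: S_def in_cbox_complex_iff)
  have hor: "norm (integral {1/2..P} (\<lambda>x. f (Complex x y))) \<le> K * sqrt P * (1 + ln P)"
    if "y > 0" and b: "\<And>x. 1/2 \<le> x \<Longrightarrow> x \<le> P \<Longrightarrow> norm (f (Complex x y)) \<le> K * sqrt P / x" for y
  proof -
    have i: "((\<lambda>x. 1 / x) has_integral (ln P - ln (1/2))) {1/2..P}"
      using PP by (intro fundamental_theorem_of_calculus)
        (auto intro!: derivative_eq_intros simp flip: has_real_derivative_iff_has_vector_derivative)
    have "norm (integral {1/2..P} (\<lambda>x. f (Complex x y))) \<le> integral {1/2..P} (\<lambda>x. K * sqrt P * (1 / x))"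
      using b i by (intro integral_norm_bound_integral integrable_continuous_interval[OF ch[OF \<open>y > 0\<close>]] integrable_on_mult_right)
        (auto simp: has_integral_iff)
    also have "\<dots> = K * sqrt P * (ln P - ln (1/2))"
      using i by (simp only: integral_mult_right has_integral_iff)
    also have "\<dots> \<le> K * sqrt P * (1 + ln P)"
    proof (intro mult_left_mono)
      have "ln (1/2 :: real) = - ln 2" by (simp add: ln_div)
      moreover have "ln 2 \<le> (1::real)" using ln_le_minus_one[of 2] by simp
      ultimately show "ln P - ln (1/2) \<le> 1 + ln P" by linarith
    qed (use K P_ge in auto)
    finally show ?thesis .
  qed
  have vert: "norm (integral {1..Y} (\<lambda>y. f (Complex P y))) \<le> C * 40 * exp 13 * sqrt P"
  proof -
    define L where "L = (P - 1/2) / (4 * Y)"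
    have L: "L > 0" using P_ge Y by (simp add: L_def)
    define D where "D = C * exp 1 * (5/4 * exp 12 * sqrt P / P)"
    have D: "D \<ge> 0" using C(1) P_ge by (simp add: D_def)
    have "norm (integral {1..Y} (\<lambda>y. f (Complex P y))) \<le> integral {1..Y} (\<lambda>y. D * exp (- (L * Y)) * exp (L * y))"
    proof (rule integral_norm_bound_integral)
      show "(\<lambda>y. f (Complex P y)) integrable_on {1..Y}"
        using P_ge by (intro integrable_continuous_interval cv) auto
      fix y assume y: "y \<in> {1..Y}"
      have "norm (theta_factor (Complex P y)) \<le> C * exp 1 * P powr (2 * P - 1) * exp (- (L * (Y - y)))"
        using theta_factor_bound[of P y] P_ge y by (simp add: L_def)
      then have "norm (f (Complex P y)) \<le> C * exp 1 * P powr (2 * P - 1) * exp (- (L * (Y - y))) * norm (zeta_tail (Complex P y))"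
        unfolding f_def norm_mult by (intro mult_right_mono) auto
      also have "\<dots> = C * exp 1 * exp (- (L * (Y - y))) * (P powr (2 * P - 1) * norm (zeta_tail (Complex P y)))"
        by (simp add: mult_ac)
      also have "\<dots> \<le> C * exp 1 * exp (- (L * (Y - y))) * (5/4 * exp 12 * sqrt P / P)"
        using C(1) P_ge by (intro mult_left_mono ratio_bound) auto
      also have "\<dots> = D * exp (- (L * Y)) * exp (L * y)"
        by (simp add: D_def algebra_simps flip: exp_add)
      finally show "norm (f (Complex P y)) \<le> D * exp (- (L * Y)) * exp (L * y)" .
    qed (auto intro!: integrable_continuous_interval continuous_intros)
    also have "\<dots> = D * exp (- (L * Y)) * integral {1..Y} (\<lambda>y. exp (L * y))" by simp
    also have "\<dots> \<le> D * exp (- (L * Y)) * (exp (L * Y) / L)"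
      using D PP integral_exp_le(1)[OF L, of 1 Y] by (intro mult_left_mono) auto
    also have "\<dots> = D / L" by (simp add: exp_minus)
    also have "\<dots> \<le> D * (8 * pi * P)"
    proof -
      have "1 / L = 4 * (pi * P\<^sup>2) / (P - 1/2)" unfolding P2 by (simp add: L_def)
      also have "\<dots> \<le> 4 * (pi * P\<^sup>2) / (P / 2)"
        using P_ge by (intro divide_left_mono) auto
      also have "\<dots> = 8 * pi * P" using P_ge by (simp add: power2_eq_square)
      finally show ?thesis using D mult_left_mono[of "1 / L" "8 * pi * P" D] by simp
    qed
    also have "\<dots> = C * exp 13 * 10 * pi * sqrt P"
    proof -
      have "exp (13::real) = exp 1 * exp 12" by (simp flip: exp_add)
      then show ?thesis using P_ge by (simp add: D_def)
    qed
    also have "\<dots> \<le> C * exp 13 * 10 * 4 * sqrt P"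
      using C(1) P_ge pi_less_4 by (intro mult_right_mono mult_left_mono) auto
    finally show ?thesis by (simp add: mult_ac)
  qed
  have "norm (\<i> * integral {1..Y} (\<lambda>y. f (Complex (1/2) y))) \<le>
     (K * sqrt P * (1 + ln P) + C * 40 * exp 13 * sqrt P) + K * sqrt P * (1 + ln P)"
    unfolding rect using hor[of 1] hor[of Y] vert top_bound bottom_bound Y
    by (intro norm_triangle_le_diff add_mono norm_triangle_le) (auto simp: norm_mult f_def K_def)
  also have "\<dots> \<le> (K * sqrt P * (1 + ln P) + C * 40 * exp 13 * (sqrt P * (1 + ln P))) + 3 * (K * sqrt P * (1 + ln P))"
  proof -
    have "sqrt P * 1 \<le> sqrt P * (1 + ln P)" using lnP P_ge by (intro mult_left_mono) auto
    then have "C * 40 * exp 13 * sqrt P \<le> C * 40 * exp 13 * (sqrt P * (1 + ln P))"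
      using C(1) by (intro mult_left_mono) auto
    moreover have "0 \<le> K * sqrt P * (1 + ln P)" using K lnP P_ge by simp
    ultimately show ?thesis by linarith
  qed
  finally have "norm (integral {1..Y} (\<lambda>y. f (Complex (1/2) y))) \<le> C * (4 * exp 1 * (30000 + 2 * exp 12) + 40 * exp 13) * sqrt P * (1 + ln P)"
    by (simp add: norm_mult K_def algebra_simps)
  then show ?thesis unfolding f_def zeta_tail_def dbl by simp
qed

end

section \<open>The integral of Hardy's function\<close>

lemma theta_factor_zeta_integral_bound:
  "\<exists>C>0. \<forall>Y\<ge>50. norm (integral {1..Y} (\<lambda>y. theta_factor (Complex (1/2) y) * zeta (Complex (1/2) (2 * y))))
     \<le> C * Y powr (1/4) * (1 + ln Y)"
proof -
  obtain C1 where C1: "C1 > 0" "\<And>x y. x > 0 \<Longrightarrow> y \<ge> 1 \<Longrightarrow>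
      norm (Gamma (Complex x y)) * exp (pi * y / 2) \<le> C1 * norm (Complex x y) powr (x - 1/2)"
    using Gamma_upper_bound by blast
  obtain C2 where C2: "\<And>Y N. 10 \<le> Y \<Longrightarrow> 1 \<le> N \<Longrightarrow> real N + 1 \<le> sqrt (Y / pi) \<Longrightarrow>
     norm (integral {1..Y} (\<lambda>y. theta_factor (Complex (1/2) y) * (\<Sum>n=1..N. of_nat n powr (- Complex (1/2) (2 * y)))))
      \<le> C2 * sqrt (sqrt (Y / pi)) * (1 + ln (sqrt (Y / pi)))"
    using theta_factor_dirichlet_sum_bound by blast
  define C3 where "C3 = C1 * (4 * exp 1 * (30000 + 2 * exp 12) + 40 * exp 13)"
  define D where "D = \<bar>C2\<bar> + \<bar>C3\<bar> + 1"
  have "norm (integral {1..Y} (\<lambda>y. theta_factor (Complex (1/2) y) * zeta (Complex (1/2) (2 * y))))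
     \<le> D * Y powr (1/4) * (1 + ln Y)" if Y: "Y \<ge> 50" for Y
  proof -
    define P where "P = sqrt (Y / pi)"
    \<comment> \<open>Subtracting one secures \<open>N + 1 \<le> P\<close> for the left shift, and
      \<open>P \<le> N + 2\<close> for the right shift still holds. The condition
      \<open>Y \<ge> 50\<close> gives \<open>P \<ge> 3\<close>, hence
      \<open>N \<ge> 1\<close>.\<close>
    define N where "N = nat \<lfloor>P\<rfloor> - 1"
    have "3\<^sup>2 \<le> Y / pi" using Y pi_less_4 by (simp add: pos_le_divide_eq)
    then have P3: "P \<ge> 3" unfolding P_def by (rule real_le_rsqrt)
    have "real (nat \<lfloor>P\<rfloor>) \<le> P" "P < real (nat \<lfloor>P\<rfloor>) + 1" "nat \<lfloor>P\<rfloor> \<ge> 3"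
      using P3 by (auto simp: le_nat_floor)
    then have N: "1 \<le> N" "real N + 1 \<le> P" "P \<le> real N + 2"
      unfolding N_def by linarith+
    have PY: "P \<le> sqrt Y" unfolding P_def using Y pi_gt3
      by (intro real_sqrt_le_mono) (simp add: divide_le_eq)
    have sP: "sqrt P \<le> Y powr (1/4)"
    proof -
      have "sqrt P \<le> sqrt (sqrt Y)" using PY by simp
      also have "\<dots> = Y powr (1/4)" using Y by (simp flip: powr_half_sqrt add: powr_powr)
      finally show ?thesis .
    qed
    have "sqrt Y \<le> sqrt (Y * Y)" using Y by (intro real_sqrt_le_mono) simp
    then have "P \<le> Y" using PY Y by simp
    then have lP: "0 \<le> ln P" "ln P \<le> ln Y" using P3 by auto
    define S where "S y = (\<Sum>n=1..N. of_nat n powr (- Complex (1/2) (2 * y)))" for y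
    define z where "z y = zeta (Complex (1/2) (2 * y))" for y
    have contS: "continuous_on {1..Y} S"
      unfolding S_def Complex_eq
      by (intro continuous_intros) (auto simp: complex_nonpos_Reals_iff)
    have contz: "continuous_on {1..Y} z"
      unfolding z_def
      by (intro continuous_on_compose2[OF holomorphic_on_imp_continuous_on[OF holomorphic_zeta]])
         (auto simp: Complex_eq complex_eq_iff intro!: continuous_intros)
    have contt: "continuous_on {1..Y} (\<lambda>y. theta_factor (Complex (1/2) y))"
      by (rule continuous_on_theta_factor_line) simp
    have "integral {1..Y} (\<lambda>y. theta_factor (Complex (1/2) y) * z y) =
       integral {1..Y} (\<lambda>y. theta_factor (Complex (1/2) y) * (z y - S y) + theta_factor (Complex (1/2) y) * S y)"
      by (simp add: algebra_simps)
    also have "\<dots> = integral {1..Y} (\<lambda>y. theta_factor (Complex (1/2) y) * (z y - S y)) + integral {1..Y} (\<lambda>y. theta_factor (Complex (1/2) y) * S y)"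
      by (intro integral_add integrable_continuous_interval continuous_intros contS contz contt)
    also have "norm \<dots> \<le> C3 * sqrt P * (1 + ln P) + C2 * sqrt P * (1 + ln P)"
    proof (rule norm_triangle_mono)
      show "norm (integral {1..Y} (\<lambda>y. theta_factor (Complex (1/2) y) * (z y - S y))) \<le> C3 * sqrt P * (1 + ln P)"
        unfolding z_def S_def C3_def using C1 Y N
        by (intro theta_factor_zeta_remainder_bound) (auto simp: P_def)
      show "norm (integral {1..Y} (\<lambda>y. theta_factor (Complex (1/2) y) * S y)) \<le> C2 * sqrt P * (1 + ln P)"
        unfolding S_def P_def using Y N by (intro C2) (auto simp: P_def)
    qed
    also have "\<dots> = (C3 + C2) * (sqrt P * (1 + ln P))" by (simp add: algebra_simps)
    also have "\<dots> \<le> D * (Y powr (1/4) * (1 + ln Y))"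
      using sP lP P3 by (intro mult_mono) (auto simp: D_def)
    finally show ?thesis by (simp add: z_def mult.assoc)
  qed
  moreover have "D > 0" by (simp add: D_def add_nonneg_pos)
  ultimately show ?thesis by blast
qed

lemma continuous_on_hardy_Z: "continuous_on A hardy_Z"
proof -
  have "continuous_on UNIV chi_inv_sqrt"
    using theI'[OF chi_inv_sqrt_ex1] unfolding chi_inv_sqrt_def by blast
  then have "continuous_on A chi_inv_sqrt" by (rule continuous_on_subset) simp
  moreover have "continuous_on A (\<lambda>t. zeta (Complex (1/2) t))"
    by (intro continuous_on_compose2[OF holomorphic_on_imp_continuous_on[OF holomorphic_zeta]])
       (auto simp: Complex_eq complex_eq_iff intro!: continuous_intros)
  ultimately show ?thesis unfolding hardy_Z_def by (intro continuous_on_mult)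
qed

text \<open>After the substitution \<open>t = 2 * y\<close>, replacing the branch by
  \<open>\<kappa> * theta_factor\<close> leaves \<open>r\<close>, an \<open>O (1 / y)\<close> error
  times the bound \<open>O (y powr (1/4))\<close> for zeta, whose integral is again
  \<open>O (Y powr (1/4))\<close>. The interval \<open>[0, 2]\<close>, below the range of the
  asymptotics, enters only through the constant \<open>A\<close>.\<close>

lemma hardy_Z_integral_log_bound:
  "\<exists>C>0. \<forall>T\<ge>100. norm (integral {0..T} hardy_Z) \<le> C * T powr (1/4) * (1 + ln T)"
proof -
  obtain C1 where C1: "C1 > 0" "\<And>Y. Y \<ge> 50 \<Longrightarrow>
     norm (integral {1..Y} (\<lambda>y. theta_factor (Complex (1/2) y) * zeta (Complex (1/2) (2 * y)))) \<le> C1 * Y powr (1/4) * (1 + ln Y)"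
    using theta_factor_zeta_integral_bound by blast
  obtain \<kappa> C2 where C2: "\<And>y. y \<ge> 1 \<Longrightarrow> norm (chi_inv_sqrt (2 * y) - \<kappa> * theta_factor (Complex (1/2) y)) \<le> C2 / y"
    using chi_inv_sqrt_approx by blast
  \<comment> \<open>The sign of \<open>C2\<close> is known only through its inequality, read at
    \<open>y = 1\<close>.\<close>
  have "0 \<le> C2 / 1" by (rule order_trans[OF norm_ge_zero C2[of 1]]) simp
  then have C20: "C2 \<ge> 0" by simp
  define C3 where "C3 = C2 * (1002 * 2)"
  have C3: "C3 \<ge> 0" using C20 by (simp add: C3_def)
  define A where "A = norm (integral {0..2} hardy_Z)"
  define C where "C = A + 2 * (norm \<kappa> * C1 + 4 * C3) + 1"
  have "norm (integral {0..T} hardy_Z) \<le> C * T powr (1/4) * (1 + ln T)" if T: "T \<ge> 100" for T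
  proof -
    define Y where "Y = T / 2"
    have Y: "Y \<ge> 50" "T = 2 * Y" using T by (auto simp: Y_def)
    define z where "z y = zeta (Complex (1/2) (2 * y))" for y
    define r where "r y = (chi_inv_sqrt (2 * y) - \<kappa> * theta_factor (Complex (1/2) y)) * z y" for y
    have contz: "continuous_on {1..Y} z"
      unfolding z_def
      by (intro continuous_on_compose2[OF holomorphic_on_imp_continuous_on[OF holomorphic_zeta]])
         (auto simp: Complex_eq complex_eq_iff intro!: continuous_intros)
    have contt: "continuous_on {1..Y} (\<lambda>y. theta_factor (Complex (1/2) y))"
      by (rule continuous_on_theta_factor_line) simp
    have conth: "continuous_on {1..Y} (\<lambda>y. hardy_Z (2 * y))"
      by (intro continuous_on_compose2[OF continuous_on_hardy_Z[of UNIV]] continuous_intros) auto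
    have req: "r y = hardy_Z (2 * y) - \<kappa> * (theta_factor (Complex (1/2) y) * z y)" for y
      by (simp add: r_def z_def hardy_Z_def algebra_simps)
    have contr: "continuous_on {1..Y} r"
      unfolding req[abs_def] by (intro continuous_intros conth contt contz)
    have "norm (integral {1..Y} r) \<le> integral {1..Y} (\<lambda>y. C3 * y powr (-3/4))"
    proof (rule integral_norm_bound_integral)
      fix y assume y: "y \<in> {1..Y}"
      have "norm (z y) \<le> 1002 * (2 * y) powr (1/4)"
        unfolding z_def using y by (intro zeta_half_line_bound) auto
      also have "(2 * y) powr (1/4) = 2 powr (1/4) * y powr (1/4)" using y by (simp add: powr_mult)
      also have "2 powr (1/4) \<le> (2::real) powr 1" by (intro powr_mono) auto
      finally have "norm (z y) \<le> 1002 * 2 * y powr (1/4)" by (simp add: mult_right_mono)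
      then have "norm (r y) \<le> (C2 / y) * (1002 * 2 * y powr (1/4))"
        unfolding r_def norm_mult using C2[of y] y C20 by (intro mult_mono) auto
      also have "\<dots> = C3 * (y powr (1/4) / y powr 1)" using y by (simp add: C3_def)
      also have "y powr (1/4) / y powr 1 = y powr (-3/4)" by (subst powr_diff[symmetric]) simp
      finally show "norm (r y) \<le> C3 * y powr (-3/4)" .
    qed (auto intro!: integrable_continuous_interval contr continuous_intros)
    also have "\<dots> = C3 * (4 * Y powr (1/4) - 4 * 1 powr (1/4))"
    proof (rule integral_unique)
      have "((\<lambda>y. y powr (-3/4)) has_integral (4 * Y powr (1/4) - 4 * 1 powr (1/4))) {1..Y}"
        using Y by (intro fundamental_theorem_of_calculus)
          (auto intro!: derivative_eq_intros simp flip: has_real_derivative_iff_has_vector_derivative)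
      then show "((\<lambda>y. C3 * y powr (-3/4)) has_integral C3 * (4 * Y powr (1/4) - 4 * 1 powr (1/4))) {1..Y}"
        by (rule has_integral_mult_right)
    qed
    also have "\<dots> \<le> C3 * (4 * Y powr (1/4))" using C3 by (intro mult_left_mono) auto
    finally have rb: "norm (integral {1..Y} r) \<le> 4 * C3 * Y powr (1/4)" by simp
    have "integral {1..Y} (\<lambda>y. hardy_Z (2 * y)) = integral {1..Y} (\<lambda>y. \<kappa> * (theta_factor (Complex (1/2) y) * z y) + r y)"
      by (simp add: req)
    also have "\<dots> = \<kappa> * integral {1..Y} (\<lambda>y. theta_factor (Complex (1/2) y) * z y) + integral {1..Y} r"
      by (subst integral_add) (auto intro!: integrable_continuous_interval contr continuous_intros contt contz)
    also have "norm \<dots> \<le> norm \<kappa> * (C1 * Y powr (1/4) * (1 + ln Y)) + 4 * C3 * Y powr (1/4)"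
      using C1(2)[OF Y(1)] rb by (intro norm_triangle_mono) (auto simp: norm_mult z_def mult_left_mono)
    also have "\<dots> \<le> (norm \<kappa> * C1 + 4 * C3) * (T powr (1/4) * (1 + ln T))"
    proof -
      have a: "Y powr (1/4) \<le> T powr (1/4)" using Y by (intro powr_mono2) auto
      have b: "ln Y \<le> ln T" "0 \<le> ln Y" using Y by auto
      have "Y powr (1/4) * (1 + ln Y) \<le> T powr (1/4) * (1 + ln T)" using a b by (intro mult_mono) auto
      then have "norm \<kappa> * C1 * (Y powr (1/4) * (1 + ln Y)) \<le> norm \<kappa> * C1 * (T powr (1/4) * (1 + ln T))"
        using C1(1) by (intro mult_left_mono) auto
      moreover have "Y powr (1/4) * 1 \<le> T powr (1/4) * (1 + ln T)" using a b by (intro mult_mono) auto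
      then have "4 * C3 * Y powr (1/4) \<le> 4 * C3 * (T powr (1/4) * (1 + ln T))"
        using C3 by (intro mult_left_mono) auto
      ultimately show ?thesis by (simp add: algebra_simps)
    qed
    finally have h: "norm (integral {1..Y} (\<lambda>y. hardy_Z (2 * y))) \<le> (norm \<kappa> * C1 + 4 * C3) * (T powr (1/4) * (1 + ln T))" .
    have "integral ((\<lambda>x. x / 2) ` {2..T}) (\<lambda>y. hardy_Z (2 * y)) = (1 / \<bar>2\<bar>) *\<^sub>R integral {2..T} hardy_Z"
      by (rule integral_stretch_real) simp
    moreover have "(\<lambda>x. x / 2) ` {2..T} = {1..Y}"
    proof -
      have "(\<lambda>x. x / 2) ` {2..T} = {2 / 2..T / 2}" using T by simp
      then show ?thesis by (simp add: Y_def)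
    qed
    ultimately have "integral {1..Y} (\<lambda>y. hardy_Z (2 * y)) = (1 / \<bar>2\<bar>) *\<^sub>R integral {2..T} hardy_Z"
      by (simp only:)
    then have sub: "integral {2..T} hardy_Z = 2 * integral {1..Y} (\<lambda>y. hardy_Z (2 * y))"
      by (simp add: scaleR_conv_of_real mult.commute)
    have "integral {0..T} hardy_Z = integral {0..2} hardy_Z + integral {2..T} hardy_Z"
      using T by (intro Henstock_Kurzweil_Integration.integral_combine[symmetric] integrable_continuous_interval continuous_on_hardy_Z) auto
    also have "norm \<dots> \<le> A * (T powr (1/4) * (1 + ln T)) + 2 * ((norm \<kappa> * C1 + 4 * C3) * (T powr (1/4) * (1 + ln T)))"
    proof (rule norm_triangle_mono)
      have "1 * 1 \<le> T powr (1/4) * (1 + ln T)"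
        using T by (intro mult_mono) (auto simp: ge_one_powr_ge_zero)
      then have "A * 1 \<le> A * (T powr (1/4) * (1 + ln T))" by (intro mult_left_mono) (auto simp: A_def)
      then show "norm (integral {0..2} hardy_Z) \<le> A * (T powr (1/4) * (1 + ln T))" by (simp add: A_def)
      show "norm (integral {2..T} hardy_Z) \<le> 2 * ((norm \<kappa> * C1 + 4 * C3) * (T powr (1/4) * (1 + ln T)))"
        unfolding sub using h by (simp add: norm_mult)
    qed
    also have "\<dots> \<le> C * (T powr (1/4) * (1 + ln T))"
    proof -
      have "0 \<le> T powr (1/4) * (1 + ln T)" using T by simp
      then show ?thesis by (simp add: C_def algebra_simps)
    qed
    finally show ?thesis by (simp add: mult.assoc)
  qed
  moreover have "C > 0"
    unfolding C_def using C1(1) C3 by (intro add_nonneg_pos add_nonneg_nonneg mult_nonneg_nonneg) (auto simp: A_def)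
  ultimately show ?thesis by blast
qed

theorem mainTheorem1:
  shows "\<forall>\<epsilon>::real. \<epsilon> > 0 \<longrightarrow>
           (\<exists>C T0 :: real. C > 0 \<and> T0 > 0 \<and>
              (\<forall>T \<ge> T0. norm (integral {0..T} hardy_Z) \<le> C * T powr (1/4 + \<epsilon>)))"
proof (intro allI impI)
  fix \<epsilon> :: real assume \<epsilon>: "\<epsilon> > 0"
  obtain C where C: "C > 0" "\<And>T. T \<ge> 100 \<Longrightarrow> norm (integral {0..T} hardy_Z) \<le> C * T powr (1/4) * (1 + ln T)"
    using hardy_Z_integral_log_bound by blast
  have "norm (integral {0..T} hardy_Z) \<le> C * (1 + 1 / \<epsilon>) * T powr (1/4 + \<epsilon>)" if T: "T \<ge> 100" for T
  proof -
    \<comment> \<open>The logarithm is traded for \<open>T powr \<epsilon>\<close>: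
      \<open>1 / \<epsilon>\<close> enters the constant, while the threshold 100 is the same for all
      \<open>\<epsilon>\<close>.\<close>
    have "ln T \<le> T powr \<epsilon> / \<epsilon>" using T \<epsilon> by (intro ln_powr_bound) auto
    moreover have "1 \<le> T powr \<epsilon>" using T \<epsilon> by (intro ge_one_powr_ge_zero) auto
    ultimately have "1 + ln T \<le> (1 + 1 / \<epsilon>) * T powr \<epsilon>" by (simp add: algebra_simps)
    then have "C * T powr (1/4) * (1 + ln T) \<le> C * T powr (1/4) * ((1 + 1 / \<epsilon>) * T powr \<epsilon>)"
      using C(1) by (intro mult_left_mono) auto
    also have "\<dots> = C * (1 + 1 / \<epsilon>) * T powr (1/4 + \<epsilon>)" by (simp add: powr_add)
    finally show ?thesis using C(2)[OF T] by linarith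
  qed
  then show "\<exists>C T0 :: real. C > 0 \<and> T0 > 0 \<and>
              (\<forall>T \<ge> T0. norm (integral {0..T} hardy_Z) \<le> C * T powr (1/4 + \<epsilon>))"
    using C(1) \<epsilon> by (intro exI[of _ "C * (1 + 1 / \<epsilon>)"] exI[of _ 100]) (auto intro!: mult_pos_pos add_pos_pos)
qed

end
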